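(* Let $H$ be a polycyclic-by-finite group. Then the group $\chi(H)$ and the non-commutative tensor square $H\otimes H$ are also polycyclic-by-finite.
   Context: A group is polycyclic-by-finite if it has a normal polycyclic subgroup of finite index. Conventions: $x^{y}=y^{-1}xy$ and $[x,y]=x^{-1}y^{-1}xy$. For a group $H$, let $H^{\psi}$ be an isomorphic copy of $H$ via an isomorphism $\psi: h\mapsto h^{\psi}$. The weak commutativity group is $$\chi(H)=\langle H, H^{\psi}\mid [h,h^{\psi}]=1\ \ \forall h\in H\rangle,$$ i.e. the quotient of the free product $H*H^{\psi}$ by the normal closure of all $[h,h^{\psi}]$, $h\in H$. The non-commutative (non-abelian) tensor square $H\otimes H$ is the group generated by the symbols $h_1\otimes h_2$ ($h_1,h_2\in H$) subject to the relations $$h_1h_2\otimes h_3=(h_1^{h_2}\otimes h_3^{h_2})(h_2\otimes h_3),\qquad h_1\otimes h_2h_3=(h_1\otimes h_3)(h_1^{h_3}\otimes h_2^{h_3})$$ for all $h_1,h_2,h_3\in H$. *)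

theory Defs
  imports "HOL-Algebra.Elementary_Groups" "HOL-Algebra.Generated_Groups"
begin

section \<open>Polycyclic-by-finite groups\<close>

definition polycyclic :: "('a, 'b) monoid_scheme \<Rightarrow> bool" where
  "polycyclic G \<longleftrightarrow> group G \<and>
    (\<exists>(n::nat) S. S 0 = {\<one>\<^bsub>G\<^esub>} \<and> S n = carrier G \<and>
      (\<forall>i<n. S i \<lhd> (G\<lparr>carrier := S (Suc i)\<rparr>) \<and>
             cyclic_group ((G\<lparr>carrier := S (Suc i)\<rparr>) Mod (S i))))"

definition polycyclic_by_finite :: "('a, 'b) monoid_scheme \<Rightarrow> bool" where
  "polycyclic_by_finite G \<longleftrightarrow> group G \<and>
    (\<exists>N. N \<lhd> G \<and> polycyclic (G\<lparr>carrier := N\<rparr>) \<and> finite (rcosets\<^bsub>G\<^esub> N))"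


section \<open>Conjugates, commutators and normal closures\<close>

text \<open>The conventions are \<open>x\<^sup>y = y\<inverse>xy\<close> and \<open>[x,y] = x\<inverse>y\<inverse>xy\<close>.\<close>

definition conjugate :: "('a, 'b) monoid_scheme \<Rightarrow> 'a \<Rightarrow> 'a \<Rightarrow> 'a" where
  "conjugate G x y = inv\<^bsub>G\<^esub> y \<otimes>\<^bsub>G\<^esub> x \<otimes>\<^bsub>G\<^esub> y"

definition commutator :: "('a, 'b) monoid_scheme \<Rightarrow> 'a \<Rightarrow> 'a \<Rightarrow> 'a" where
  "commutator G x y = inv\<^bsub>G\<^esub> x \<otimes>\<^bsub>G\<^esub> inv\<^bsub>G\<^esub> y \<otimes>\<^bsub>G\<^esub> x \<otimes>\<^bsub>G\<^esub> y"

definition normal_closure :: "('a, 'b) monoid_scheme \<Rightarrow> 'a set \<Rightarrow> 'a set" where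
  "normal_closure G S = \<Inter>{N. N \<lhd> G \<and> S \<subseteq> N}"

lemma (in group) normal_closure_normal:
  assumes "S \<subseteq> carrier G"
  shows "normal_closure G S \<lhd> G"
proof -
  have G: "carrier G \<lhd> G"
    by (rule normal_invI[OF subgroup_self]) auto
  have "subgroup (\<Inter>{N. N \<lhd> G \<and> S \<subseteq> N}) G"
    using G assms by (intro subgroups_Inter) (auto simp: normal_inv_iff)
  then show ?thesis
    unfolding normal_closure_def by (intro normal_invI) (auto simp: normal_inv_iff)
qed


section \<open>Free groups\<close>

text \<open>
  A letter is a generator \<open>x\<close> with a sign: \<open>(x, True)\<close> stands for \<open>x\<close> and
  \<open>(x, False)\<close> for \<open>x\<inverse>\<close>.  The elements of the free group are the freely
  reduced words; the product is concatenation followed by free reduction.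
\<close>

fun reduced :: "('a \<times> bool) list \<Rightarrow> bool" where
  "reduced [] = True"
| "reduced [a] = True"
| "reduced (a # b # w) = (b \<noteq> (fst a, \<not> snd a) \<and> reduced (b # w))"

fun cons_reduce :: "'a \<times> bool \<Rightarrow> ('a \<times> bool) list \<Rightarrow> ('a \<times> bool) list" where
  "cons_reduce a [] = [a]"
| "cons_reduce a (b # w) = (if b = (fst a, \<not> snd a) then w else a # b # w)"

definition free_group :: "'a set \<Rightarrow> ('a \<times> bool) list monoid" where
  "free_group X =
    \<lparr>carrier = {w. set w \<subseteq> X \<times> UNIV \<and> reduced w},
     monoid.mult = foldr cons_reduce,
     one = []\<rparr>"

lemma reduced_tl: "reduced (a # w) \<Longrightarrow> reduced w"
  by (cases w) auto

lemma reduced_cons_reduce: "reduced w \<Longrightarrow> reduced (cons_reduce a w)"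
  by (cases w) (auto dest: reduced_tl)

lemma reduced_foldr: "reduced w \<Longrightarrow> reduced (foldr cons_reduce u w)"
  by (induction u) (auto simp: reduced_cons_reduce)

lemma set_cons_reduce: "set (cons_reduce a w) \<subseteq> insert a (set w)"
  by (cases w) auto

lemma set_foldr: "set (foldr cons_reduce u w) \<subseteq> set u \<union> set w"
proof (induction u)
  case (Cons a u)
  then show ?case using set_cons_reduce[of a "foldr cons_reduce u w"] by auto
qed auto

lemma cons_reduce_cancel:
  assumes "reduced w"
  shows "cons_reduce (x, s) (cons_reduce (x, \<not> s) w) = w"
proof (cases w)
  case (Cons b v)
  then show ?thesis using assms by (cases v) auto
qed auto

lemma foldr_cons_reduce:
  assumes "reduced w"
  shows "foldr cons_reduce (cons_reduce a u) w = cons_reduce a (foldr cons_reduce u w)"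
proof (cases u)
  case (Cons b v)
  then show ?thesis
    using cons_reduce_cancel[OF reduced_foldr[OF assms, of v], of "fst a" "snd a"] by auto
qed auto

lemma foldr_cons_reduce_assoc:
  assumes "reduced w"
  shows "foldr cons_reduce (foldr cons_reduce u v) w =
         foldr cons_reduce u (foldr cons_reduce v w)"
  by (induction u) (auto simp: foldr_cons_reduce assms)

lemma foldr_cons_reduce_Nil: "reduced u \<Longrightarrow> foldr cons_reduce u [] = u"
proof (induction u)
  case (Cons a u)
  then show ?case by (cases u) auto
qed auto

lemma foldr_cons_reduce_inverse:
  assumes "reduced w"
  shows "foldr cons_reduce (rev (map (\<lambda>(x, s). (x, \<not> s)) u)) (foldr cons_reduce u w) = w"
  using assms
proof (induction u)
  case (Cons a u)
  obtain x s where "a = (x, s)" by fastforce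
  with Cons show ?case
    using cons_reduce_cancel[OF reduced_foldr[OF Cons.prems, of u], of x "\<not> s"] by auto
qed auto

lemma group_free_group: "group (free_group X)"
proof (rule groupI)
  fix u v assume "u \<in> carrier (free_group X)" "v \<in> carrier (free_group X)"
  then show "u \<otimes>\<^bsub>free_group X\<^esub> v \<in> carrier (free_group X)"
    using set_foldr[of u v] by (auto simp: free_group_def reduced_foldr)
next
  fix u assume u: "u \<in> carrier (free_group X)"
  let ?i = "rev (map (\<lambda>(x, s). (x, \<not> s)) u)"
  let ?v = "foldr cons_reduce ?i []"
  have "?v \<in> carrier (free_group X)"
    using u set_foldr[of ?i "[]"] by (auto simp: free_group_def reduced_foldr)
  moreover have "foldr cons_reduce ?v u = []"
  proof -
    have "foldr cons_reduce ?v u = foldr cons_reduce ?i u"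
      using u by (simp add: foldr_cons_reduce_assoc free_group_def)
    also have "u = foldr cons_reduce u []"
      using u by (simp add: foldr_cons_reduce_Nil free_group_def)
    then have "foldr cons_reduce ?i u = []"
      using foldr_cons_reduce_inverse[of "[]" u] by simp
    finally show ?thesis .
  qed
  ultimately show "\<exists>v\<in>carrier (free_group X). v \<otimes>\<^bsub>free_group X\<^esub> u = \<one>\<^bsub>free_group X\<^esub>"
    by (auto simp: free_group_def)
qed (auto simp: free_group_def foldr_cons_reduce_assoc)


section \<open>Groups given by generators and relations\<close>

definition free_gen :: "'a \<Rightarrow> ('a \<times> bool) list" where
  "free_gen x = [(x, True)]"

text \<open>
  A relation \<open>l = r\<close> between elements of the free group is encoded as the pair \<open>(l, r)\<close>.
\<close>

definition relator_closure ::
    "'a set \<Rightarrow> (('a \<times> bool) list \<times> ('a \<times> bool) list) set \<Rightarrow> ('a \<times> bool) list set" where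
  "relator_closure X E =
    normal_closure (free_group X)
      {l \<otimes>\<^bsub>free_group X\<^esub> inv\<^bsub>free_group X\<^esub> r | l r. (l, r) \<in> E}"

definition presented_group ::
    "'a set \<Rightarrow> (('a \<times> bool) list \<times> ('a \<times> bool) list) set \<Rightarrow> ('a \<times> bool) list set monoid" where
  "presented_group X E = free_group X Mod relator_closure X E"

definition presented_gen ::
    "'a set \<Rightarrow> (('a \<times> bool) list \<times> ('a \<times> bool) list) set \<Rightarrow> 'a \<Rightarrow> ('a \<times> bool) list set" where
  "presented_gen X E x = relator_closure X E #>\<^bsub>free_group X\<^esub> free_gen x"

lemma group_presented_group:
  assumes "E \<subseteq> carrier (free_group X) \<times> carrier (free_group X)"
  shows "group (presented_group X E)"
proof -
  interpret F: group "free_group X" by (rule group_free_group)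
  have "relator_closure X E \<lhd> free_group X"
    unfolding relator_closure_def using assms by (intro F.normal_closure_normal) blast
  then show ?thesis
    unfolding presented_group_def by (rule normal.factorgroup_is_group)
qed

lemma free_gen_closed: "x \<in> X \<Longrightarrow> free_gen x \<in> carrier (free_group X)"
  by (simp add: free_group_def free_gen_def)

lemma presented_gen_closed:
  "x \<in> X \<Longrightarrow> presented_gen X E x \<in> carrier (presented_group X E)"
  using free_gen_closed[of x X]
  by (auto simp: presented_group_def presented_gen_def FactGroup_def RCOSETS_def)


section \<open>Free products\<close>

text \<open>The relations are those of the multiplication tables of the two factors.\<close>

definition free_product_rels ::
    "('a, 'c) monoid_scheme \<Rightarrow> ('b, 'd) monoid_scheme \<Rightarrow>
     ((('a + 'b) \<times> bool) list \<times> (('a + 'b) \<times> bool) list) set" where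
  "free_product_rels G K =
    (let F = free_group (carrier G <+> carrier K) in
      {(free_gen (Inl x) \<otimes>\<^bsub>F\<^esub> free_gen (Inl y), free_gen (Inl (x \<otimes>\<^bsub>G\<^esub> y))) | x y.
         x \<in> carrier G \<and> y \<in> carrier G} \<union>
      {(free_gen (Inr x) \<otimes>\<^bsub>F\<^esub> free_gen (Inr y), free_gen (Inr (x \<otimes>\<^bsub>K\<^esub> y))) | x y.
         x \<in> carrier K \<and> y \<in> carrier K})"

definition free_product ::
    "('a, 'c) monoid_scheme \<Rightarrow> ('b, 'd) monoid_scheme \<Rightarrow> (('a + 'b) \<times> bool) list set monoid" where
  "free_product G K = presented_group (carrier G <+> carrier K) (free_product_rels G K)"

definition free_product_inl ::
    "('a, 'c) monoid_scheme \<Rightarrow> ('b, 'd) monoid_scheme \<Rightarrow> 'a \<Rightarrow> (('a + 'b) \<times> bool) list set" where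
  "free_product_inl G K x =
    presented_gen (carrier G <+> carrier K) (free_product_rels G K) (Inl x)"

definition free_product_inr ::
    "('a, 'c) monoid_scheme \<Rightarrow> ('b, 'd) monoid_scheme \<Rightarrow> 'b \<Rightarrow> (('a + 'b) \<times> bool) list set" where
  "free_product_inr G K x =
    presented_gen (carrier G <+> carrier K) (free_product_rels G K) (Inr x)"

lemma group_free_product:
  assumes "group G" "group K"
  shows "group (free_product G K)"
proof -
  interpret G: group G by fact
  interpret K: group K by fact
  interpret F: group "free_group (carrier G <+> carrier K)" by (rule group_free_group)
  show ?thesis
    unfolding free_product_def
    by (rule group_presented_group)
      (auto simp: free_product_rels_def Let_def intro!: F.m_closed free_gen_closed)
qed


section \<open>The weak commutativity group\<close>

text \<open>
  In \<open>free_product H H\<close> the left factor is \<open>H\<close>, the right factor is the copy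
  \<open>H\<^sup>\<psi>\<close>, and \<open>\<psi>\<close> maps \<open>free_product_inl H H h\<close> to \<open>free_product_inr H H h\<close>.
\<close>

definition weak_commutativity_group ::
    "('a, 'b) monoid_scheme \<Rightarrow> (('a + 'a) \<times> bool) list set set monoid" where
  "weak_commutativity_group H =
    free_product H H Mod
      normal_closure (free_product H H)
        {commutator (free_product H H) (free_product_inl H H h) (free_product_inr H H h) | h.
           h \<in> carrier H}"

lemma group_weak_commutativity_group:
  assumes "group H"
  shows "group (weak_commutativity_group H)"
proof -
  interpret P: group "free_product H H" using assms by (intro group_free_product)
  have cl: "free_product_inl H H h \<in> carrier (free_product H H)"
    "free_product_inr H H h \<in> carrier (free_product H H)" if "h \<in> carrier H" for h
    using that presented_gen_closed
    unfolding free_product_def free_product_inl_def free_product_inr_def by (metis InlI InrI)+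
  show ?thesis
    unfolding weak_commutativity_group_def
    by (intro normal.factorgroup_is_group P.normal_closure_normal)
      (auto simp: commutator_def cl)
qed


section \<open>The non-abelian tensor square\<close>

text \<open>The generator \<open>h\<^sub>1 \<otimes> h\<^sub>2\<close> is the pair \<open>(h\<^sub>1, h\<^sub>2)\<close>.\<close>

definition tensor_square_rels ::
    "('a, 'b) monoid_scheme \<Rightarrow> ((('a \<times> 'a) \<times> bool) list \<times> (('a \<times> 'a) \<times> bool) list) set" where
  "tensor_square_rels H =
    (let F = free_group (carrier H \<times> carrier H) in
      {(free_gen (a \<otimes>\<^bsub>H\<^esub> b, c),
        free_gen (conjugate H a b, conjugate H c b) \<otimes>\<^bsub>F\<^esub> free_gen (b, c)) | a b c.
         a \<in> carrier H \<and> b \<in> carrier H \<and> c \<in> carrier H} \<union>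
      {(free_gen (a, b \<otimes>\<^bsub>H\<^esub> c),
        free_gen (a, c) \<otimes>\<^bsub>F\<^esub> free_gen (conjugate H a c, conjugate H b c)) | a b c.
         a \<in> carrier H \<and> b \<in> carrier H \<and> c \<in> carrier H})"

definition tensor_square ::
    "('a, 'b) monoid_scheme \<Rightarrow> (('a \<times> 'a) \<times> bool) list set monoid" where
  "tensor_square H = presented_group (carrier H \<times> carrier H) (tensor_square_rels H)"

lemma group_tensor_square:
  assumes "group H"
  shows "group (tensor_square H)"
proof -
  interpret H: group H by fact
  interpret F: group "free_group (carrier H \<times> carrier H)" by (rule group_free_group)
  show ?thesis
    unfolding tensor_square_def
    by (rule group_presented_group)
      (auto simp: tensor_square_rels_def Let_def conjugate_def intro!: F.m_closed free_gen_closed)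
qed

end

theory Submission
  imports Defs
begin

text \<open>
  Everything rests on one principle (\<open>fin_gen_central_extension_series\<close>):
  if \<open>Z\<close> is central in \<open>E\<close>, the quotient \<open>E / Z\<close> is polycyclic-by-finite and \<open>E\<close> is finitely
  generated, then \<open>E\<close> is polycyclic-by-finite. The reason is that \<open>E / Z\<close> is finitely presented,
  so \<open>Z\<close> is finitely generated; the proof given here descends along a series of \<open>E / Z\<close>
  instead of using presentations.
  
  For \<open>\<chi>(H)\<close> let \<open>D\<close> be the subgroup generated by the \<open>[a, b\<^sup>\<psi>]\<close> and \<open>L\<close> the one generated by the
  \<open>\<ell>\<^sub>h = h\<inverse>h\<^sup>\<psi>\<close>. Both are normal. The quotient by \<open>D\<close> is an image of \<open>H \<times> H\<close> and the quotient
  by \<open>L\<close> is an image of \<open>H\<close>, so it suffices to treat \<open>L\<close>, and \<open>L / (D \<inter> L)\<close> is under control.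
  The identity \<open>[a, b\<^sup>\<psi>] = [a\<^sup>\<psi>, b]\<close> forces \<open>h\<close> and \<open>h\<^sup>\<psi>\<close> to act alike on \<open>D\<close>, that is,
  \<open>[D, L] = 1\<close>, so \<open>D \<inter> L\<close> is central in \<open>L\<close>. Finally \<open>L\<close> is finitely generated: the relations
  give \<open>\<ell>\<^bsub>xyx\<^esub> = \<ell>\<^sub>x\<ell>\<^sub>y\<ell>\<^sub>x\<close>, so the \<open>h\<close> with \<open>\<ell>\<^sub>h\<close> in a given subgroup form a set closed under
  inverses and \<open>(x, y) \<mapsto> xyx\<close>, and a polycyclic-by-finite group is finitely generated under
  these operations alone (\<open>series_twisted_basis\<close>).
  
  For \<open>H \<otimes> H\<close>, expanding \<open>ab \<otimes> cd\<close> in two ways shows that \<open>b \<otimes> d\<close> acts by conjugation on the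
  generators \<open>x \<otimes> y\<close> as \<open>[b, d]\<close> acts on \<open>H\<close>. Hence \<open>H \<otimes> H\<close> modulo its centre is a section of \<open>H\<close>,
  and only finite generation is left. It is proved by climbing a series of \<open>H\<close>: if \<open>N\<close> is normal
  in \<open>K\<close>, then modulo the \<open>n \<otimes> m\<close> with \<open>n, m \<in> N\<close> the maps \<open>n \<mapsto> n \<otimes> r\<close> and \<open>n \<mapsto> r \<otimes> n\<close> are
  multiplicative enough for generators of \<open>N\<close> to suffice.
  
  Both arguments only bound groups from above. So all that is used of a presented group is
  that its generators generate and its relations hold; no map out of it is ever constructed.
\<close>

section \<open>Subnormal series with cyclic or finite factors\<close>

text \<open>
  The exponents in \<open>k \<otimes> t [^] i \<in> N\<close> and the multipliers in \<open>k \<otimes> f \<in> N\<close> stand for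
  inverses of coset representatives. Stated in this form, neither condition mentions a
  quotient group, and all steps live inside one fixed group.
\<close>
definition cyclic_step :: "('a, 'b) monoid_scheme \<Rightarrow> 'a set \<Rightarrow> 'a set \<Rightarrow> bool" where
  "cyclic_step G N K \<longleftrightarrow> subgroup N G \<and> subgroup K G \<and> N \<subseteq> K \<and>
     (\<forall>k\<in>K. \<forall>n\<in>N. k \<otimes>\<^bsub>G\<^esub> n \<otimes>\<^bsub>G\<^esub> inv\<^bsub>G\<^esub> k \<in> N) \<and>
     (\<exists>t\<in>K. \<forall>k\<in>K. \<exists>i::int. k \<otimes>\<^bsub>G\<^esub> t [^]\<^bsub>G\<^esub> i \<in> N)"

definition finite_step :: "('a, 'b) monoid_scheme \<Rightarrow> 'a set \<Rightarrow> 'a set \<Rightarrow> bool" where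
  "finite_step G N K \<longleftrightarrow> subgroup N G \<and> subgroup K G \<and> N \<subseteq> K \<and>
     (\<forall>k\<in>K. \<forall>n\<in>N. k \<otimes>\<^bsub>G\<^esub> n \<otimes>\<^bsub>G\<^esub> inv\<^bsub>G\<^esub> k \<in> N) \<and>
     (\<exists>F. finite F \<and> F \<subseteq> K \<and> (\<forall>k\<in>K. \<exists>f\<in>F. k \<otimes>\<^bsub>G\<^esub> f \<in> N))"

definition series_step :: "('a, 'b) monoid_scheme \<Rightarrow> 'a set \<Rightarrow> 'a set \<Rightarrow> bool" where
  "series_step G N K \<longleftrightarrow> cyclic_step G N K \<or> finite_step G N K"

abbreviation series :: "('a, 'b) monoid_scheme \<Rightarrow> 'a set \<Rightarrow> 'a set \<Rightarrow> bool" where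
  "series G \<equiv> (series_step G)\<^sup>*\<^sup>*"

definition fin_gen :: "('a, 'b) monoid_scheme \<Rightarrow> 'a set \<Rightarrow> bool" where
  "fin_gen G M \<longleftrightarrow> (\<exists>X. finite X \<and> X \<subseteq> carrier G \<and> M = generate G X)"

lemma (in group) inv_cancel [simp]:
  assumes "x \<in> carrier G" "y \<in> carrier G"
  shows "x \<otimes> (inv x \<otimes> y) = y" "inv x \<otimes> (x \<otimes> y) = y"
  using assms by (simp_all add: m_assoc[symmetric])

lemma cyclic_stepD:
  assumes "cyclic_step G N K"
  shows "subgroup N G" "subgroup K G" "N \<subseteq> K"
    "\<And>k n. k \<in> K \<Longrightarrow> n \<in> N \<Longrightarrow> k \<otimes>\<^bsub>G\<^esub> n \<otimes>\<^bsub>G\<^esub> inv\<^bsub>G\<^esub> k \<in> N"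
    "\<exists>t\<in>K. \<forall>k\<in>K. \<exists>i::int. k \<otimes>\<^bsub>G\<^esub> t [^]\<^bsub>G\<^esub> i \<in> N"
  using assms unfolding cyclic_step_def by blast+

lemma finite_stepD:
  assumes "finite_step G N K"
  shows "subgroup N G" "subgroup K G" "N \<subseteq> K"
    "\<exists>F. finite F \<and> F \<subseteq> K \<and> (\<forall>k\<in>K. \<exists>f\<in>F. k \<otimes>\<^bsub>G\<^esub> f \<in> N)"
    "\<And>k n. k \<in> K \<Longrightarrow> n \<in> N \<Longrightarrow> k \<otimes>\<^bsub>G\<^esub> n \<otimes>\<^bsub>G\<^esub> inv\<^bsub>G\<^esub> k \<in> N"
  using assms unfolding finite_step_def by blast+

lemma series_stepD:
  assumes "series_step G N K"
  shows "subgroup N G" "subgroup K G" "N \<subseteq> K"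
    "\<And>k n. k \<in> K \<Longrightarrow> n \<in> N \<Longrightarrow> k \<otimes>\<^bsub>G\<^esub> n \<otimes>\<^bsub>G\<^esub> inv\<^bsub>G\<^esub> k \<in> N"
  using assms cyclic_stepD(1-4)[of G N K] finite_stepD(1-3,5)[of G N K]
  unfolding series_step_def by blast+

lemma series_subgroup:
  assumes "series G A B" "subgroup A G"
  shows "subgroup B G" "A \<subseteq> B"
proof -
  have "subgroup B G \<and> A \<subseteq> B"
    using assms by (induction rule: rtranclp_induct) (use series_stepD in blast)+
  then show "subgroup B G" "A \<subseteq> B" by auto
qed

lemma int_subgroup_principal:
  fixes I :: "int set"
  assumes "0 \<in> I" "\<And>i j. i \<in> I \<Longrightarrow> j \<in> I \<Longrightarrow> i + j \<in> I" "\<And>i. i \<in> I \<Longrightarrow> - i \<in> I"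
  shows "\<exists>d\<in>I. \<forall>i\<in>I. d dvd i"
proof (cases "\<exists>n>0. int n \<in> I")
  case False
  have "i = 0" if "i \<in> I" for i
    using False assms(3)[OF that] that
    by (metis neg_0_less_iff_less not_less_iff_gr_or_eq of_nat_0_less_iff zero_less_imp_eq_int)
  then show ?thesis using assms(1) by auto
next
  case True
  define d where "d = (LEAST n. n > 0 \<and> int n \<in> I)"
  have d: "d > 0" "int d \<in> I" using LeastI_ex[OF True] unfolding d_def by auto
  have mult: "int d * int n \<in> I" for n
    by (induction n) (use assms d in \<open>auto simp: algebra_simps\<close>)
  have mult': "int d * q \<in> I" for q
    using mult[of "nat q"] assms(3)[OF mult[of "nat (- q)"]] by (cases "q \<ge> 0") auto
  have "int d dvd i" if i: "i \<in> I" for i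
  proof (rule ccontr)
    assume nd: "\<not> int d dvd i"
    have "i mod int d = i + int d * (- (i div int d))"
      by (simp add: minus_mult_div_eq_mod[symmetric])
    then have m: "i mod int d \<in> I" using assms(2)[OF i mult'] by metis
    have "i mod int d \<noteq> 0" "i mod int d \<ge> 0" using nd d by (auto simp: dvd_eq_mod_eq_0)
    then have p: "i mod int d > 0" by linarith
    then have "d \<le> nat (i mod int d)"
      using m Least_le[of "\<lambda>n. n > 0 \<and> int n \<in> I" "nat (i mod int d)"] unfolding d_def[symmetric] by auto
    then show False using p d pos_mod_bound[of "int d" i] by linarith
  qed
  then show ?thesis using d by auto
qed

lemma int_pow_DirProd:
  fixes i :: int
  assumes "group G" "group H" "x \<in> carrier G" "y \<in> carrier H"
  shows "(x, y) [^]\<^bsub>G \<times>\<times> H\<^esub> i = (x [^]\<^bsub>G\<^esub> i, y [^]\<^bsub>H\<^esub> i)"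
proof (rule prod_eqI)
  have D: "group (G \<times>\<times> H)" using assms DirProd_group by blast
  have "fst \<in> hom (G \<times>\<times> H) G" "snd \<in> hom (G \<times>\<times> H) H"
    by (auto simp: hom_def)
  then show "fst ((x, y) [^]\<^bsub>G \<times>\<times> H\<^esub> i) = fst (x [^]\<^bsub>G\<^esub> i, y [^]\<^bsub>H\<^esub> i)"
    "snd ((x, y) [^]\<^bsub>G \<times>\<times> H\<^esub> i) = snd (x [^]\<^bsub>G\<^esub> i, y [^]\<^bsub>H\<^esub> i)"
    using hom_int_pow[of fst "G \<times>\<times> H" G "(x,y)" i] hom_int_pow[of snd "G \<times>\<times> H" H "(x,y)" i] assms D
    by auto
qed

text \<open>
  The pairs \<open>(k, i)\<close> with \<open>k N = t\<^bsup>-i\<^esup> N\<close> form the graph of a homomorphism from \<open>K\<close> to \<open>\<int>\<close>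
  modulo the order of \<open>t\<close> in \<open>K / N\<close>; working with the graph avoids a case distinction on
  that order.
\<close>
lemma (in group) cyclic_step_exponents:
  assumes st: "cyclic_step G N K" and t: "t \<in> K"
  shows "subgroup {(k, i). k \<in> K \<and> k \<otimes> t [^] i \<in> N} (G \<times>\<times> integer_group)"
proof -
  note D = cyclic_stepD[OF st]
  interpret N: subgroup N G by (rule D)
  interpret K: subgroup K G by (rule D)
  interpret P: group "G \<times>\<times> integer_group" by (simp add: DirProd_group)
  show ?thesis
  proof (rule P.subgroupI, goal_cases)
    case 1 then show ?case by auto
  next
    case 2 then show ?case using K.one_closed by (auto intro!: exI[of _ \<one>] exI[of _ "0::int"])
  next
    case (3 a)
    then obtain k i where a: "a = (k, i)" "k \<in> K" "k \<otimes> t [^] i \<in> N" by auto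
    have "t [^] i \<in> K" using t subgroup_int_pow_closed K.subgroup_axioms by blast
    then have "t [^] i \<otimes> (k \<otimes> t [^] i) \<otimes> inv (t [^] i) \<in> N" using D a by blast
    then have "inv (t [^] i \<otimes> k) \<in> N" using a t by (simp add: m_assoc)
    then show ?case using a t by (simp add: inv_mult_group int_pow_neg)
  next
    case (4 a b)
    then obtain k i l j where a: "a = (k, i)" "k \<in> K" "k \<otimes> t [^] i \<in> N"
      and b: "b = (l, j)" "l \<in> K" "l \<otimes> t [^] j \<in> N" by auto
    have "(k \<otimes> (l \<otimes> t [^] j) \<otimes> inv k) \<otimes> (k \<otimes> t [^] i) \<in> N" using D a b by blast
    then have "k \<otimes> l \<otimes> t [^] (i + j) \<in> N" using a b t
      by (simp add: m_assoc add.commute[of i] int_pow_mult)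
    then show ?case using a b by simp
  qed
qed

section \<open>Transport of series along relations\<close>

text \<open>
  A subgroup \<open>R\<close> of \<open>H \<times> G\<close> is a multivalued partial homomorphism. Images, preimages and
  intersections with a subgroup are all of the form \<open>R `` A\<close>, so transporting series along
  such relations settles these cases, and also the action of the tensor square, at once.
\<close>
lemma subgroup_Image:
  assumes "group G" "group H" "subgroup R (H \<times>\<times> G)" "subgroup A H"
  shows "subgroup (R `` A) G"
proof -
  interpret G: group G by fact
  interpret H: group H by fact
  interpret R: subgroup R "H \<times>\<times> G" by fact
  interpret A: subgroup A H by fact
  show ?thesis
  proof (rule G.subgroupI)
    show "R `` A \<subseteq> carrier G" using R.subset by auto
    have "(\<one>\<^bsub>H\<^esub>, \<one>\<^bsub>G\<^esub>) \<in> R" using R.one_closed by simp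
    then show "R `` A \<noteq> {}" using A.one_closed by blast
  next
    fix g assume "g \<in> R `` A"
    then obtain a where a: "a \<in> A" "(a, g) \<in> R" by auto
    then have c: "a \<in> carrier H" "g \<in> carrier G" using R.subset by auto
    have "inv\<^bsub>H \<times>\<times> G\<^esub> (a, g) \<in> R" by (rule R.m_inv_closed[OF a(2)])
    then have "(inv\<^bsub>H\<^esub> a, inv\<^bsub>G\<^esub> g) \<in> R" by (simp only: inv_DirProd[OF assms(2,1) c])
    then show "inv\<^bsub>G\<^esub> g \<in> R `` A" using a by auto
  next
    fix g h assume "g \<in> R `` A" "h \<in> R `` A"
    then obtain a b where a: "a \<in> A" "(a, g) \<in> R" "b \<in> A" "(b, h) \<in> R" by auto
    then have "(a \<otimes>\<^bsub>H\<^esub> b, g \<otimes>\<^bsub>G\<^esub> h) \<in> R" using R.m_closed[of "(a, g)" "(b, h)"] by simp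
    then show "g \<otimes>\<^bsub>G\<^esub> h \<in> R `` A" using a by auto
  qed
qed

text \<open>
  A generator of the image step is a partner \<open>g\<^sub>0\<close> of an element \<open>k\<^sub>0 \<in> t\<^bsup>-d\<^esup> N\<close> in the domain of \<open>R\<close>,
  where \<open>d\<close> generates the group of all exponents that occur in the domain: a subgroup of
  \<open>\<int>\<close> is cyclic.
\<close>
lemma cyclic_step_Image:
  assumes "group G" "group H" and R: "subgroup R (H \<times>\<times> G)" and st: "cyclic_step H N K"
  shows "cyclic_step G (R `` N) (R `` K)"
proof -
  interpret G: group G by fact
  interpret H: group H by fact
  interpret R: subgroup R "H \<times>\<times> G" by fact
  note D = cyclic_stepD[OF st]
  interpret N: subgroup N H by (rule D)
  interpret K: subgroup K H by (rule D)
  obtain t where t: "t \<in> K" "\<forall>k\<in>K. \<exists>i::int. k \<otimes>\<^bsub>H\<^esub> t [^]\<^bsub>H\<^esub> i \<in> N" using D(5) by blast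
  have Rc: "k \<in> carrier H" "g \<in> carrier G" if "(k, g) \<in> R" for k g using that R.subset by auto
  have Ri: "(inv\<^bsub>H\<^esub> k, inv\<^bsub>G\<^esub> g) \<in> R" if "(k, g) \<in> R" for k g
    using R.m_inv_closed[OF that] Rc[OF that] by (simp add: inv_DirProd assms)
  have Rm: "(k \<otimes>\<^bsub>H\<^esub> l, g \<otimes>\<^bsub>G\<^esub> h) \<in> R" if "(k, g) \<in> R" "(l, h) \<in> R" for k l g h
    using R.m_closed[OF that] by simp
  define P where "P = {(k, i). k \<in> K \<and> k \<otimes>\<^bsub>H\<^esub> t [^]\<^bsub>H\<^esub> (i::int) \<in> N}"
  have sP: "subgroup P (H \<times>\<times> integer_group)"
    unfolding P_def by (rule H.cyclic_step_exponents[OF st t(1)])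
  interpret P: subgroup P "H \<times>\<times> integer_group" by (rule sP)
  have Pg: "group (H \<times>\<times> integer_group)" by (simp add: DirProd_group assms)
  have Pc: "k \<in> K" "k \<in> carrier H" if "(k, i) \<in> P" for k i using that by (auto simp: P_def)
  have "\<exists>d\<in>P `` Domain R. \<forall>i\<in>P `` Domain R. d dvd i"
  proof (rule int_subgroup_principal)
    show "0 \<in> P `` Domain R" using P.one_closed R.one_closed by auto
  next
    fix i j assume "i \<in> P `` Domain R" "j \<in> P `` Domain R"
    then show "i + j \<in> P `` Domain R"
      using Rm P.m_closed by (fastforce simp: Image_def Bex_def Domain_iff)
  next
    fix i assume "i \<in> P `` Domain R"
    then obtain k g where "(k, g) \<in> R" "(k, i) \<in> P" by auto
    then show "- i \<in> P `` Domain R"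
      using Ri[of k g] P.m_inv_closed[of "(k, i)"] Pc by (auto simp: inv_DirProd assms)
  qed
  then obtain d k0 g0 where d: "(k0, d) \<in> P" "(k0, g0) \<in> R" "\<And>k i g. (k, i) \<in> P \<Longrightarrow> (k, g) \<in> R \<Longrightarrow> d dvd i"
    by (metis DomainE DomainI Image_iff)
  show ?thesis
    unfolding cyclic_step_def
  proof (intro conjI ballI)
    show "subgroup (R `` N) G" "subgroup (R `` K) G" using subgroup_Image[OF assms(1-3)] D by auto
    show "R `` N \<subseteq> R `` K" using D by auto
  next
    fix x y assume "x \<in> R `` K" "y \<in> R `` N"
    then obtain k n where kn: "k \<in> K" "(k, x) \<in> R" "n \<in> N" "(n, y) \<in> R" by auto
    then have "(k \<otimes>\<^bsub>H\<^esub> n \<otimes>\<^bsub>H\<^esub> inv\<^bsub>H\<^esub> k, x \<otimes>\<^bsub>G\<^esub> y \<otimes>\<^bsub>G\<^esub> inv\<^bsub>G\<^esub> x) \<in> R" using Rm Ri by blast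
    then show "x \<otimes>\<^bsub>G\<^esub> y \<otimes>\<^bsub>G\<^esub> inv\<^bsub>G\<^esub> x \<in> R `` N" using D kn by blast
  next
    show "\<exists>t\<in>R `` K. \<forall>k\<in>R `` K. \<exists>i::int. k \<otimes>\<^bsub>G\<^esub> t [^]\<^bsub>G\<^esub> i \<in> R `` N"
    proof (intro bexI ballI)
      show "g0 \<in> R `` K" using d Pc by auto
      fix g assume "g \<in> R `` K"
      then obtain k where k: "k \<in> K" "(k, g) \<in> R" by auto
      then obtain i where i: "(k, i) \<in> P" using t unfolding P_def by auto
      then obtain q where q: "i = d * q" using d(3) k by (meson dvdE)
      have "(k0 [^]\<^bsub>H\<^esub> (-q), d * (-q)) \<in> P"
        using group.subgroup_int_pow_closed[OF Pg sP d(1), of "-q"] Pc[OF d(1)]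
        by (simp add: int_pow_DirProd assms mult.commute)
      from P.m_closed[OF i this] q have "k \<otimes>\<^bsub>H\<^esub> k0 [^]\<^bsub>H\<^esub> (-q) \<in> N"
        using k Pc[OF d(1)] by (auto simp: P_def)
      moreover have "(k0 [^]\<^bsub>H\<^esub> (-q), g0 [^]\<^bsub>G\<^esub> (-q)) \<in> R"
        using group.subgroup_int_pow_closed[OF _ R d(2), of "-q"] Rc[OF d(2)] DirProd_group[OF assms(2,1)]
        by (simp add: int_pow_DirProd assms)
      ultimately show "\<exists>i::int. g \<otimes>\<^bsub>G\<^esub> g0 [^]\<^bsub>G\<^esub> i \<in> R `` N" using Rm k by blast
    qed
  qed
qed

lemma finite_step_Image:
  assumes "group G" "group H" and R: "subgroup R (H \<times>\<times> G)" and st: "finite_step H N K"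
  shows "finite_step G (R `` N) (R `` K)"
proof -
  interpret G: group G by fact
  interpret H: group H by fact
  interpret R: subgroup R "H \<times>\<times> G" by fact
  note D = finite_stepD[OF st]
  interpret N: subgroup N H by (rule D)
  interpret K: subgroup K H by (rule D)
  obtain F where F: "finite F" "F \<subseteq> K" "\<forall>k\<in>K. \<exists>f\<in>F. k \<otimes>\<^bsub>H\<^esub> f \<in> N" using D(4) by blast
  have Rc: "k \<in> carrier H" "g \<in> carrier G" if "(k, g) \<in> R" for k g using that R.subset by auto
  have Ri: "(inv\<^bsub>H\<^esub> k, inv\<^bsub>G\<^esub> g) \<in> R" if "(k, g) \<in> R" for k g
    using R.m_inv_closed[OF that] Rc[OF that] by (simp add: inv_DirProd assms)
  have Rm: "(k \<otimes>\<^bsub>H\<^esub> l, g \<otimes>\<^bsub>G\<^esub> h) \<in> R" if "(k, g) \<in> R" "(l, h) \<in> R" for k l g h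
    using R.m_closed[OF that] by simp
  \<comment> \<open>only those cosets of \<open>N\<close> count that meet the domain of \<open>R\<close>; one partner is chosen for each\<close>
  define good where "good f g \<longleftrightarrow> (\<exists>k\<in>K. (k, g) \<in> R \<and> k \<otimes>\<^bsub>H\<^esub> f \<in> N)" for f g
  define E where "E = (\<lambda>f. inv\<^bsub>G\<^esub> (SOME g. good f g)) ` {f \<in> F. \<exists>g. good f g}"
  have good: "good f (SOME g. good f g)" if "good f g" for f g using that by (rule someI)
  show ?thesis
    unfolding finite_step_def
  proof (intro conjI exI[of _ E] ballI)
    show "subgroup (R `` N) G" "subgroup (R `` K) G" using subgroup_Image[OF assms(1-3)] D by auto
    show "R `` N \<subseteq> R `` K" using D by auto
    show "finite E" using F by (auto simp: E_def)
    have "inv\<^bsub>G\<^esub> (SOME g. good f g) \<in> R `` K" if "good f g" for f g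
      using good[OF that] Ri unfolding good_def by blast
    then show "E \<subseteq> R `` K" by (auto simp: E_def)
  next
    fix x y assume "x \<in> R `` K" "y \<in> R `` N"
    then obtain k n where kn: "k \<in> K" "(k, x) \<in> R" "n \<in> N" "(n, y) \<in> R" by auto
    then have "(k \<otimes>\<^bsub>H\<^esub> n \<otimes>\<^bsub>H\<^esub> inv\<^bsub>H\<^esub> k, x \<otimes>\<^bsub>G\<^esub> y \<otimes>\<^bsub>G\<^esub> inv\<^bsub>G\<^esub> x) \<in> R" using Rm Ri by blast
    then show "x \<otimes>\<^bsub>G\<^esub> y \<otimes>\<^bsub>G\<^esub> inv\<^bsub>G\<^esub> x \<in> R `` N" using D kn by blast
  next
    fix g assume "g \<in> R `` K"
    then obtain k f where k: "k \<in> K" "(k, g) \<in> R" and f: "f \<in> F" "k \<otimes>\<^bsub>H\<^esub> f \<in> N" using F by blast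
    then have gd: "good f g" unfolding good_def by blast
    define h where "h = (SOME g. good f g)"
    obtain l where l: "l \<in> K" "(l, h) \<in> R" "l \<otimes>\<^bsub>H\<^esub> f \<in> N" using good[OF gd] unfolding good_def h_def by blast
    have "(k \<otimes>\<^bsub>H\<^esub> f) \<otimes>\<^bsub>H\<^esub> inv\<^bsub>H\<^esub> (l \<otimes>\<^bsub>H\<^esub> f) \<in> N" using l f by blast
    moreover have "f \<in> carrier H" using f F by auto
    ultimately have "k \<otimes>\<^bsub>H\<^esub> inv\<^bsub>H\<^esub> l \<in> N" using k l by (simp add: H.m_assoc H.inv_mult_group)
    moreover have "(k \<otimes>\<^bsub>H\<^esub> inv\<^bsub>H\<^esub> l, g \<otimes>\<^bsub>G\<^esub> inv\<^bsub>G\<^esub> h) \<in> R" using Rm Ri k l by blast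
    moreover have "inv\<^bsub>G\<^esub> h \<in> E" using f gd unfolding E_def h_def by blast
    ultimately show "\<exists>f\<in>E. g \<otimes>\<^bsub>G\<^esub> f \<in> R `` N" by blast
  qed
qed

lemma series_step_Image:
  assumes "group G" "group H" "subgroup R (H \<times>\<times> G)" "series_step H N K"
  shows "series_step G (R `` N) (R `` K)"
  using assms cyclic_step_Image finite_step_Image unfolding series_step_def by blast

lemma series_Image:
  assumes "group G" "group H" "subgroup R (H \<times>\<times> G)" "series H A B"
  shows "series G (R `` A) (R `` B)"
  using assms(4)
proof (induction rule: rtranclp_induct)
  case (step N K)
  from step.IH series_step_Image[OF assms(1-3) step.hyps(2)] show ?case by (rule rtranclp.rtrancl_into_rtrancl)
qed simp

lemma subgroup_Id_on:
  assumes "group G" "subgroup M G" shows "subgroup (Id_on M) (G \<times>\<times> G)"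
proof -
  interpret M: subgroup M G by fact
  interpret P: group "G \<times>\<times> G" using assms by (simp add: DirProd_group)
  show ?thesis
  proof (rule P.subgroupI)
    show "Id_on M \<noteq> {}" using M.one_closed by blast
  qed (auto simp: assms)
qed

lemma Id_on_Image_eq_Int: "Id_on M `` A = A \<inter> M" by auto

lemma series_Int:
  assumes "group G" "subgroup M G" "series G A B"
  shows "series G (A \<inter> M) (B \<inter> M)"
  using series_Image[OF assms(1,1) subgroup_Id_on[OF assms(1,2)] assms(3)] by (simp only: Id_on_Image_eq_Int)

lemma series_step_Int:
  assumes "group G" "subgroup M G" "series_step G A B"
  shows "series_step G (A \<inter> M) (B \<inter> M)"
  using series_step_Image[OF assms(1,1) subgroup_Id_on[OF assms(1,2)] assms(3)] by (simp only: Id_on_Image_eq_Int)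

lemma cyclic_step_Int:
  assumes "group G" "subgroup M G" "cyclic_step G A B"
  shows "cyclic_step G (A \<inter> M) (B \<inter> M)"
  using cyclic_step_Image[OF assms(1,1) subgroup_Id_on[OF assms(1,2)] assms(3)] by (simp only: Id_on_Image_eq_Int)

text \<open>
  Lifts a series of \<open>H\<close> through an extension by \<open>M\<close>: it climbs from \<open>M\<close> to the whole group when
  \<open>\<alpha>\<close> is onto modulo \<open>M\<close>.
\<close>
lemma series_hom_mult:
  assumes "group G" "group H" "\<alpha> \<in> hom H G" "subgroup M G"
    and norm: "\<And>h m. h \<in> carrier H \<Longrightarrow> m \<in> M \<Longrightarrow> \<alpha> h \<otimes>\<^bsub>G\<^esub> m \<otimes>\<^bsub>G\<^esub> inv\<^bsub>G\<^esub> (\<alpha> h) \<in> M"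
    and s: "series H {\<one>\<^bsub>H\<^esub>} (carrier H)"
  shows "series G M {m \<otimes>\<^bsub>G\<^esub> \<alpha> h | m h. m \<in> M \<and> h \<in> carrier H}"
proof -
  interpret G: group G by fact
  interpret H: group H by fact
  interpret M: subgroup M G by fact
  interpret \<alpha>: group_hom H G \<alpha> using assms(1-3) by (simp add: group_hom_def group_hom_axioms_def)
  interpret P: group "H \<times>\<times> G" using assms(1,2) by (simp add: DirProd_group)
  define R where "R = {(h, m \<otimes>\<^bsub>G\<^esub> \<alpha> h) | m h. m \<in> M \<and> h \<in> carrier H}"
  have RI: "(h, m \<otimes>\<^bsub>G\<^esub> \<alpha> h) \<in> R" if "m \<in> M" "h \<in> carrier H" for m h
    using that unfolding R_def by blast
  have R: "subgroup R (H \<times>\<times> G)"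
  proof (rule P.subgroupI)
    show "R \<subseteq> carrier (H \<times>\<times> G)" by (auto simp: R_def)
    show "R \<noteq> {}" using M.one_closed H.one_closed unfolding R_def by blast
  next
    fix a assume "a \<in> R"
    then obtain m h where a: "a = (h, m \<otimes>\<^bsub>G\<^esub> \<alpha> h)" "m \<in> M" "h \<in> carrier H" by (auto simp: R_def)
    define n where "n = \<alpha> (inv\<^bsub>H\<^esub> h) \<otimes>\<^bsub>G\<^esub> inv\<^bsub>G\<^esub> m \<otimes>\<^bsub>G\<^esub> inv\<^bsub>G\<^esub> (\<alpha> (inv\<^bsub>H\<^esub> h))"
    have n: "n \<in> M" unfolding n_def using a by (intro norm) auto
    have "inv\<^bsub>H \<times>\<times> G\<^esub> a = (inv\<^bsub>H\<^esub> h, n \<otimes>\<^bsub>G\<^esub> \<alpha> (inv\<^bsub>H\<^esub> h))"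
      using a(2,3) unfolding a(1) n_def by (simp add: G.m_assoc G.inv_mult_group inv_DirProd[OF assms(2,1)])
    then show "inv\<^bsub>H \<times>\<times> G\<^esub> a \<in> R" using RI[OF n, of "inv\<^bsub>H\<^esub> h"] a(3) by simp
  next
    fix a b assume "a \<in> R" "b \<in> R"
    then obtain m h n k where a: "a = (h, m \<otimes>\<^bsub>G\<^esub> \<alpha> h)" "m \<in> M" "h \<in> carrier H"
      and b: "b = (k, n \<otimes>\<^bsub>G\<^esub> \<alpha> k)" "n \<in> M" "k \<in> carrier H" by (auto simp: R_def)
    define p where "p = m \<otimes>\<^bsub>G\<^esub> (\<alpha> h \<otimes>\<^bsub>G\<^esub> n \<otimes>\<^bsub>G\<^esub> inv\<^bsub>G\<^esub> (\<alpha> h))"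
    have p: "p \<in> M" unfolding p_def by (rule M.m_closed[OF a(2) norm[OF a(3) b(2)]])
    have "a \<otimes>\<^bsub>H \<times>\<times> G\<^esub> b = (h \<otimes>\<^bsub>H\<^esub> k, p \<otimes>\<^bsub>G\<^esub> \<alpha> (h \<otimes>\<^bsub>H\<^esub> k))"
      using a(2,3) b(2,3) unfolding a(1) b(1) p_def by (simp add: G.m_assoc)
    then show "a \<otimes>\<^bsub>H \<times>\<times> G\<^esub> b \<in> R" using RI[OF p, of "h \<otimes>\<^bsub>H\<^esub> k"] a(3) b(3) by simp
  qed
  have "(\<one>\<^bsub>H\<^esub>, m) \<in> R \<longleftrightarrow> m \<in> M" for m
    using RI[of m "\<one>\<^bsub>H\<^esub>"] M.mem_carrier[of m] by (auto simp: R_def)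
  then have "R `` {\<one>\<^bsub>H\<^esub>} = M" by auto
  moreover have "R `` carrier H = {m \<otimes>\<^bsub>G\<^esub> \<alpha> h | m h. m \<in> M \<and> h \<in> carrier H}" by (auto simp: R_def Image_iff)
  ultimately show ?thesis using series_Image[OF assms(1,2) R s] by simp
qed

section \<open>Finitely generated central extensions\<close>
lemma generate_conj_closed:
  fixes G (structure)
  assumes "group G" "S \<subseteq> carrier G" "t \<in> carrier G"
    and "\<And>s. s \<in> S \<Longrightarrow> t \<otimes> s \<otimes> inv t \<in> generate G S"
    and "g \<in> generate G S"
  shows "t \<otimes> g \<otimes> inv t \<in> generate G S"
proof -
  interpret group G by fact
  interpret S: subgroup "generate G S" G using assms by (intro generate_is_subgroup)
  from assms(5) show ?thesis
  proof (induction rule: generate.induct)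
    case one
    then show ?case using assms(3) S.one_closed by simp
  next
    case (incl h)
    then show ?case using assms(4) by simp
  next
    case (inv h)
    then have hc: "h \<in> carrier G" using assms(2) by auto
    have "inv (t \<otimes> h \<otimes> inv t) \<in> generate G S" using assms(4) inv by blast
    then show ?case using hc assms(3) by (simp add: inv_mult_group m_assoc)
  next
    case (eng h k)
    then have "h \<in> carrier G" "k \<in> carrier G" using S.mem_carrier by blast+
    moreover have "(t \<otimes> h \<otimes> inv t) \<otimes> (t \<otimes> k \<otimes> inv t) \<in> generate G S" using eng by (auto intro: generate.eng)
    ultimately show ?case using assms(3) by (simp add: m_assoc)
  qed
qed

lemma generate_commute:
  fixes G (structure)
  assumes "group G" "S \<subseteq> carrier G" "x \<in> carrier G"
    and "\<And>s. s \<in> S \<Longrightarrow> x \<otimes> s = s \<otimes> x" and "g \<in> generate G S"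
  shows "x \<otimes> g = g \<otimes> x"
proof -
  interpret group G by fact
  interpret S: subgroup "generate G S" G using assms by (intro generate_is_subgroup)
  from assms(5) show ?thesis
  proof (induction rule: generate.induct)
    case one
    then show ?case using assms(3) by simp
  next
    case (incl h)
    then show ?case using assms(4) by simp
  next
    case (inv h)
    then have hc: "h \<in> carrier G" "x \<otimes> h = h \<otimes> x" using assms(2,4) by auto
    have "inv h \<otimes> (x \<otimes> h) \<otimes> inv h = inv h \<otimes> (h \<otimes> x) \<otimes> inv h" using hc by simp
    then show ?case using hc(1) assms(3) by (simp add: m_assoc)
  next
    case (eng h k)
    then have hk: "h \<in> carrier G" "k \<in> carrier G" using S.mem_carrier by blast+
    have "x \<otimes> (h \<otimes> k) = (x \<otimes> h) \<otimes> k" using hk assms(3) by (simp add: m_assoc)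
    also have "\<dots> = h \<otimes> (x \<otimes> k)" using hk assms(3) eng by (simp add: m_assoc)
    also have "\<dots> = (h \<otimes> k) \<otimes> x" using hk assms(3) eng by (simp add: m_assoc)
    finally show ?case .
  qed
qed

lemma series_finite_extension:
  fixes G (structure)
  assumes "group G" "series G A B" "subgroup A G"
  shows "\<exists>Y. finite Y \<and> Y \<subseteq> B \<and> generate G (A \<union> Y) = B"
  using assms(2)
proof (induction rule: rtranclp_induct)
  case base
  interpret group G by fact
  have "generate G A = A" using generateI[OF assms(3), of A] by simp
  then show ?case by (intro exI[of _ "{}"]) auto
next
  case (step N K)
  interpret group G by fact
  note D = series_stepD[OF step.hyps(2)]
  interpret N: subgroup N G by (rule D)
  interpret K: subgroup K G by (rule D)
  obtain Y where Y: "finite Y" "Y \<subseteq> N" "generate G (A \<union> Y) = N" using step.IH by blast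
  have *: "\<exists>F. finite F \<and> F \<subseteq> K \<and> (\<forall>k\<in>K. \<exists>f\<in>generate G F. k \<otimes> f \<in> N)"
    using step.hyps(2) unfolding series_step_def
  proof
    assume "finite_step G N K"
    from finite_stepD(4)[OF this]
    obtain F where F: "finite F" "F \<subseteq> K" "\<forall>k\<in>K. \<exists>f\<in>F. k \<otimes> f \<in> N" by blast
    have "F \<subseteq> generate G F" by (simp add: generate.incl subsetI)
    then show ?thesis using F by (intro exI[of _ F]) blast
  next
    assume "cyclic_step G N K"
    from cyclic_stepD(5)[OF this]
    obtain t where t: "t \<in> K" "\<forall>k\<in>K. \<exists>i::int. k \<otimes> t [^] i \<in> N" by blast
    have "subgroup (generate G {t}) G" using t(1) by (intro generate_is_subgroup) auto
    then have "t [^] (i::int) \<in> generate G {t}" for i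
      using subgroup_int_pow_closed generate.incl[of t "{t}" G] by blast
    then show ?thesis using t by (intro exI[of _ "{t}"]) blast
  qed
  then obtain F where F: "finite F" "F \<subseteq> K" "\<forall>k\<in>K. \<exists>f\<in>generate G F. k \<otimes> f \<in> N" by blast
  let ?g = "generate G (A \<union> (Y \<union> F))"
  have sub: "A \<union> (Y \<union> F) \<subseteq> K" using F Y D series_subgroup(2)[OF step.hyps(1) assms(3)] by blast
  then have g: "subgroup ?g G" by (intro generate_is_subgroup) auto
  have "N \<subseteq> ?g" using Y(3) mono_generate[of "A \<union> Y" "A \<union> (Y \<union> F)"] by blast
  moreover have "generate G F \<subseteq> ?g" by (intro mono_generate) auto
  ultimately have 1: "K \<subseteq> ?g"
  proof (intro subsetI)
    fix k assume k: "k \<in> K" and sb: "N \<subseteq> ?g" "generate G F \<subseteq> ?g"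
    obtain f where f: "f \<in> generate G F" "k \<otimes> f \<in> N" using F k by blast
    have fc: "f \<in> carrier G" using generate_in_carrier[OF _ f(1)] F(2) K.subset by blast
    have "(k \<otimes> f) \<otimes> inv f \<in> ?g"
      using sb f subgroup.m_closed[OF g] subgroup.m_inv_closed[OF g] by blast
    then show "k \<in> ?g" using k fc by (simp add: m_assoc)
  qed
  have "?g \<subseteq> K" by (rule generate_subgroup_incl[OF sub K.subgroup_axioms])
  then show ?case using 1 sub Y F by (intro exI[of _ "Y \<union> F"]) auto
qed

text \<open>
  Schreier's lemma in a relative form. For a finite quotient the Schreier generators \<open>Q\<close> generate
  \<open>N\<close>; for a cyclic quotient \<open>N\<close> need not be finitely generated, but it is so up to conjugation
  by the two elements \<open>t\<close> and \<open>t\<inverse>\<close> of \<open>T\<close>. For both, a subgroup of \<open>N\<close> that contains \<open>Q\<close> and is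
  stable under \<open>T\<close> is all of \<open>N\<close>.
\<close>
lemma series_step_kernel_generators:
  fixes G (structure)
  assumes "group G" "fin_gen G M" "series_step G N M"
  shows "\<exists>T Q. finite T \<and> T \<subseteq> M \<and> finite Q \<and> Q \<subseteq> N \<and>
    (\<forall>t\<in>T. \<forall>n\<in>N. t \<otimes> n \<otimes> inv t \<in> N) \<and>
    (\<forall>S. subgroup S G \<longrightarrow> Q \<subseteq> S \<longrightarrow> S \<subseteq> N \<longrightarrow>
       (\<forall>t\<in>T. \<forall>s\<in>S. t \<otimes>\<^bsub>G\<^esub> s \<otimes>\<^bsub>G\<^esub> inv\<^bsub>G\<^esub> t \<in> S) \<longrightarrow> S = N)"
proof -
  interpret group G by fact
  note D = series_stepD[OF assms(3)]
  interpret N: subgroup N G by (rule D)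
  interpret M: subgroup M G by (rule D)
  obtain X where X: "finite X" "X \<subseteq> carrier G" "M = generate G X" using assms(2) by (auto simp: fin_gen_def)
  have XM: "X \<subseteq> M" using X generate.incl[of _ X G] by blast
  from assms(3) show ?thesis unfolding series_step_def
  proof
    assume st: "cyclic_step G N M"
    then obtain t where t: "t \<in> M" "\<forall>k\<in>M. \<exists>i::int. k \<otimes> t [^] i \<in> N" using cyclic_stepD(5)[OF st] by blast
    have tc: "t \<in> carrier G" using t by simp
    have tM: "t [^] (i::int) \<in> M" for i
      using t by (intro subgroup_int_pow_closed M.subgroup_axioms) 
    have "\<exists>d\<in>{i::int. t [^] i \<in> N}. \<forall>i\<in>{i. t [^] i \<in> N}. d dvd i"
      by (rule int_subgroup_principal) (auto simp: int_pow_mult int_pow_neg tc)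
    then obtain d where d: "t [^] (d::int) \<in> N" "\<And>i. t [^] i \<in> N \<Longrightarrow> d dvd i" by blast
    obtain e :: "'a \<Rightarrow> int" where e: "\<forall>k\<in>M. k \<otimes> t [^] (e k) \<in> N" using t(2) by metis
    define T where "T = {t, inv t}"
    \<comment> \<open>\<open>t [^] d\<close> is needed when \<open>t\<close> has finite order modulo \<open>N\<close>; otherwise \<open>d = 0\<close>\<close>
    define Q where "Q = insert (t [^] d) ((\<lambda>x. x \<otimes> t [^] (e x)) ` X)"
    have "S = N" if S: "subgroup S G" "Q \<subseteq> S" "S \<subseteq> N" "\<And>t s. t \<in> T \<Longrightarrow> s \<in> S \<Longrightarrow> t \<otimes> s \<otimes> inv t \<in> S" for S
    proof -
      interpret S: subgroup S G by (rule S)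
      have nconj: "s \<in> S \<Longrightarrow> u [^] n \<otimes> s \<otimes> inv (u [^] n) \<in> S" if u: "u \<in> T" "u \<in> carrier G" for u s and n :: nat
      proof (induction n arbitrary: s)
        case (Suc n)
        from Suc(1)[OF S(4)[OF u(1) Suc(2)]] show ?case using u Suc(2) by (simp add: m_assoc inv_mult_group)
      qed (auto)
      have conj: "t [^] i \<otimes> s \<otimes> inv (t [^] i) \<in> S" if "s \<in> S" for s and i :: int
      proof (cases "i \<ge> 0")
        case True
        then show ?thesis using nconj[of t s "nat i"] that tc by (simp add: T_def pow_nat)
      next
        case False
        then have "inv t [^] (nat (- i)) = t [^] i" using tc 
          by (metis int_pow_def2 inv_closed linorder_not_le nat_pow_inv)
        then show ?thesis using nconj[of "inv t" s "nat (- i)"] that tc by (simp add: T_def)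
      qed
      \<comment> \<open>\<open>C\<close> is the product of \<open>S\<close> with the powers of \<open>t\<close>\<close>
      define C where "C = {k \<in> M. \<exists>i::int. k \<otimes> t [^] i \<in> S}"
      have "subgroup C G"
      proof (rule subgroupI)
        show "C \<subseteq> carrier G" by (auto simp: C_def)
        show "C \<noteq> {}" using S.one_closed by (auto simp: C_def intro!: exI[of _ \<one>] exI[of _ "0::int"])
      next
        fix k assume "k \<in> C"
        then obtain i :: int where k: "k \<in> M" "k \<otimes> t [^] i \<in> S" by (auto simp: C_def)
        have "t [^] i \<otimes> (k \<otimes> t [^] i) \<otimes> inv (t [^] i) \<in> S" using conj k by blast
        then have "inv (t [^] i \<otimes> k) \<in> S" using k tc by (simp add: m_assoc)
        then have "inv k \<otimes> t [^] (- i) \<in> S" using k tc by (simp add: inv_mult_group int_pow_neg)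
        then show "inv k \<in> C" using k by (auto simp: C_def)
      next
        fix k l assume "k \<in> C" "l \<in> C"
        then obtain i j :: int where k: "k \<in> M" "k \<otimes> t [^] i \<in> S" and l: "l \<in> M" "l \<otimes> t [^] j \<in> S"
          by (auto simp: C_def)
        have "(k \<otimes> t [^] i) \<otimes> (t [^] (-i) \<otimes> (l \<otimes> t [^] j) \<otimes> inv (t [^] (-i))) \<in> S"
          using conj k l by blast
        moreover have "t [^] (i + j) = t [^] j \<otimes> t [^] i" using tc by (simp add: int_pow_mult[symmetric] add.commute)
        ultimately have "(k \<otimes> l) \<otimes> t [^] (i + j) \<in> S" using k l tc by (simp add: int_pow_neg m_assoc)
        then show "k \<otimes> l \<in> C" using k l by (auto simp: C_def)
      qed
      moreover have "X \<subseteq> C" using S(2) XM by (auto simp: C_def Q_def)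
      ultimately have MC: "M \<subseteq> C" unfolding X(3) by (intro generate_subgroup_incl)
      have "N \<subseteq> S"
      proof
        fix n assume n: "n \<in> N"
        then obtain i :: int where i: "n \<otimes> t [^] i \<in> S" using MC D by (auto simp: C_def)
        then have "inv n \<otimes> (n \<otimes> t [^] i) \<in> N" using S(3) n by blast
        then have "t [^] i \<in> N" using n tc by simp
        then obtain q where "i = d * q" using d by (meson dvdE)
        moreover have "t [^] d \<in> S" using S(2) by (simp add: Q_def)
        ultimately have ti: "t [^] i \<in> S" using subgroup_int_pow_closed[OF S(1), of "t [^] d" q] tc by (simp add: int_pow_pow)
        then have "(n \<otimes> t [^] i) \<otimes> inv (t [^] i) \<in> S" using i by blast
        then show "n \<in> S" using n tc by (simp add: m_assoc)
      qed
      then show ?thesis using S(3) by blast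
    qed
    moreover have T: "finite T" "T \<subseteq> M" "finite Q" "Q \<subseteq> N" using t(1) M.m_inv_closed[OF t(1)] X(1) XM d(1) e unfolding T_def Q_def by blast+
    moreover have "\<forall>t\<in>T. \<forall>n\<in>N. t \<otimes> n \<otimes> inv t \<in> N" using T(2) cyclic_stepD(4)[OF st] by blast
    ultimately show ?thesis by (intro exI[of _ T] exI[of _ Q]) simp
  next
    assume st: "finite_step G N M"
    then obtain F where F: "finite F" "F \<subseteq> M" "\<forall>k\<in>M. \<exists>f\<in>F. k \<otimes> f \<in> N" using finite_stepD(4)[OF st] by blast
    \<comment> \<open>adding \<open>\<one>\<close> puts \<open>\<one>\<close> into the union \<open>C\<close> of cosets of \<open>S\<close> considered below\<close>
    define E where "E = insert \<one> F"
    define P where "P = (\<lambda>(e, x, f). inv e \<otimes> x \<otimes> f) ` (E \<times> (X \<union> m_inv G ` X) \<times> E)"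
    define Q where "Q = N \<inter> (E \<union> P)"
    have E: "finite E" "E \<subseteq> M" "\<forall>k\<in>M. \<exists>f\<in>E. k \<otimes> f \<in> N" "E \<subseteq> carrier G" using F by (auto simp: E_def)
    have finQ: "finite Q" using E X by (auto simp: Q_def P_def)
    have "S = N" if S: "subgroup S G" "Q \<subseteq> S" "S \<subseteq> N" for S
    proof -
      interpret S: subgroup S G by (rule S)
      define C where "C = {k \<in> M. \<exists>e\<in>E. k \<otimes> e \<in> S}"
      have step: "c \<otimes> x \<in> C" if c: "c \<in> C" and x: "x \<in> X \<union> m_inv G ` X" for c x
      proof -
        obtain e where e: "e \<in> E" "c \<in> M" "c \<otimes> e \<in> S" using c by (auto simp: C_def)
        have xM: "x \<in> M" using x XM by auto
        have ec: "e \<in> carrier G" using e E by auto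
        have iex: "inv e \<otimes> x \<in> M" using e E xM by blast
        then obtain f where f: "f \<in> E" "inv e \<otimes> x \<otimes> f \<in> N" using E(3) by blast
        have fc: "f \<in> carrier G" using f E by auto
        have "(e, x, f) \<in> E \<times> (X \<union> m_inv G ` X) \<times> E" using f e x by simp
        then have "inv e \<otimes> x \<otimes> f \<in> P" unfolding P_def by (rule rev_image_eqI) simp
        then have "inv e \<otimes> x \<otimes> f \<in> Q" using f by (simp add: Q_def)
        then have "(c \<otimes> e) \<otimes> (inv e \<otimes> x \<otimes> f) \<in> S" using S(2) e by blast
        then have "c \<otimes> x \<otimes> f \<in> S" using e ec xM fc by (simp add: m_assoc)
        then show ?thesis using f e xM by (auto simp: C_def)
      qed
      have "c \<otimes> h \<in> C" if "h \<in> generate G X" "c \<in> C" for h c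
        using that
      proof (induction arbitrary: c rule: generate.induct)
        case one
        then show ?case by (auto simp: C_def)
      next
        case (incl h)
        then show ?case using step by blast
      next
        case (inv h)
        then show ?case using step by blast
      next
        case (eng h1 h2)
        have "h1 \<in> carrier G" "h2 \<in> carrier G" "c \<in> carrier G"
          using eng X generate_in_carrier by (auto simp: C_def)
        then show ?case using eng.IH(2)[OF eng.IH(1)[OF eng.prems]] by (simp add: m_assoc)
      qed
      moreover have "\<one> \<in> C" using S.one_closed by (auto simp: C_def E_def)
      ultimately have MC: "M \<subseteq> C" using X by (metis M.mem_carrier l_one subsetI)
      have "N \<subseteq> S"
      proof
        fix n assume n: "n \<in> N"
        then obtain e where e: "e \<in> E" "n \<otimes> e \<in> S" using MC D by (auto simp: C_def)
        then have "inv n \<otimes> (n \<otimes> e) \<in> N" using S(3) n by blast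
        moreover have ec: "e \<in> carrier G" using e E by blast
        ultimately have "e \<in> S" using n e S(2) by (auto simp: Q_def)
        then have "(n \<otimes> e) \<otimes> inv e \<in> S" using e by blast
        then show "n \<in> S" using n ec by (simp add: m_assoc)
      qed
      then show ?thesis using S(3) by blast
    qed
    moreover have "Q \<subseteq> N" by (auto simp: Q_def)
    ultimately show ?thesis using finQ by (intro exI[of _ "{}"] exI[of _ Q]) auto
  qed
qed

lemma generate_subgroup_Un_central:
  fixes G (structure)
  assumes "group G" "subgroup Z G" "Y \<subseteq> carrier G"
    and comm: "\<And>z y. z \<in> Z \<Longrightarrow> y \<in> generate G (Z \<union> Y) \<Longrightarrow> z \<otimes>\<^bsub>G\<^esub> y = y \<otimes>\<^bsub>G\<^esub> z"
    and q: "q \<in> generate G (Z \<union> Y)"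
  shows "\<exists>z\<in>Z. \<exists>w\<in>generate G Y. q = w \<otimes>\<^bsub>G\<^esub> z"
proof -
  interpret group G by fact
  interpret Z: subgroup Z G by fact
  let ?g = "generate G (Z \<union> Y)"
  have sub: "Z \<union> Y \<subseteq> carrier G" using assms Z.subset by auto
  have s: "subgroup ?g G" "subgroup (generate G Y) G" using assms sub by (auto intro: generate_is_subgroup)
  interpret W: subgroup "generate G Y" G by (rule s)
  have inc: "generate G Y \<subseteq> ?g" by (rule mono_generate) auto
  have one: "\<one> \<in> generate G Y" "\<one> \<in> Z" by auto
  from q show ?thesis
  proof (induction rule: generate.induct)
    case one
    then show ?case using Z.one_closed W.one_closed by (metis r_one one_closed)
  next
    case (incl h)
    then show ?case
    proof
      assume "h \<in> Z" then show ?thesis using W.one_closed by (metis l_one Z.mem_carrier)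
    next
      assume "h \<in> Y" then show ?thesis using Z.one_closed generate.incl[of h Y G] W.mem_carrier by (metis r_one)
    qed
  next
    case (inv h)
    then show ?case
    proof
      assume "h \<in> Z" then show ?thesis using W.one_closed by (metis l_one Z.mem_carrier Z.m_inv_closed)
    next
      assume "h \<in> Y" then show ?thesis using Z.one_closed generate.inv[of h Y G] W.mem_carrier by (metis r_one)
    qed
  next
    case (eng h1 h2)
    then obtain z w z' w' where d: "z \<in> Z" "w \<in> generate G Y" "h1 = w \<otimes> z" "z' \<in> Z" "w' \<in> generate G Y" "h2 = w' \<otimes> z'"
      by blast
    have "z \<otimes> w' = w' \<otimes> z" using comm d inc by blast
    then have "h1 \<otimes> h2 = (w \<otimes> w') \<otimes> (z \<otimes> z')" using d by (simp add: m_assoc) (metis Z.mem_carrier W.mem_carrier m_assoc)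
    then show ?case using d by blast
  qed
qed

lemma commuting_fin_gen_series:
  fixes G (structure)
  assumes "group G" "finite X" "X \<subseteq> carrier G" "\<And>x y. x \<in> generate G X \<Longrightarrow> y \<in> generate G X \<Longrightarrow> x \<otimes>\<^bsub>G\<^esub> y = y \<otimes>\<^bsub>G\<^esub> x"
  shows "series G {\<one>\<^bsub>G\<^esub>} (generate G X)"
  using assms(2-4)
proof (induction rule: finite_induct)
  case empty
  interpret group G by fact
  show ?case by (simp add: generate_empty)
next
  case (insert x X)
  interpret group G by fact
  let ?K = "generate G (insert x X)" and ?N = "generate G X"
  have sub: "?N \<subseteq> ?K" by (intro mono_generate) auto
  have sg: "subgroup ?N G" "subgroup ?K G" using insert by (auto intro: generate_is_subgroup)
  interpret N: subgroup ?N G by (rule sg)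
  interpret K: subgroup ?K G by (rule sg)
  have x: "x \<in> ?K" by (intro generate.incl) auto
  have xi: "x [^] (i::int) \<in> ?K" for i using x subgroup_int_pow_closed[OF sg(2)] by blast
  have xc: "x \<in> carrier G" using x by auto
  have comm: "a \<otimes> b = b \<otimes> a" if "a \<in> ?K" "b \<in> ?K" for a b using insert.prems that by blast
  have "series G {\<one>} ?N" using insert.IH insert.prems sub by blast
  moreover have "cyclic_step G ?N ?K"
    unfolding cyclic_step_def
  proof (intro conjI ballI sub sg bexI[of _ x] x)
    fix k n assume k: "k \<in> ?K" and n: "n \<in> ?N"
    then have "k \<otimes> n \<otimes> inv k = n" using comm[of k n] sub by (simp add: subset_iff m_assoc)
    then show "k \<otimes> n \<otimes> inv k \<in> ?N" using n by simp
  next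
    fix k assume "k \<in> ?K"
    then show "\<exists>i::int. k \<otimes> x [^] i \<in> ?N"
    proof (induction rule: generate.induct)
      case one
      then show ?case using N.one_closed by (auto intro!: exI[of _ "0::int"])
    next
      case (incl h)
      show ?case
      proof (cases "h = x")
        case True
        then show ?thesis using xc N.one_closed by (intro exI[of _ "-1::int"]) (simp add: int_pow_neg)
      next
        case False
        then show ?thesis using incl generate.incl[of h X G] by (intro exI[of _ "0::int"]) auto
      qed
    next
      case (inv h)
      show ?case
      proof (cases "h = x")
        case True
        then show ?thesis using xc N.one_closed by (intro exI[of _ "1::int"]) simp
      next
        case False
        then show ?thesis using inv generate.inv[of h X G] by (intro exI[of _ "0::int"]) auto
      qed
    next
      case (eng h k)
      then obtain i j :: int where "h \<otimes> x [^] i \<in> ?N" "k \<otimes> x [^] j \<in> ?N" by blast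
      then have n: "(h \<otimes> x [^] i) \<otimes> (k \<otimes> x [^] j) \<in> ?N" by blast
      have hk: "h \<in> carrier G" "k \<in> carrier G" using eng by auto
      have "x [^] i \<otimes> k = k \<otimes> x [^] i" using comm xi eng by blast
      then have "x [^] i \<otimes> (k \<otimes> x [^] j) = k \<otimes> x [^] (i + j)" using hk xc
        by (metis int_pow_closed int_pow_mult m_assoc)
      then have "(h \<otimes> k) \<otimes> x [^] (i + j) \<in> ?N" using n hk xc by (simp add: m_assoc)
      then show ?case by blast
    qed
  qed
  ultimately show ?case by (meson rtranclp.rtrancl_into_rtrancl series_step_def)
qed

text \<open>
  The induction descends from \<open>B\<close> to \<open>Z\<close>: for a step from \<open>N\<close> to \<open>K\<close> and a finitely generated \<open>M \<subseteq> K\<close>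
  one needs that \<open>N' = N \<inter> M\<close> is finitely generated. Modulo \<open>Z\<close> it is, by some \<open>Y\<close>, because \<open>N' / (Z \<inter> M)\<close>
  has a series. Each of the finitely many elements of \<open>N'\<close> that matter for Schreier's lemma
  differs from an element of \<open>generate G Y\<close> by a central factor, and adding these finitely many
  factors to \<open>Y\<close> gives generators of \<open>N'\<close>; being central, they are harmless for the
  stability under conjugation.
\<close>
lemma fin_gen_central_extension_series:
  fixes G (structure)
  assumes "group G" "subgroup Z G" "series G Z B"
    and "\<And>z b. z \<in> Z \<Longrightarrow> b \<in> B \<Longrightarrow> z \<otimes>\<^bsub>G\<^esub> b = b \<otimes>\<^bsub>G\<^esub> z"
    and "M \<subseteq> B" "fin_gen G M"
  shows "series G {\<one>\<^bsub>G\<^esub>} M"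
  using assms(3-6)
proof (induction arbitrary: M rule: rtranclp_induct)
  case base
  from base(3) obtain X where X: "finite X" "X \<subseteq> carrier G" "M = generate G X" by (auto simp: fin_gen_def)
  then show ?case using commuting_fin_gen_series[OF assms(1) X(1,2)] base by blast
next
  case (step N K)
  interpret group G by fact
  interpret Z: subgroup Z G by fact
  note D = series_stepD[OF step.hyps(2)]
  have ZN: "Z \<subseteq> N" using series_subgroup(2)[OF step.hyps(1) assms(2)] .
  obtain X where X: "finite X" "X \<subseteq> carrier G" "M = generate G X" using step.prems by (auto simp: fin_gen_def)
  have M: "subgroup M G" using X generate_is_subgroup by blast
  interpret M: subgroup M G by fact
  have "K \<inter> M = M" using step.prems by blast
  then have st: "series_step G (N \<inter> M) M" using series_step_Int[OF assms(1) M step.hyps(2)] by simp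
  define N' where "N' = N \<inter> M"
  have "subgroup N' G" using st series_stepD N'_def by blast
  interpret N': subgroup N' G by fact
  have s: "series G (Z \<inter> M) N'" unfolding N'_def using series_Int[OF assms(1) M step.hyps(1)] .
  have ZM: "subgroup (Z \<inter> M) G" using subgroups_Inter_pair assms(2) M by blast
  obtain T Q where T: "finite T" "T \<subseteq> M" and Q: "finite Q" "Q \<subseteq> N'"
    and norm: "\<And>t n. t \<in> T \<Longrightarrow> n \<in> N' \<Longrightarrow> t \<otimes> n \<otimes> inv t \<in> N'"
    and TQ: "\<And>S. subgroup S G \<Longrightarrow> Q \<subseteq> S \<Longrightarrow> S \<subseteq> N' \<Longrightarrow> (\<forall>t\<in>T. \<forall>s\<in>S. t \<otimes> s \<otimes> inv t \<in> S) \<Longrightarrow> S = N'"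
    using series_step_kernel_generators[OF assms(1) step.prems(3) st] unfolding N'_def by blast
  obtain Y where Y: "finite Y" "Y \<subseteq> N'" "generate G ((Z \<inter> M) \<union> Y) = N'"
    using series_finite_extension[OF assms(1) s ZM] by blast
  have comm: "z \<otimes> b = b \<otimes> z" if "z \<in> Z" "b \<in> M" for z b using step.prems that by blast
  have N'M: "N' \<subseteq> M" by (auto simp: N'_def)
  have "\<exists>z\<in>Z \<inter> M. \<exists>w\<in>generate G Y. q = w \<otimes> z" if "q \<in> N'" for q
  proof (rule generate_subgroup_Un_central[OF assms(1) ZM])
    show "Y \<subseteq> carrier G" using Y(2) by auto
    show "q \<in> generate G ((Z \<inter> M) \<union> Y)" using Y(3) that by simp
  qed (use comm N'M Y(3) in blast)
  then obtain z where z: "\<And>q. q \<in> N' \<Longrightarrow> z q \<in> Z \<inter> M \<and> (\<exists>w\<in>generate G Y. q = w \<otimes> z q)" by metis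
  \<comment> \<open>besides \<open>Q\<close>, the conjugates of \<open>Y\<close> under \<open>T\<close> must be captured for \<open>S\<close> to be stable under \<open>T\<close>\<close>
  define Q' where "Q' = Q \<union> (\<lambda>(t, y). t \<otimes> y \<otimes> inv t) ` (T \<times> Y)"
  have Q': "finite Q'" "Q' \<subseteq> N'" using Q T Y norm by (auto simp: Q'_def)
  define U where "U = Y \<union> z ` Q'"
  define S where "S = generate G U"
  have zN': "z q \<in> N'" if "q \<in> Q'" for q using z Q' that ZN by (auto simp: N'_def)
  have U: "U \<subseteq> N'" using Y zN' by (auto simp: U_def)
  have "subgroup S G" unfolding S_def using U by (intro generate_is_subgroup) auto
  interpret S: subgroup S G by fact
  have YS: "generate G Y \<subseteq> S" unfolding S_def by (rule mono_generate) (auto simp: U_def)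
  have Q'S: "Q' \<subseteq> S"
  proof
    fix q assume q: "q \<in> Q'"
    then obtain w where w: "w \<in> generate G Y" "q = w \<otimes> z q" using z Q' by blast
    have "z q \<in> S" unfolding S_def using q by (intro generate.incl) (auto simp: U_def)
    then show "q \<in> S" using w YS S.m_closed[of w "z q"] by auto
  qed
  have "S = N'"
  proof (rule TQ)
    show "subgroup S G" by fact
    show "Q \<subseteq> S" using Q'S by (auto simp: Q'_def)
    show "S \<subseteq> N'" unfolding S_def by (rule generate_subgroup_incl[OF U N'.subgroup_axioms])
    show "\<forall>t\<in>T. \<forall>s\<in>S. t \<otimes> s \<otimes> inv t \<in> S"
    proof (intro ballI)
      fix t s assume t: "t \<in> T" and s: "s \<in> S"
      have tc: "t \<in> carrier G" using t T by auto
      have u: "t \<otimes> u \<otimes> inv t \<in> S" if "u \<in> U" for u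
        using that unfolding U_def
      proof
        assume "u \<in> Y" then show ?thesis using Q'S t by (auto simp: Q'_def)
      next
        assume "u \<in> z ` Q'"
        then have "u \<in> Z" "u \<in> U" using z Q' by (auto simp: U_def)
        moreover have "t \<otimes> u = u \<otimes> t" using comm t T \<open>u \<in> Z\<close> by force
        ultimately have "t \<otimes> u \<otimes> inv t = u" using tc by (simp add: m_assoc)
        then show ?thesis unfolding S_def using \<open>u \<in> U\<close> by (auto intro: generate.incl)
      qed
      show "t \<otimes> s \<otimes> inv t \<in> S" unfolding S_def
      proof (rule generate_conj_closed[OF is_group _ tc])
        show "U \<subseteq> carrier G" using U by auto
      qed (use u s in \<open>simp_all add: S_def\<close>)
    qed
  qed
  then have "fin_gen G N'" unfolding fin_gen_def S_def using Y Q' U by (intro exI[of _ U]) (auto simp: U_def)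
  moreover have "N' \<subseteq> N" by (auto simp: N'_def)
  ultimately have "series G {\<one>} N'" using step.IH step.prems D by blast
  then show ?case using st N'_def rtranclp.rtrancl_into_rtrancl by metis
qed

section \<open>Twisted subgroups\<close>

text \<open>
  The multiplication of a group is recovered only partially from \<open>(x, y) \<mapsto> xyx\<close>: in an abelian
  group a twisted subgroup is closed under adding doubles of its elements, not under addition.
\<close>
definition twisted_subgroup :: "('a, 'b) monoid_scheme \<Rightarrow> 'a set \<Rightarrow> bool" where
  "twisted_subgroup H \<Sigma> \<longleftrightarrow> \<one>\<^bsub>H\<^esub> \<in> \<Sigma> \<and> (\<forall>x\<in>\<Sigma>. inv\<^bsub>H\<^esub> x \<in> \<Sigma>) \<and>
     (\<forall>x\<in>\<Sigma>. \<forall>y\<in>\<Sigma>. x \<otimes>\<^bsub>H\<^esub> y \<otimes>\<^bsub>H\<^esub> x \<in> \<Sigma>)"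

text \<open>
  Writing \<open>p = xt\<close> and \<open>q = yt\<close>, one has \<open>xyx \<cdot> t = p (t\<inverse> q t\<inverse>) p\<close> and \<open>x\<inverse> t = t p\<inverse> t\<close>, which are
  again built from palindromes.
\<close>
lemma twisted_subgroup_translate:
  fixes H (structure)
  assumes "group H" "twisted_subgroup H \<Sigma>" "t \<in> \<Sigma>" "t \<in> carrier H"
  shows "twisted_subgroup H {h \<in> carrier H. h \<otimes> t \<in> \<Sigma>}"
proof -
  interpret group H by fact
  have inv: "inv x \<in> \<Sigma>" and pal: "x \<otimes> y \<otimes> x \<in> \<Sigma>" if "x \<in> \<Sigma>" "y \<in> \<Sigma>" for x y
    using assms(2) that unfolding twisted_subgroup_def by auto
  show ?thesis
    unfolding twisted_subgroup_def
  proof (intro conjI ballI)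
    show "\<one> \<in> {h \<in> carrier H. h \<otimes> t \<in> \<Sigma>}" using assms by simp
  next
    fix x assume "x \<in> {h \<in> carrier H. h \<otimes> t \<in> \<Sigma>}"
    then have x: "x \<in> carrier H" "x \<otimes> t \<in> \<Sigma>" by auto
    have "t \<otimes> inv (x \<otimes> t) \<otimes> t \<in> \<Sigma>"
      by (intro pal assms(3) inv[OF x(2) x(2)])
    then show "inv x \<in> {h \<in> carrier H. h \<otimes> t \<in> \<Sigma>}" using x assms(4) by (simp add: inv_mult_group m_assoc)
  next
    fix x y assume "x \<in> {h \<in> carrier H. h \<otimes> t \<in> \<Sigma>}" "y \<in> {h \<in> carrier H. h \<otimes> t \<in> \<Sigma>}"
    then have x: "x \<in> carrier H" "x \<otimes> t \<in> \<Sigma>" and y: "y \<in> carrier H" "y \<otimes> t \<in> \<Sigma>" by auto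
    have "(x \<otimes> t) \<otimes> (inv t \<otimes> (y \<otimes> t) \<otimes> inv t) \<otimes> (x \<otimes> t) \<in> \<Sigma>"
      by (intro pal x y inv[OF assms(3) x(2)])
    then show "x \<otimes> y \<otimes> x \<in> {h \<in> carrier H. h \<otimes> t \<in> \<Sigma>}" using x y assms(4) by (simp add: m_assoc)
  qed
qed

text \<open>
  Let \<open>X\<close> be a basis for \<open>N\<close>. Translation by \<open>t \<in> \<Sigma>\<close> turns \<open>\<Sigma>\<close> into a twisted subgroup again, so the
  coset \<open>N t\<close> lies in \<open>\<Sigma>\<close> as soon as the finite set \<open>X t\<close> does. This covers a finite factor. For a
  cyclic factor, \<open>t (n t\<^bsup>j\<^esup>) t\<close> runs through \<open>N t\<^bsup>j+2\<^esup>\<close>, so the two cosets \<open>N\<close> and \<open>N t\<close> yield all others.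
\<close>
lemma series_twisted_basis:
  fixes H (structure)
  assumes "group H" "series H {\<one>} K"
  shows "\<exists>X. finite X \<and> X \<subseteq> K \<and> (\<forall>\<Sigma>. twisted_subgroup H \<Sigma> \<longrightarrow> X \<subseteq> \<Sigma> \<longrightarrow> K \<subseteq> \<Sigma>)"
  using assms(2)
proof (induction rule: rtranclp_induct)
  case base
  then show ?case by (intro exI[of _ "{}"]) (simp add: twisted_subgroup_def)
next
  case (step N K)
  interpret group H by fact
  note D = series_stepD[OF step.hyps(2)]
  interpret N: subgroup N H by (rule D)
  interpret K: subgroup K H by (rule D)
  obtain X where X: "finite X" "X \<subseteq> N" and XN: "\<And>\<Sigma>. twisted_subgroup H \<Sigma> \<Longrightarrow> X \<subseteq> \<Sigma> \<Longrightarrow> N \<subseteq> \<Sigma>"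
    using step.IH by blast
  have coset: "n \<otimes> t \<in> \<Sigma>" if S: "twisted_subgroup H \<Sigma>" and t: "t \<in> \<Sigma>" "t \<in> carrier H"
    and Xt: "(\<lambda>x. x \<otimes> t) ` X \<subseteq> \<Sigma>" and n: "n \<in> N" for \<Sigma> t n
  proof -
    have "X \<subseteq> {h \<in> carrier H. h \<otimes> t \<in> \<Sigma>}" using X Xt by auto
    then show ?thesis using XN[OF twisted_subgroup_translate[OF assms(1) S t]] n by blast
  qed
  from step.hyps(2) show ?case unfolding series_step_def
  proof
    assume st: "finite_step H N K"
    obtain F where F: "finite F" "F \<subseteq> K" "\<forall>k\<in>K. \<exists>f\<in>F. k \<otimes> f \<in> N" using finite_stepD(4)[OF st] by blast
    define X' where "X' = m_inv H ` F \<union> (\<lambda>(x, f). x \<otimes> inv f) ` (X \<times> F)"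
    have "K \<subseteq> \<Sigma>" if S: "twisted_subgroup H \<Sigma>" "X' \<subseteq> \<Sigma>" for \<Sigma>
    proof
      fix k assume k: "k \<in> K"
      then obtain f where f: "f \<in> F" "k \<otimes> f \<in> N" using F by blast
      have fc: "f \<in> carrier H" using f F by auto
      have "(k \<otimes> f) \<otimes> inv f \<in> \<Sigma>"
        by (rule coset[OF S(1)]) (use S(2) f fc in \<open>auto simp: X'_def\<close>)
      then show "k \<in> \<Sigma>" using k fc by (simp add: m_assoc)
    qed
    moreover have inK: "x \<otimes> inv f \<in> K" if "x \<in> X" "f \<in> F" for x f using that X D(3) F by blast
    moreover have "finite X'" "X' \<subseteq> K" using F X inK by (auto simp: X'_def)
    ultimately show ?thesis by (intro exI[of _ X'] conjI allI impI)
  next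
    assume st: "cyclic_step H N K"
    obtain t where t: "t \<in> K" "\<forall>k\<in>K. \<exists>i::int. k \<otimes> t [^] i \<in> N" using cyclic_stepD(5)[OF st] by blast
    have tc: "t \<in> carrier H" using t by simp
    have norm: "k \<otimes> n \<otimes> inv k \<in> N" if "k \<in> K" "n \<in> N" for k n using cyclic_stepD(4)[OF st that] .
    define X' where "X' = X \<union> {t} \<union> (\<lambda>x. x \<otimes> t) ` X"
    have "K \<subseteq> \<Sigma>" if S: "twisted_subgroup H \<Sigma>" "X' \<subseteq> \<Sigma>" for \<Sigma>
    proof -
      have inv: "inv x \<in> \<Sigma>" and pal: "x \<otimes> y \<otimes> x \<in> \<Sigma>" if "x \<in> \<Sigma>" "y \<in> \<Sigma>" for x y
        using S(1) that unfolding twisted_subgroup_def by auto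
      have tS: "t \<in> \<Sigma>" using S by (auto simp: X'_def)
      have N0: "N \<subseteq> \<Sigma>" using XN[OF S(1)] S(2) by (auto simp: X'_def)
      have N1: "n \<otimes> t \<in> \<Sigma>" if "n \<in> N" for n
        by (rule coset[OF S(1) tS tc _ that]) (use S(2) in \<open>auto simp: X'_def\<close>)
      have Nj: "\<forall>n\<in>N. n \<otimes> t [^] j \<in> \<Sigma> \<and> n \<otimes> t [^] Suc j \<in> \<Sigma>" for j :: nat
      proof (induction j)
        case 0
        show ?case using N0 N1 tc by auto
      next
        case (Suc j)
        show ?case
        proof (intro ballI conjI)
          fix n assume n: "n \<in> N"
          show "n \<otimes> t [^] Suc j \<in> \<Sigma>" using Suc n by blast
          have "inv t \<otimes> n \<otimes> inv (inv t) \<in> N" using norm n t by blast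
          then have "t \<otimes> ((inv t \<otimes> n \<otimes> inv (inv t)) \<otimes> t [^] j) \<otimes> t \<in> \<Sigma>" using pal tS Suc by blast
          moreover have "t \<otimes> ((inv t \<otimes> n \<otimes> inv (inv t)) \<otimes> t [^] j) \<otimes> t = n \<otimes> t [^] Suc (Suc j)"
            using n tc by (simp add: m_assoc) (metis m_assoc nat_pow_Suc nat_pow_Suc2 nat_pow_closed)
          ultimately show "n \<otimes> t [^] Suc (Suc j) \<in> \<Sigma>" by simp
        qed
      qed
      show ?thesis
      proof
        fix k assume k: "k \<in> K"
        then obtain i :: int where i: "k \<otimes> t [^] i \<in> N" using t by blast
        have kc: "k \<in> carrier H" using k by simp
        show "k \<in> \<Sigma>"
        proof (cases "i \<le> 0")
          case True
          have "(k \<otimes> t [^] i) \<otimes> t [^] nat (- i) \<in> \<Sigma>" using Nj i by blast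
          moreover have "t [^] nat (- i) = t [^] (- i)" using True by (simp add: pow_nat)
          ultimately show ?thesis using kc tc by (simp add: m_assoc int_pow_neg)
        next
          case False
          have ti: "t [^] i \<in> K" using t subgroup_int_pow_closed[OF K.subgroup_axioms] by blast
          define n where "n = t [^] i \<otimes> inv (k \<otimes> t [^] i) \<otimes> inv (t [^] i)"
          have "n \<in> N" unfolding n_def using norm ti i by blast
          then have "inv (n \<otimes> t [^] nat i) \<in> \<Sigma>" using Nj inv by blast
          moreover have "t [^] nat i = t [^] i" using False by (simp add: pow_nat)
          ultimately show ?thesis using kc tc by (simp add: n_def m_assoc inv_mult_group)
        qed
      qed
    qed
    moreover have "finite X'" "X' \<subseteq> K" using X D t by (auto simp: X'_def)
    ultimately show ?thesis by (intro exI[of _ X'] conjI allI impI)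
  qed
qed

section \<open>Groups generated by two weakly commuting images\<close>

text \<open>
  A quotient of \<open>\<chi>(H)\<close>, with \<open>\<alpha>\<close> and \<open>\<beta>\<close> the maps \<open>h \<mapsto> h\<close> and \<open>h \<mapsto> h\<^sup>\<psi>\<close>.
\<close>
locale weakly_commuting_pair =
  group G + H: group H + \<alpha>: group_hom H G \<alpha> + \<beta>: group_hom H G \<beta>
  for G (structure) and H and \<alpha> \<beta> +
  assumes commute: "h \<in> carrier H \<Longrightarrow> \<alpha> h \<otimes> \<beta> h = \<beta> h \<otimes> \<alpha> h"
    and generated: "generate G (\<alpha> ` carrier H \<union> \<beta> ` carrier H) = carrier G"
begin

definition mixed where "mixed a b = commutator G (\<alpha> a) (\<beta> b)"
definition discrepancy where "discrepancy h = inv (\<alpha> h) \<otimes> \<beta> h"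
definition D where "D = generate G {mixed a b | a b. a \<in> carrier H \<and> b \<in> carrier H}"
definition L where "L = generate G (discrepancy ` carrier H)"

lemma mixed_closed [simp]: "a \<in> carrier H \<Longrightarrow> b \<in> carrier H \<Longrightarrow> mixed a b \<in> carrier G"
  by (simp add: mixed_def commutator_def)

lemma discrepancy_closed [simp]: "h \<in> carrier H \<Longrightarrow> discrepancy h \<in> carrier G"
  by (simp add: discrepancy_def)

lemma D_subgroup: "subgroup D G"
  unfolding D_def by (intro generate_is_subgroup) auto

lemma L_subgroup: "subgroup L G"
  unfolding L_def by (intro generate_is_subgroup) auto

lemma mixed_in_D: "a \<in> carrier H \<Longrightarrow> b \<in> carrier H \<Longrightarrow> mixed a b \<in> D"
  unfolding D_def by (intro generate.incl) auto

lemma discrepancy_in_L: "h \<in> carrier H \<Longrightarrow> discrepancy h \<in> L"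
  unfolding L_def by (intro generate.incl) auto

text \<open>
  Sidki's identity. It is the relation \<open>[ac, (ac)\<^sup>\<psi>] = 1\<close> with \<open>c = b\<inverse>\<close>, multiplied on both sides so that
  \<open>[a, a\<^sup>\<psi>] = 1\<close> and \<open>[c, c\<^sup>\<psi>] = 1\<close> cancel one letter at each end.
\<close>
lemma mixed_swap:
  assumes "a \<in> carrier H" "b \<in> carrier H"
  shows "mixed a b = commutator G (\<beta> a) (\<alpha> b)"
proof -
  define c where "c = inv\<^bsub>H\<^esub> b"
  have c: "c \<in> carrier H" "b = inv\<^bsub>H\<^esub> c" using assms by (auto simp: c_def)
  have "(\<alpha> a \<otimes> \<alpha> c) \<otimes> (\<beta> a \<otimes> \<beta> c) = (\<beta> a \<otimes> \<beta> c) \<otimes> (\<alpha> a \<otimes> \<alpha> c)"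
    using commute[of "a \<otimes>\<^bsub>H\<^esub> c"] assms c by simp
  then have "inv (\<alpha> a \<otimes> \<beta> a) \<otimes> ((\<alpha> a \<otimes> \<alpha> c) \<otimes> (\<beta> a \<otimes> \<beta> c)) \<otimes> inv (\<alpha> c \<otimes> \<beta> c)
    = inv (\<beta> a \<otimes> \<alpha> a) \<otimes> ((\<beta> a \<otimes> \<beta> c) \<otimes> (\<alpha> a \<otimes> \<alpha> c)) \<otimes> inv (\<beta> c \<otimes> \<alpha> c)"
    using commute[of a] commute[of c] assms c by simp
  then show ?thesis using assms(1) c(1) unfolding mixed_def commutator_def c(2)
    by (simp add: m_assoc inv_mult_group)
qed

lemma commutator_mult_left:
  assumes "x \<in> carrier G" "y \<in> carrier G" "z \<in> carrier G"
  shows "commutator G (x \<otimes> y) z = inv y \<otimes> commutator G x z \<otimes> y \<otimes> commutator G y z"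
  using assms by (simp add: commutator_def m_assoc inv_mult_group)

text \<open>
  The right-hand side is the same for \<open>\<alpha>\<close> and for \<open>\<beta>\<close>, by \<open>mixed_swap\<close>. This is what makes \<open>D\<close> and \<open>L\<close>
  commute.
\<close>
lemma mixed_conj_\<alpha>:
  assumes "a \<in> carrier H" "b \<in> carrier H" "c \<in> carrier H"
  shows "inv (\<alpha> b) \<otimes> mixed a c \<otimes> \<alpha> b = mixed (a \<otimes>\<^bsub>H\<^esub> b) c \<otimes> inv (mixed b c)"
proof -
  have "mixed (a \<otimes>\<^bsub>H\<^esub> b) c = inv (\<alpha> b) \<otimes> mixed a c \<otimes> \<alpha> b \<otimes> mixed b c"
    using commutator_mult_left[of "\<alpha> a" "\<alpha> b" "\<beta> c"] assms by (simp add: mixed_def)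
  then show ?thesis using assms by (simp add: m_assoc)
qed

lemma mixed_conj_\<beta>:
  assumes "a \<in> carrier H" "b \<in> carrier H" "c \<in> carrier H"
  shows "inv (\<beta> b) \<otimes> mixed a c \<otimes> \<beta> b = mixed (a \<otimes>\<^bsub>H\<^esub> b) c \<otimes> inv (mixed b c)"
proof -
  have "mixed (a \<otimes>\<^bsub>H\<^esub> b) c = inv (\<beta> b) \<otimes> mixed a c \<otimes> \<beta> b \<otimes> mixed b c"
    using commutator_mult_left[of "\<beta> a" "\<beta> b" "\<alpha> c"] assms by (simp add: mixed_swap)
  then show ?thesis using assms by (simp add: m_assoc)
qed

lemma D_normalized_\<alpha>:
  assumes "h \<in> carrier H" "d \<in> D"
  shows "\<alpha> h \<otimes> d \<otimes> inv (\<alpha> h) \<in> D"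
  unfolding D_def
proof (rule generate_conj_closed[OF group_axioms])
  fix s assume "s \<in> {mixed a b | a b. a \<in> carrier H \<and> b \<in> carrier H}"
  then obtain a c where s: "s = mixed a c" "a \<in> carrier H" "c \<in> carrier H" by blast
  have "\<alpha> h \<otimes> s \<otimes> inv (\<alpha> h) = mixed (a \<otimes>\<^bsub>H\<^esub> inv\<^bsub>H\<^esub> h) c \<otimes> inv (mixed (inv\<^bsub>H\<^esub> h) c)"
    using mixed_conj_\<alpha>[of a "inv\<^bsub>H\<^esub> h" c] s assms by simp
  also have "\<dots> \<in> D" using s assms mixed_in_D by (intro subgroup.m_closed subgroup.m_inv_closed D_subgroup) auto
  finally show "\<alpha> h \<otimes> s \<otimes> inv (\<alpha> h) \<in> generate G {mixed a b | a b. a \<in> carrier H \<and> b \<in> carrier H}"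
    unfolding D_def .
qed (use assms in \<open>auto simp: D_def[symmetric]\<close>)

lemma D_normalized_\<beta>:
  assumes "h \<in> carrier H" "d \<in> D"
  shows "\<beta> h \<otimes> d \<otimes> inv (\<beta> h) \<in> D"
  unfolding D_def
proof (rule generate_conj_closed[OF group_axioms])
  fix s assume "s \<in> {mixed a b | a b. a \<in> carrier H \<and> b \<in> carrier H}"
  then obtain a c where s: "s = mixed a c" "a \<in> carrier H" "c \<in> carrier H" by blast
  have "\<beta> h \<otimes> s \<otimes> inv (\<beta> h) = mixed (a \<otimes>\<^bsub>H\<^esub> inv\<^bsub>H\<^esub> h) c \<otimes> inv (mixed (inv\<^bsub>H\<^esub> h) c)"
    using mixed_conj_\<beta>[of a "inv\<^bsub>H\<^esub> h" c] s assms by simp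
  also have "\<dots> \<in> D" using s assms mixed_in_D by (intro subgroup.m_closed subgroup.m_inv_closed D_subgroup) auto
  finally show "\<beta> h \<otimes> s \<otimes> inv (\<beta> h) \<in> generate G {mixed a b | a b. a \<in> carrier H \<and> b \<in> carrier H}"
    unfolding D_def .
qed (use assms in \<open>auto simp: D_def[symmetric]\<close>)

lemma mixed_discrepancy_commute:
  assumes "a \<in> carrier H" "c \<in> carrier H" "h \<in> carrier H"
  shows "mixed a c \<otimes> discrepancy h = discrepancy h \<otimes> mixed a c"
proof -
  have "inv (\<alpha> h) \<otimes> mixed a c \<otimes> \<alpha> h = inv (\<beta> h) \<otimes> mixed a c \<otimes> \<beta> h"
    using mixed_conj_\<alpha> mixed_conj_\<beta> assms by simp
  then have "\<beta> h \<otimes> (inv (\<alpha> h) \<otimes> mixed a c \<otimes> \<alpha> h) \<otimes> inv (\<alpha> h)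
    = \<beta> h \<otimes> (inv (\<beta> h) \<otimes> mixed a c \<otimes> \<beta> h) \<otimes> inv (\<alpha> h)" by simp
  then have 1: "\<beta> h \<otimes> inv (\<alpha> h) \<otimes> mixed a c = mixed a c \<otimes> (\<beta> h \<otimes> inv (\<alpha> h))"
    using assms by (simp add: m_assoc)
  have "inv (\<alpha> h) \<otimes> (\<alpha> h \<otimes> \<beta> h) \<otimes> inv (\<alpha> h) = inv (\<alpha> h) \<otimes> (\<beta> h \<otimes> \<alpha> h) \<otimes> inv (\<alpha> h)"
    using commute[OF assms(3)] by simp
  then have "\<beta> h \<otimes> inv (\<alpha> h) = discrepancy h" using assms by (simp add: discrepancy_def m_assoc)
  then show ?thesis using 1 by simp
qed

lemma D_L_commute:
  assumes "d \<in> D" "l \<in> L"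
  shows "d \<otimes> l = l \<otimes> d"
proof -
  have 1: "mixed a c \<otimes> l = l \<otimes> mixed a c" if "a \<in> carrier H" "c \<in> carrier H" for a c
  proof (rule generate_commute[OF group_axioms])
    show "l \<in> generate G (discrepancy ` carrier H)" using assms by (simp add: L_def)
  qed (use that mixed_discrepancy_commute in auto)
  have "l \<otimes> d = d \<otimes> l"
  proof (rule generate_commute[OF group_axioms])
    show "d \<in> generate G {mixed a b | a b. a \<in> carrier H \<and> b \<in> carrier H}" using assms by (simp add: D_def)
    show "l \<in> carrier G" using assms L_subgroup by (simp add: subgroup.mem_carrier)
  qed (use 1 in auto)
  then show ?thesis by simp
qed

lemma discrepancy_conj:
  assumes "a \<in> carrier H" "b \<in> carrier H"
  shows "inv (\<alpha> a) \<otimes> discrepancy b \<otimes> \<alpha> a = discrepancy (b \<otimes>\<^bsub>H\<^esub> a) \<otimes> inv (discrepancy a)"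
  using assms by (simp add: discrepancy_def m_assoc inv_mult_group)

lemma L_normalized_\<alpha>:
  assumes "h \<in> carrier H" "l \<in> L"
  shows "\<alpha> h \<otimes> l \<otimes> inv (\<alpha> h) \<in> L"
  unfolding L_def
proof (rule generate_conj_closed[OF group_axioms])
  fix s assume "s \<in> discrepancy ` carrier H"
  then obtain b where s: "s = discrepancy b" "b \<in> carrier H" by blast
  have "\<alpha> h \<otimes> s \<otimes> inv (\<alpha> h) = discrepancy (b \<otimes>\<^bsub>H\<^esub> inv\<^bsub>H\<^esub> h) \<otimes> inv (discrepancy (inv\<^bsub>H\<^esub> h))"
    using discrepancy_conj[of "inv\<^bsub>H\<^esub> h" b] s assms by simp
  also have "\<dots> \<in> L" using s assms discrepancy_in_L by (intro subgroup.m_closed subgroup.m_inv_closed L_subgroup) auto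
  finally show "\<alpha> h \<otimes> s \<otimes> inv (\<alpha> h) \<in> generate G (discrepancy ` carrier H)" unfolding L_def .
qed (use assms in \<open>auto simp: L_def[symmetric]\<close>)

lemma discrepancy_one: "discrepancy \<one>\<^bsub>H\<^esub> = \<one>" by (simp add: discrepancy_def)

lemma discrepancy_inv:
  assumes "h \<in> carrier H" shows "discrepancy (inv\<^bsub>H\<^esub> h) = inv (discrepancy h)"
proof -
  have "inv (\<beta> h) \<otimes> (\<alpha> h \<otimes> \<beta> h) \<otimes> inv (\<beta> h) = inv (\<beta> h) \<otimes> (\<beta> h \<otimes> \<alpha> h) \<otimes> inv (\<beta> h)"
    using commute[OF assms] by simp
  then show ?thesis using assms by (simp add: discrepancy_def m_assoc inv_mult_group)
qed

text \<open>
  For \<open>h = xy\<close> the middle part \<open>h\<inverse> h\<^sup>\<psi>\<close> of \<open>(xyx)\<inverse> (xyx)\<^sup>\<psi> = x\<inverse> (h\<inverse> h\<^sup>\<psi>) x\<^sup>\<psi>\<close> may be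
  replaced by \<open>h\<^sup>\<psi> h\<inverse>\<close>, and then the letters group into three discrepancies.
\<close>
lemma discrepancy_palindrome:
  assumes "x \<in> carrier H" "y \<in> carrier H"
  shows "discrepancy (x \<otimes>\<^bsub>H\<^esub> y \<otimes>\<^bsub>H\<^esub> x) = discrepancy x \<otimes> discrepancy y \<otimes> discrepancy x"
proof -
  have comm: "inv (\<alpha> h) \<otimes> \<beta> h = \<beta> h \<otimes> inv (\<alpha> h)" if "h \<in> carrier H" for h
  proof -
    have "inv (\<alpha> h) \<otimes> (\<alpha> h \<otimes> \<beta> h) \<otimes> inv (\<alpha> h) = inv (\<alpha> h) \<otimes> (\<beta> h \<otimes> \<alpha> h) \<otimes> inv (\<alpha> h)"
      using commute[OF that] by simp
    then show ?thesis using that by (simp add: m_assoc)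
  qed
  have "discrepancy (x \<otimes>\<^bsub>H\<^esub> y \<otimes>\<^bsub>H\<^esub> x) = inv (\<alpha> x) \<otimes> (inv (\<alpha> (x \<otimes>\<^bsub>H\<^esub> y)) \<otimes> \<beta> (x \<otimes>\<^bsub>H\<^esub> y)) \<otimes> \<beta> x"
    using assms by (simp add: discrepancy_def m_assoc inv_mult_group)
  also have "\<dots> = inv (\<alpha> x) \<otimes> (\<beta> (x \<otimes>\<^bsub>H\<^esub> y) \<otimes> inv (\<alpha> (x \<otimes>\<^bsub>H\<^esub> y))) \<otimes> \<beta> x"
    using comm[of "x \<otimes>\<^bsub>H\<^esub> y"] assms by simp
  also have "\<dots> = inv (\<alpha> x) \<otimes> \<beta> x \<otimes> (\<beta> y \<otimes> inv (\<alpha> y)) \<otimes> inv (\<alpha> x) \<otimes> \<beta> x"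
    using assms by (simp add: m_assoc inv_mult_group)
  also have "\<dots> = discrepancy x \<otimes> discrepancy y \<otimes> discrepancy x"
    using assms comm[of y] by (simp add: discrepancy_def m_assoc)
  finally show ?thesis .
qed

lemma L_fin_gen:
  assumes "series H {\<one>\<^bsub>H\<^esub>} (carrier H)"
  shows "fin_gen G L"
proof -
  obtain X where X: "finite X" "X \<subseteq> carrier H"
    and tw: "\<And>\<Sigma>. twisted_subgroup H \<Sigma> \<Longrightarrow> X \<subseteq> \<Sigma> \<Longrightarrow> carrier H \<subseteq> \<Sigma>"
    using series_twisted_basis[OF H.is_group assms] by blast
  define S where "S = generate G (discrepancy ` X)"
  have XG: "discrepancy ` X \<subseteq> carrier G" using X by auto
  have S: "subgroup S G" unfolding S_def using XG by (intro generate_is_subgroup)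
  interpret S: subgroup S G by fact
  have "twisted_subgroup H {h \<in> carrier H. discrepancy h \<in> S}"
    unfolding twisted_subgroup_def using discrepancy_one discrepancy_inv discrepancy_palindrome by auto
  moreover have "X \<subseteq> {h \<in> carrier H. discrepancy h \<in> S}" using X by (auto simp: S_def intro: generate.incl)
  ultimately have "carrier H \<subseteq> {h \<in> carrier H. discrepancy h \<in> S}" by (rule tw)
  then have "L \<subseteq> S" unfolding L_def by (intro generate_subgroup_incl[OF _ S]) auto
  moreover have "S \<subseteq> L" unfolding L_def S_def using X by (intro mono_generate) auto
  ultimately show ?thesis unfolding fin_gen_def S_def using X XG by blast
qed

text \<open>
  The series are built as \<open>D \<le> D \<alpha>(H) \<le> D \<alpha>(H) \<beta>(H) = G\<close>, restricted to \<open>L\<close>, made to start at the trivial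
  group by the central extension principle, and continued by \<open>L \<le> L \<alpha>(H) = G\<close>.
\<close>
theorem series_carrier:
  assumes s: "series H {\<one>\<^bsub>H\<^esub>} (carrier H)"
  shows "series G {\<one>} (carrier G)"
proof -
  interpret DD: subgroup D G by (rule D_subgroup)
  interpret LL: subgroup L G by (rule L_subgroup)
  define M where "M = {d \<otimes> \<alpha> h | d h. d \<in> D \<and> h \<in> carrier H}"
  define M' where "M' = {m \<otimes> \<beta> h | m h. m \<in> M \<and> h \<in> carrier H}"
  have s1: "series G D M" unfolding M_def
    by (rule series_hom_mult[OF group_axioms H.is_group \<alpha>.homh D_subgroup D_normalized_\<alpha> s])
  have M: "subgroup M G" using series_subgroup(1)[OF s1 D_subgroup] .
  interpret M: subgroup M G by fact
  have MI: "d \<otimes> \<alpha> h \<in> M" if "d \<in> D" "h \<in> carrier H" for d h using that unfolding M_def by blast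
  have normM: "\<beta> k \<otimes> m \<otimes> inv (\<beta> k) \<in> M" if k: "k \<in> carrier H" and m: "m \<in> M" for k m
  proof -
    obtain d h where d: "m = d \<otimes> \<alpha> h" "d \<in> D" "h \<in> carrier H" using m unfolding M_def by blast
    define e where "e = (\<beta> k \<otimes> d \<otimes> inv (\<beta> k)) \<otimes> (\<alpha> h \<otimes> mixed h (inv\<^bsub>H\<^esub> k) \<otimes> inv (\<alpha> h))"
    have "e \<in> D" unfolding e_def
      using d k D_normalized_\<beta>[of k d] D_normalized_\<alpha>[of h "mixed h (inv\<^bsub>H\<^esub> k)"] mixed_in_D[of h "inv\<^bsub>H\<^esub> k"] by simp
    moreover have "\<beta> k \<otimes> m \<otimes> inv (\<beta> k) = e \<otimes> \<alpha> h"
      using d k unfolding e_def mixed_def commutator_def by (simp add: m_assoc)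
    ultimately show ?thesis using MI d by simp
  qed
  have s2: "series G M M'" unfolding M'_def
    by (rule series_hom_mult[OF group_axioms H.is_group \<beta>.homh M normM s])
  have M': "subgroup M' G" using series_subgroup(1)[OF s2 M] .
  have "\<alpha> h \<in> M'" if h: "h \<in> carrier H" for h
  proof -
    have "\<alpha> h \<in> M" using MI[OF DD.one_closed h] h by simp
    then show ?thesis using series_subgroup(2)[OF s2 M] by blast
  qed
  moreover have "\<beta> h \<in> M'" if h: "h \<in> carrier H" for h
  proof -
    have "\<one> \<otimes> \<beta> h \<in> M'" unfolding M'_def using M.one_closed h by (intro CollectI exI[of _ \<one>] exI[of _ h]) simp
    then show ?thesis using h by simp
  qed
  ultimately have "carrier G \<subseteq> M'" unfolding generated[symmetric]
    by (intro generate_subgroup_incl[OF _ M']) auto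
  then have "M' = carrier G" using subgroup.subset[OF M'] by blast
  then have "series G D (carrier G)" using s1 s2 by simp
  from series_Int[OF group_axioms L_subgroup this]
  have s3: "series G (D \<inter> L) L" using LL.subset by (simp add: Int_absorb1)
  have DL: "subgroup (D \<inter> L) G" using subgroups_Inter_pair D_subgroup L_subgroup by blast
  have s4: "series G {\<one>} L"
    by (rule fin_gen_central_extension_series[OF group_axioms DL s3 _ _ L_fin_gen[OF s]])
      (use D_L_commute in auto)
  define P where "P = {l \<otimes> \<alpha> h | l h. l \<in> L \<and> h \<in> carrier H}"
  have s5: "series G L P" unfolding P_def
    by (rule series_hom_mult[OF group_axioms H.is_group \<alpha>.homh L_subgroup L_normalized_\<alpha> s])
  have P: "subgroup P G" using series_subgroup(1)[OF s5 L_subgroup] .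
  have PI: "l \<otimes> \<alpha> h \<in> P" if "l \<in> L" "h \<in> carrier H" for l h using that unfolding P_def by blast
  have "\<alpha> h \<in> P" "\<beta> h \<in> P" if h: "h \<in> carrier H" for h
  proof -
    show "\<alpha> h \<in> P" using PI[OF LL.one_closed h] h by simp
    have "(\<alpha> h \<otimes> discrepancy h \<otimes> inv (\<alpha> h)) \<otimes> \<alpha> h \<in> P"
      by (rule PI[OF L_normalized_\<alpha>[OF h discrepancy_in_L[OF h]] h])
    then show "\<beta> h \<in> P" using h by (simp add: discrepancy_def m_assoc)
  qed
  then have "carrier G \<subseteq> P" unfolding generated[symmetric]
    by (intro generate_subgroup_incl[OF _ P]) auto
  then have "P = carrier G" using subgroup.subset[OF P] by blast
  then show ?thesis using s4 s5 by simp
qed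

end

section \<open>Groups generated by a crossed pairing\<close>
lemma (in group) conjugate_closed [simp]:
  "x \<in> carrier G \<Longrightarrow> y \<in> carrier G \<Longrightarrow> conjugate G x y \<in> carrier G"
  by (simp add: conjugate_def)

lemma (in group) conjugate_conjugate:
  "x \<in> carrier G \<Longrightarrow> y \<in> carrier G \<Longrightarrow> z \<in> carrier G \<Longrightarrow>
    conjugate G (conjugate G x y) z = conjugate G x (y \<otimes> z)"
  by (simp add: conjugate_def m_assoc inv_mult_group)

lemma (in group) conjugate_mult:
  "x \<in> carrier G \<Longrightarrow> y \<in> carrier G \<Longrightarrow> z \<in> carrier G \<Longrightarrow>
    conjugate G (x \<otimes> y) z = conjugate G x z \<otimes> conjugate G y z"
  by (simp add: conjugate_def m_assoc)

lemma (in group) conjugate_one [simp]: "x \<in> carrier G \<Longrightarrow> conjugate G x \<one> = x"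
  by (simp add: conjugate_def)

lemma (in group) conjugate_commuting:
  "x \<in> carrier G \<Longrightarrow> y \<in> carrier G \<Longrightarrow> x \<otimes> y = y \<otimes> x \<Longrightarrow> conjugate G x y = x"
  by (simp add: conjugate_def m_assoc)

lemma int_set_UNIV:
  fixes I :: "int set"
  assumes "1 \<in> I" "\<And>i j. i \<in> I \<Longrightarrow> j \<in> I \<Longrightarrow> i + j \<in> I" "\<And>i. i \<in> I \<Longrightarrow> - i \<in> I"
  shows "i \<in> I"
proof -
  have "0 \<in> I" using assms(2)[OF assms(1) assms(3)[OF assms(1)]] by simp
  then obtain d where "d \<in> I" "\<forall>i\<in>I. d dvd i" using int_subgroup_principal[of I] assms(2,3) by blast
  have n: "int n \<in> I" for n
  proof (induction n)
    case (Suc n)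
    then show ?case using assms(2)[OF _ assms(1), of "int n"] by (simp add: add.commute)
  qed (simp add: \<open>0 \<in> I\<close>)
  show ?thesis using n[of "nat i"] assms(3)[OF n[of "nat (- i)"]] by (cases "i \<ge> 0") auto
qed

text \<open>
  A quotient of \<open>H \<otimes> H\<close>, with \<open>f a b\<close> the image of \<open>a \<otimes> b\<close>.
\<close>
locale crossed_pairing =
  group G + H: group H
  for G (structure) and H and f +
  assumes f_closed [simp]: "a \<in> carrier H \<Longrightarrow> b \<in> carrier H \<Longrightarrow> f a b \<in> carrier G"
    and f_mult_left: "a \<in> carrier H \<Longrightarrow> b \<in> carrier H \<Longrightarrow> c \<in> carrier H \<Longrightarrow>
      f (a \<otimes>\<^bsub>H\<^esub> b) c = f (conjugate H a b) (conjugate H c b) \<otimes> f b c"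
    and f_mult_right: "a \<in> carrier H \<Longrightarrow> b \<in> carrier H \<Longrightarrow> c \<in> carrier H \<Longrightarrow>
      f a (b \<otimes>\<^bsub>H\<^esub> c) = f a c \<otimes> f (conjugate H a c) (conjugate H b c)"
    and generated: "generate G {f a b | a b. a \<in> carrier H \<and> b \<in> carrier H} = carrier G"
begin

lemma f_one_left [simp]: assumes "c \<in> carrier H" shows "f \<one>\<^bsub>H\<^esub> c = \<one>"
proof -
  have "f \<one>\<^bsub>H\<^esub> c \<otimes> f \<one>\<^bsub>H\<^esub> c = f \<one>\<^bsub>H\<^esub> c" using f_mult_left[of "\<one>\<^bsub>H\<^esub>" "\<one>\<^bsub>H\<^esub>" c] assms by simp
  then show ?thesis using assms by simp
qed

lemma f_one_right [simp]: assumes "c \<in> carrier H" shows "f c \<one>\<^bsub>H\<^esub> = \<one>"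
proof -
  have "f c \<one>\<^bsub>H\<^esub> \<otimes> f c \<one>\<^bsub>H\<^esub> = f c \<one>\<^bsub>H\<^esub>" using f_mult_right[of c "\<one>\<^bsub>H\<^esub>" "\<one>\<^bsub>H\<^esub>"] assms by simp
  then show ?thesis using assms by simp
qed

text \<open>
  Expanding \<open>f (ab) (cd)\<close> first in the left and first in the right argument gives two products with
  equal outer factors; the inner ones compare \<open>f x y \<cdot> f b d\<close> with \<open>f b d \<cdot> f x' y'\<close>. Here \<open>a\<close> and \<open>c\<close> are
  chosen such that \<open>x = a\<^bsup>db\<^esup>\<close> and \<open>y = c\<^bsup>db\<^esup>\<close>, whence \<open>x' = a\<^bsup>bd\<^esup> = x\<^bsup>[b,d]\<^esup>\<close>.
\<close>
lemma f_conjugate_commutator: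
  assumes "x \<in> carrier H" "y \<in> carrier H" "b \<in> carrier H" "d \<in> carrier H"
  shows "inv (f b d) \<otimes> f x y \<otimes> f b d =
    f (conjugate H x (commutator H b d)) (conjugate H y (commutator H b d))"
proof -
  define a where "a = conjugate H x (inv\<^bsub>H\<^esub> (d \<otimes>\<^bsub>H\<^esub> b))"
  define c where "c = conjugate H y (inv\<^bsub>H\<^esub> (d \<otimes>\<^bsub>H\<^esub> b))"
  have ac: "a \<in> carrier H" "c \<in> carrier H" using assms by (simp_all add: a_def c_def)
  have swap: "b \<otimes>\<^bsub>H\<^esub> conjugate H d b = d \<otimes>\<^bsub>H\<^esub> b" "d \<otimes>\<^bsub>H\<^esub> conjugate H b d = b \<otimes>\<^bsub>H\<^esub> d"
    using assms by (simp_all add: conjugate_def H.m_assoc)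
  have "f (a \<otimes>\<^bsub>H\<^esub> b) (c \<otimes>\<^bsub>H\<^esub> d) =
    f (conjugate H a b) (conjugate H d b) \<otimes> f (conjugate H a (d \<otimes>\<^bsub>H\<^esub> b)) (conjugate H c (d \<otimes>\<^bsub>H\<^esub> b))
      \<otimes> (f b d \<otimes> f (conjugate H b d) (conjugate H c d))"
    using assms ac f_mult_left[of a b "c \<otimes>\<^bsub>H\<^esub> d"] f_mult_right[of b c d]
      f_mult_right[of "conjugate H a b" "conjugate H c b" "conjugate H d b"]
    by (simp add: H.conjugate_mult H.conjugate_conjugate swap)
  moreover
  have r: "f (a \<otimes>\<^bsub>H\<^esub> b) (c \<otimes>\<^bsub>H\<^esub> d) =
    f (a \<otimes>\<^bsub>H\<^esub> b) d \<otimes> f (conjugate H (a \<otimes>\<^bsub>H\<^esub> b) d) (conjugate H c d)"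
    using f_mult_right[of "a \<otimes>\<^bsub>H\<^esub> b" c d] assms ac by simp
  then have "f (a \<otimes>\<^bsub>H\<^esub> b) (c \<otimes>\<^bsub>H\<^esub> d) =
    f (conjugate H a b) (conjugate H d b) \<otimes> f b d \<otimes>
      (f (conjugate H a (b \<otimes>\<^bsub>H\<^esub> d)) (conjugate H c (b \<otimes>\<^bsub>H\<^esub> d)) \<otimes> f (conjugate H b d) (conjugate H c d))"
    unfolding r using assms ac f_mult_left[of a b d]
      f_mult_left[of "conjugate H a d" "conjugate H b d" "conjugate H c d"]
    by (simp add: H.conjugate_mult H.conjugate_conjugate swap)
  ultimately have "f (conjugate H a (d \<otimes>\<^bsub>H\<^esub> b)) (conjugate H c (d \<otimes>\<^bsub>H\<^esub> b)) \<otimes> f b d =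
    f b d \<otimes> f (conjugate H a (b \<otimes>\<^bsub>H\<^esub> d)) (conjugate H c (b \<otimes>\<^bsub>H\<^esub> d))"
    using assms ac by (simp add: m_assoc[symmetric])
      (simp add: m_assoc)
  moreover have "conjugate H a (d \<otimes>\<^bsub>H\<^esub> b) = x" "conjugate H c (d \<otimes>\<^bsub>H\<^esub> b) = y"
    using assms by (simp_all add: a_def c_def H.conjugate_conjugate)
  moreover have "inv\<^bsub>H\<^esub> (d \<otimes>\<^bsub>H\<^esub> b) \<otimes>\<^bsub>H\<^esub> (b \<otimes>\<^bsub>H\<^esub> d) = commutator H b d"
    using assms by (simp add: commutator_def H.inv_mult_group H.m_assoc)
  then have "conjugate H a (b \<otimes>\<^bsub>H\<^esub> d) = conjugate H x (commutator H b d)"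
    "conjugate H c (b \<otimes>\<^bsub>H\<^esub> d) = conjugate H y (commutator H b d)"
    using assms by (simp_all add: a_def c_def H.conjugate_conjugate)
  ultimately have "f x y \<otimes> f b d = f b d \<otimes>
    f (conjugate H x (commutator H b d)) (conjugate H y (commutator H b d))" by simp
  moreover have "commutator H b d \<in> carrier H" using assms by (simp add: commutator_def)
  ultimately show ?thesis using assms by (simp add: m_assoc)
qed

definition T where "T K = generate G {f a b | a b. a \<in> K \<and> b \<in> K}"

lemma T_subgroup: "K \<subseteq> carrier H \<Longrightarrow> subgroup (T K) G"
  unfolding T_def by (intro generate_is_subgroup) (auto intro!: f_closed)

lemma f_in_T: "a \<in> K \<Longrightarrow> b \<in> K \<Longrightarrow> f a b \<in> T K"
  unfolding T_def by (intro generate.incl) auto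

text \<open>
  Here \<open>S\<close> is a subgroup that contains all \<open>f n m\<close> with \<open>n, m \<in> N\<close>, where \<open>N\<close> is normal in \<open>K\<close>. The goal is to
  find finitely many further elements that force all \<open>f k l\<close> with \<open>k, l \<in> K\<close> into \<open>S\<close>.
\<close>

context
  fixes N K S
  assumes N: "subgroup N H" and K: "subgroup K H" and NK: "N \<subseteq> K"
    and norm: "\<And>k n. k \<in> K \<Longrightarrow> n \<in> N \<Longrightarrow> k \<otimes>\<^bsub>H\<^esub> n \<otimes>\<^bsub>H\<^esub> inv\<^bsub>H\<^esub> k \<in> N"
    and S: "subgroup S G" and NN: "\<And>n m. n \<in> N \<Longrightarrow> m \<in> N \<Longrightarrow> f n m \<in> S"
begin

interpretation N: subgroup N H by (rule N)
interpretation K: subgroup K H by (rule K)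
interpretation S: subgroup S G by (rule S)

lemma conjugate_in_N: "n \<in> N \<Longrightarrow> k \<in> K \<Longrightarrow> conjugate H n k \<in> N"
  unfolding conjugate_def using norm[of "inv\<^bsub>H\<^esub> k" n] by simp

lemma conjugate_in_K: "n \<in> K \<Longrightarrow> k \<in> K \<Longrightarrow> conjugate H n k \<in> K"
  unfolding conjugate_def by simp

lemma split_conjugate:
  assumes "r \<in> K" "m \<in> N"
  obtains v where "v \<in> N" "conjugate H r m = v \<otimes>\<^bsub>H\<^esub> r"
proof
  show "inv\<^bsub>H\<^esub> m \<otimes>\<^bsub>H\<^esub> (r \<otimes>\<^bsub>H\<^esub> m \<otimes>\<^bsub>H\<^esub> inv\<^bsub>H\<^esub> r) \<in> N" using norm[OF assms] assms by simp
  show "conjugate H r m = inv\<^bsub>H\<^esub> m \<otimes>\<^bsub>H\<^esub> (r \<otimes>\<^bsub>H\<^esub> m \<otimes>\<^bsub>H\<^esub> inv\<^bsub>H\<^esub> r) \<otimes>\<^bsub>H\<^esub> r"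
    using assms by (simp add: conjugate_def H.m_assoc)
qed

text \<open>
  Up to a factor from \<open>S\<close>, the map \<open>n \<mapsto> f n r\<close> is an antihomomorphism on \<open>N\<close>. The conjugate of \<open>r\<close> that the
  product rule introduces differs from \<open>r\<close> by an element \<open>v\<close> of \<open>N\<close>, and splitting off \<open>v\<close> costs only a
  value of \<open>f\<close> on \<open>N\<close>. The conjugate of the first argument disappears by naming it \<open>y\<close>.
\<close>
lemma f_left_mod:
  assumes "r \<in> K" "m \<in> N" "y \<in> N"
  shows "\<exists>s\<in>S. f (m \<otimes>\<^bsub>H\<^esub> y) r = f y r \<otimes> s \<otimes> f m r"
proof -
  define n where "n = m \<otimes>\<^bsub>H\<^esub> y \<otimes>\<^bsub>H\<^esub> inv\<^bsub>H\<^esub> m"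
  have n: "n \<in> carrier H" "n \<otimes>\<^bsub>H\<^esub> m = m \<otimes>\<^bsub>H\<^esub> y" "conjugate H n m = y"
    using assms by (simp_all add: n_def conjugate_def H.m_assoc)
  obtain v where v: "v \<in> N" "conjugate H r m = v \<otimes>\<^bsub>H\<^esub> r" using split_conjugate[OF assms(1,2)] .
  have "f (m \<otimes>\<^bsub>H\<^esub> y) r = f y (v \<otimes>\<^bsub>H\<^esub> r) \<otimes> f m r"
    using f_mult_left[of n m r] n v assms by simp
  also have "f y (v \<otimes>\<^bsub>H\<^esub> r) = f y r \<otimes> f (conjugate H y r) (conjugate H v r)"
    using f_mult_right assms v by simp
  finally show ?thesis using NN conjugate_in_N assms v by blast
qed

lemma f_right_mod:
  assumes "r \<in> K" "m \<in> N" "y \<in> N"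
  shows "\<exists>s\<in>S. f r (m \<otimes>\<^bsub>H\<^esub> y) = f r m \<otimes> s \<otimes> f r y"
proof -
  define n where "n = m \<otimes>\<^bsub>H\<^esub> y \<otimes>\<^bsub>H\<^esub> inv\<^bsub>H\<^esub> m"
  have n: "n \<in> carrier H" "n \<otimes>\<^bsub>H\<^esub> m = m \<otimes>\<^bsub>H\<^esub> y" "conjugate H n m = y"
    using assms by (simp_all add: n_def conjugate_def H.m_assoc)
  obtain v where v: "v \<in> N" "conjugate H r m = v \<otimes>\<^bsub>H\<^esub> r" using split_conjugate[OF assms(1,2)] .
  have "f r (m \<otimes>\<^bsub>H\<^esub> y) = f r m \<otimes> f (v \<otimes>\<^bsub>H\<^esub> r) y"
    using f_mult_right[of r n m] n v assms by simp
  also have "f (v \<otimes>\<^bsub>H\<^esub> r) y = f (conjugate H v r) (conjugate H y r) \<otimes> f r y"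
    using f_mult_left assms v by simp
  finally have "f r (m \<otimes>\<^bsub>H\<^esub> y) = f r m \<otimes> f (conjugate H v r) (conjugate H y r) \<otimes> f r y"
    using assms v by (simp add: m_assoc)
  then show ?thesis using NN conjugate_in_N assms v by blast
qed

lemma f_left_generators:
  assumes r: "r \<in> K" and Y: "N = generate H Y" "\<And>y. y \<in> Y \<Longrightarrow> f y r \<in> S" and n: "n \<in> N"
  shows "f n r \<in> S"
proof -
  have YN: "Y \<subseteq> N" unfolding Y(1) by (simp add: generate.incl subsetI)
  have "subgroup {n \<in> N. f n r \<in> S} H"
  proof (rule H.subgroupI)
    show "{n \<in> N. f n r \<in> S} \<subseteq> carrier H" by auto
    show "{n \<in> N. f n r \<in> S} \<noteq> {}" using r N.one_closed by (auto intro!: exI[of _ "\<one>\<^bsub>H\<^esub>"])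
  next
    fix m assume "m \<in> {n \<in> N. f n r \<in> S}"
    then have m: "m \<in> N" "f m r \<in> S" by auto
    obtain s where s: "s \<in> S" "f (m \<otimes>\<^bsub>H\<^esub> inv\<^bsub>H\<^esub> m) r = f (inv\<^bsub>H\<^esub> m) r \<otimes> s \<otimes> f m r"
      using f_left_mod[OF r m(1), of "inv\<^bsub>H\<^esub> m"] m by blast
    then have "f (inv\<^bsub>H\<^esub> m) r \<otimes> (s \<otimes> f m r) = \<one>" using m r by (simp add: m_assoc)
    then have "f (inv\<^bsub>H\<^esub> m) r = inv (s \<otimes> f m r)" using s(1) m r by (simp add: inv_equality)
    moreover have "inv (s \<otimes> f m r) \<in> S" using s m by blast
    ultimately show "inv\<^bsub>H\<^esub> m \<in> {n \<in> N. f n r \<in> S}" using m by simp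
  next
    fix m y assume "m \<in> {n \<in> N. f n r \<in> S}" "y \<in> {n \<in> N. f n r \<in> S}"
    then show "m \<otimes>\<^bsub>H\<^esub> y \<in> {n \<in> N. f n r \<in> S}" using f_left_mod[OF r, of m y] by auto
  qed
  then have "generate H Y \<subseteq> {n \<in> N. f n r \<in> S}" using Y(2) YN by (intro H.generate_subgroup_incl) auto
  then show ?thesis using n Y(1) by blast
qed

lemma f_right_generators:
  assumes r: "r \<in> K" and Y: "N = generate H Y" "\<And>y. y \<in> Y \<Longrightarrow> f r y \<in> S" and n: "n \<in> N"
  shows "f r n \<in> S"
proof -
  have YN: "Y \<subseteq> N" unfolding Y(1) by (simp add: generate.incl subsetI)
  have "subgroup {n \<in> N. f r n \<in> S} H"
  proof (rule H.subgroupI)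
    show "{n \<in> N. f r n \<in> S} \<subseteq> carrier H" by auto
    show "{n \<in> N. f r n \<in> S} \<noteq> {}" using r N.one_closed by (auto intro!: exI[of _ "\<one>\<^bsub>H\<^esub>"])
  next
    fix m assume "m \<in> {n \<in> N. f r n \<in> S}"
    then have m: "m \<in> N" "f r m \<in> S" by auto
    obtain s where s: "s \<in> S" "f r (inv\<^bsub>H\<^esub> m \<otimes>\<^bsub>H\<^esub> m) = f r (inv\<^bsub>H\<^esub> m) \<otimes> s \<otimes> f r m"
      using f_right_mod[OF r _ m(1), of "inv\<^bsub>H\<^esub> m"] m by blast
    then have "f r (inv\<^bsub>H\<^esub> m) \<otimes> (s \<otimes> f r m) = \<one>" using m r by (simp add: m_assoc)
    then have "f r (inv\<^bsub>H\<^esub> m) = inv (s \<otimes> f r m)" using s(1) m r by (simp add: inv_equality)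
    moreover have "inv (s \<otimes> f r m) \<in> S" using s m by blast
    ultimately show "inv\<^bsub>H\<^esub> m \<in> {n \<in> N. f r n \<in> S}" using m by simp
  next
    fix m y assume "m \<in> {n \<in> N. f r n \<in> S}" "y \<in> {n \<in> N. f r n \<in> S}"
    then show "m \<otimes>\<^bsub>H\<^esub> y \<in> {n \<in> N. f r n \<in> S}" using f_right_mod[OF r, of m y] by auto
  qed
  then have "generate H Y \<subseteq> {n \<in> N. f r n \<in> S}" using Y(2) YN by (intro H.generate_subgroup_incl) auto
  then show ?thesis using n Y(1) by blast
qed

lemma f_representatives:
  assumes R: "R \<subseteq> K" "\<And>k. k \<in> K \<Longrightarrow> \<exists>n\<in>N. \<exists>r\<in>R. k = n \<otimes>\<^bsub>H\<^esub> r"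
    and NR: "\<And>n r. n \<in> N \<Longrightarrow> r \<in> R \<Longrightarrow> f n r \<in> S"
    and RN: "\<And>n r. n \<in> N \<Longrightarrow> r \<in> R \<Longrightarrow> f r n \<in> S"
    and RR: "\<And>r q. r \<in> R \<Longrightarrow> q \<in> R \<Longrightarrow> f r q \<in> S"
    and k: "k \<in> K" and l: "l \<in> K"
  shows "f k l \<in> S"
proof -
  have RK: "r \<in> K" "r \<in> carrier H" if "r \<in> R" for r using that R by auto
  have NKS: "f n k \<in> S" if n: "n \<in> N" and k: "k \<in> K" for n k
  proof -
    obtain m r where m: "m \<in> N" "r \<in> R" "k = m \<otimes>\<^bsub>H\<^esub> r" using R k by blast
    have "f n k = f n r \<otimes> f (conjugate H n r) (conjugate H m r)" using f_mult_right m n RK by simp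
    then show ?thesis using NR NN n m RK conjugate_in_N by simp
  qed
  have KNS: "f k n \<in> S" if n: "n \<in> N" and k: "k \<in> K" for n k
  proof -
    obtain m r where m: "m \<in> N" "r \<in> R" "k = m \<otimes>\<^bsub>H\<^esub> r" using R k by blast
    have "f k n = f (conjugate H m r) (conjugate H n r) \<otimes> f r n" using f_mult_left m n RK by simp
    then show ?thesis using RN NN n m RK conjugate_in_N by simp
  qed
  have RKS: "f r k \<in> S" if r: "r \<in> R" and k: "k \<in> K" for r k
  proof -
    obtain m q where m: "m \<in> N" "q \<in> R" "k = m \<otimes>\<^bsub>H\<^esub> q" using R k by blast
    have "f r k = f r q \<otimes> f (conjugate H r q) (conjugate H m q)" using f_mult_right m r RK by simp
    then show ?thesis using RR KNS r m RK conjugate_in_N conjugate_in_K by simp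
  qed
  obtain m r where m: "m \<in> N" "r \<in> R" "k = m \<otimes>\<^bsub>H\<^esub> r" using R k by blast
  have "f k l = f (conjugate H m r) (conjugate H l r) \<otimes> f r l" using f_mult_left m l RK by simp
  then show ?thesis using NKS RKS l m RK conjugate_in_N conjugate_in_K by simp
qed

text \<open>
  Powers of \<open>t\<close> are unaffected by conjugation with powers of \<open>t\<close>, so in each argument the values at powers
  of \<open>t\<close> follow from those at \<open>t\<close> itself.
\<close>
lemma f_powers:
  assumes t: "t \<in> K"
    and Nt: "\<And>n. n \<in> N \<Longrightarrow> f n t \<in> S" and tN: "\<And>n. n \<in> N \<Longrightarrow> f t n \<in> S" and tt: "f t t \<in> S"
  shows "n \<in> N \<Longrightarrow> f n (t [^]\<^bsub>H\<^esub> (i::int)) \<in> S" "n \<in> N \<Longrightarrow> f (t [^]\<^bsub>H\<^esub> (i::int)) n \<in> S"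
    "f (t [^]\<^bsub>H\<^esub> (i::int)) (t [^]\<^bsub>H\<^esub> (j::int)) \<in> S"
proof -
  have tc: "t \<in> carrier H" using t by simp
  define p where "p i = t [^]\<^bsub>H\<^esub> (i::int)" for i
  have pK: "p i \<in> K" for i unfolding p_def using H.subgroup_int_pow_closed[OF K t] .
  have pc: "p i \<in> carrier H" for i using pK by simp
  have p1: "p 1 = t" and p0: "p 0 = \<one>\<^bsub>H\<^esub>" using tc by (simp_all add: p_def)
  have padd: "p (i + j) = p i \<otimes>\<^bsub>H\<^esub> p j" for i j using tc by (simp add: p_def H.int_pow_mult)
  have cj: "conjugate H (p i) (p j) = p i" for i j
    by (rule H.conjugate_commuting[OF pc pc]) (simp add: padd[symmetric] add.commute)
  have neg: "x \<in> S" if "x \<otimes> y = \<one>" "x \<in> carrier G" "y \<in> S" for x y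
  proof -
    have "x = inv y" using that by (simp add: inv_equality)
    then show ?thesis using that by blast
  qed
  have neg': "x \<in> S" if "y \<otimes> x = \<one>" "x \<in> carrier G" "y \<in> S" for x y
  proof -
    have "x \<otimes> y = \<one>" using that inv_comm by auto
    then show ?thesis using neg that by blast
  qed
  have fr: "f n (p (i + j)) = f n (p j) \<otimes> f (conjugate H n (p j)) (p i)" if "n \<in> carrier H" for n i j
    using f_mult_right[of n "p i" "p j"] that pc by (simp add: padd cj)
  have fl: "f (p (i + j)) n = f (p i) (conjugate H n (p j)) \<otimes> f (p j) n" if "n \<in> carrier H" for n i j
    using f_mult_left[of "p i" "p j" n] that pc by (simp add: padd cj)
  have "i \<in> {i. \<forall>n\<in>N. f n (p i) \<in> S}" for i
  proof (rule int_set_UNIV)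
    show "1 \<in> {i. \<forall>n\<in>N. f n (p i) \<in> S}" using Nt p1 by simp
  next
    fix i j assume "i \<in> {i. \<forall>n\<in>N. f n (p i) \<in> S}" "j \<in> {i. \<forall>n\<in>N. f n (p i) \<in> S}"
    then show "i + j \<in> {i. \<forall>n\<in>N. f n (p i) \<in> S}" using fr conjugate_in_N pK by simp
  next
    fix i assume i: "i \<in> {i. \<forall>n\<in>N. f n (p i) \<in> S}"
    have "f n (p (- i)) \<in> S" if n: "n \<in> N" for n
      by (rule neg[of _ "f (conjugate H n (p (- i))) (p i)"])
        (use i n fr[of n i "- i"] conjugate_in_N[OF n pK] pc p0 in auto)
    then show "- i \<in> {i. \<forall>n\<in>N. f n (p i) \<in> S}" by blast
  qed
  then show "n \<in> N \<Longrightarrow> f n (t [^]\<^bsub>H\<^esub> (i::int)) \<in> S" by (simp add: p_def)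
  have "i \<in> {i. \<forall>n\<in>N. f (p i) n \<in> S}" for i
  proof (rule int_set_UNIV)
    show "1 \<in> {i. \<forall>n\<in>N. f (p i) n \<in> S}" using tN p1 by simp
  next
    fix i j assume "i \<in> {i. \<forall>n\<in>N. f (p i) n \<in> S}" "j \<in> {i. \<forall>n\<in>N. f (p i) n \<in> S}"
    then show "i + j \<in> {i. \<forall>n\<in>N. f (p i) n \<in> S}" using fl conjugate_in_N pK by simp
  next
    fix i assume i: "i \<in> {i. \<forall>n\<in>N. f (p i) n \<in> S}"
    have "f (p (- i)) n \<in> S" if n: "n \<in> N" for n
      by (rule neg'[of "f (p i) (conjugate H n (p (- i)))"])
        (use i n fl[of n i "- i"] conjugate_in_N[OF n pK] pc p0 in auto)
    then show "- i \<in> {i. \<forall>n\<in>N. f (p i) n \<in> S}" by blast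
  qed
  then show "n \<in> N \<Longrightarrow> f (t [^]\<^bsub>H\<^esub> (i::int)) n \<in> S" by (simp add: p_def)
  have ct: "conjugate H t (p j) = t" for j using cj[of 1 j] p1 by simp
  have 1: "i \<in> {i. f (p i) t \<in> S}" for i
  proof (rule int_set_UNIV)
    show "1 \<in> {i. f (p i) t \<in> S}" using tt p1 by simp
  next
    fix i j assume "i \<in> {i. f (p i) t \<in> S}" "j \<in> {i. f (p i) t \<in> S}"
    then show "i + j \<in> {i. f (p i) t \<in> S}" using fl[OF tc] ct by simp
  next
    fix i assume i: "i \<in> {i. f (p i) t \<in> S}"
    have "f (p (- i)) t \<in> S"
      by (rule neg'[of "f (p i) t"]) (use i fl[OF tc, of i "- i"] ct pc tc p0 in auto)
    then show "- i \<in> {i. f (p i) t \<in> S}" by blast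
  qed
  have "j \<in> {j. \<forall>i. f (p i) (p j) \<in> S}" for j
  proof (rule int_set_UNIV)
    show "1 \<in> {j. \<forall>i. f (p i) (p j) \<in> S}" using 1 p1 by simp
  next
    fix j k assume "j \<in> {j. \<forall>i. f (p i) (p j) \<in> S}" "k \<in> {j. \<forall>i. f (p i) (p j) \<in> S}"
    then show "j + k \<in> {j. \<forall>i. f (p i) (p j) \<in> S}" using fr[OF pc] cj by simp
  next
    fix j assume j: "j \<in> {j. \<forall>i. f (p i) (p j) \<in> S}"
    have "f (p i) (p (- j)) \<in> S" for i
      by (rule neg[of _ "f (p i) (p j)"]) (use j fr[OF pc, of i j "- j"] cj pc p0 in auto)
    then show "- j \<in> {j. \<forall>i. f (p i) (p j) \<in> S}" by blast
  qed
  then show "f (t [^]\<^bsub>H\<^esub> (i::int)) (t [^]\<^bsub>H\<^esub> (j::int)) \<in> S" by (simp add: p_def)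
qed

end

text \<open>
  If \<open>K / N\<close> is finite, \<open>R\<close> is a set of coset representatives; if it is cyclic, \<open>R = {t}\<close> and the
  representatives are the powers of \<open>t\<close>.
\<close>
lemma T_step_fin_gen:
  assumes N: "fin_gen H N" and TN: "fin_gen G (T N)" and st: "series_step H N K"
  shows "fin_gen G (T K)"
proof -
  note D = series_stepD[OF st]
  interpret N: subgroup N H by (rule D)
  interpret K: subgroup K H by (rule D)
  obtain Y where Y: "finite Y" "Y \<subseteq> carrier H" "N = generate H Y" using N by (auto simp: fin_gen_def)
  have YN: "Y \<subseteq> N" unfolding Y(3) by (simp add: generate.incl subsetI)
  obtain X where X: "finite X" "X \<subseteq> carrier G" "T N = generate G X" using TN by (auto simp: fin_gen_def)
  have TK: "subgroup (T K) G" by (rule T_subgroup) auto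
  have XT: "X \<subseteq> T K"
  proof -
    have "X \<subseteq> T N" unfolding X(3) by (simp add: generate.incl subsetI)
    also have "\<dots> \<subseteq> T K" unfolding T_def by (rule mono_generate) (use D(3) in blast)
    finally show ?thesis .
  qed
  define B where "B R = X \<union> ((\<lambda>(y, r). f y r) ` (Y \<times> R) \<union> (\<lambda>(y, r). f r y) ` (Y \<times> R)) \<union>
     (\<lambda>(q, r). f q r) ` (R \<times> R)" for R
  define S where "S R = generate G (B R)" for R
  have BT: "B R \<subseteq> T K" if "R \<subseteq> K" for R
    using XT that YN D(3) by (auto simp: B_def intro!: f_in_T)
  have finB: "finite (B R)" if "finite R" for R using that X Y by (auto simp: B_def)
  have BG: "B R \<subseteq> carrier G" if "R \<subseteq> K" for R using BT[OF that] subgroup.subset[OF TK] by blast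
  have SG: "subgroup (S R) G" if "R \<subseteq> K" for R unfolding S_def by (intro generate_is_subgroup BG that)
  have BS: "B R \<subseteq> S R" for R unfolding S_def by (simp add: generate.incl subsetI)
  have ST: "S R \<subseteq> T K" if "R \<subseteq> K" for R unfolding S_def by (rule generate_subgroup_incl[OF BT[OF that] TK])
  have NS: "f n m \<in> S R" if "n \<in> N" "m \<in> N" for n m R
  proof -
    have "T N \<subseteq> S R" unfolding X(3) S_def by (rule mono_generate) (auto simp: B_def)
    then show ?thesis using f_in_T that by blast
  qed
  have NR: "f n r \<in> S R" if "n \<in> N" "r \<in> R" "R \<subseteq> K" for n r R
  proof (rule f_left_generators[OF D(1-4) SG[OF that(3)] NS _ Y(3) _ that(1)])
    fix y assume "y \<in> Y"
    then have "f y r \<in> B R" using that by (force simp: B_def)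
    then show "f y r \<in> S R" using BS by blast
  qed (use that in auto)
  have RN: "f r n \<in> S R" if "n \<in> N" "r \<in> R" "R \<subseteq> K" for n r R
  proof (rule f_right_generators[OF D(1-4) SG[OF that(3)] NS _ Y(3) _ that(1)])
    fix y assume "y \<in> Y"
    then have "f r y \<in> B R" using that by (force simp: B_def)
    then show "f r y \<in> S R" using BS by blast
  qed (use that in auto)
  have RR: "f q r \<in> S R" if "q \<in> R" "r \<in> R" for q r R
  proof -
    have "f q r \<in> B R" using that by (force simp: B_def)
    then show ?thesis using BS by blast
  qed
  have "\<exists>R. finite R \<and> R \<subseteq> K \<and> (\<forall>k\<in>K. \<forall>l\<in>K. f k l \<in> S R)"
    using st unfolding series_step_def
  proof
    assume st: "finite_step H N K"
    obtain F where F: "finite F" "F \<subseteq> K" "\<forall>k\<in>K. \<exists>f\<in>F. k \<otimes>\<^bsub>H\<^esub> f \<in> N" using finite_stepD(4)[OF st] by blast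
    define R where "R = m_inv H ` F"
    have RK: "R \<subseteq> K" using F by (auto simp: R_def)
    have dec: "\<exists>n\<in>N. \<exists>r\<in>R. k = n \<otimes>\<^bsub>H\<^esub> r" if k: "k \<in> K" for k
    proof -
      obtain e where e: "e \<in> F" "k \<otimes>\<^bsub>H\<^esub> e \<in> N" using F k by blast
      have "e \<in> carrier H" using e F by auto
      then have "k = (k \<otimes>\<^bsub>H\<^esub> e) \<otimes>\<^bsub>H\<^esub> inv\<^bsub>H\<^esub> e" using k by (simp add: H.m_assoc)
      then show ?thesis using e unfolding R_def by blast
    qed
    have "f k l \<in> S R" if "k \<in> K" "l \<in> K" for k l
      by (rule f_representatives[OF D(1-4) SG[OF RK] NS RK dec _ _ _ that]) (use NR RN RR RK in auto)
    moreover have "finite R" using F by (simp add: R_def)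
    ultimately show ?thesis using RK by blast
  next
    assume st: "cyclic_step H N K"
    obtain t where t: "t \<in> K" "\<forall>k\<in>K. \<exists>i::int. k \<otimes>\<^bsub>H\<^esub> t [^]\<^bsub>H\<^esub> i \<in> N" using cyclic_stepD(5)[OF st] by blast
    have tc: "t \<in> carrier H" using t by simp
    have tK: "{t} \<subseteq> K" using t by simp
    define R where "R = range (\<lambda>i::int. t [^]\<^bsub>H\<^esub> i)"
    have RK: "R \<subseteq> K" using H.subgroup_int_pow_closed[OF D(2) t(1)] by (auto simp: R_def)
    have dec: "\<exists>n\<in>N. \<exists>r\<in>R. k = n \<otimes>\<^bsub>H\<^esub> r" if k: "k \<in> K" for k
    proof -
      obtain i :: int where i: "k \<otimes>\<^bsub>H\<^esub> t [^]\<^bsub>H\<^esub> i \<in> N" using t k by blast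
      have "k = (k \<otimes>\<^bsub>H\<^esub> t [^]\<^bsub>H\<^esub> i) \<otimes>\<^bsub>H\<^esub> t [^]\<^bsub>H\<^esub> (- i)"
        using k tc by (simp add: H.m_assoc H.int_pow_neg)
      then show ?thesis using i unfolding R_def by blast
    qed
    note pow = f_powers[OF D(1-4) SG[OF tK] NS t(1) NR[OF _ _ tK] RN[OF _ _ tK] RR]
    have "f k l \<in> S {t}" if "k \<in> K" "l \<in> K" for k l
      by (rule f_representatives[OF D(1-4) SG[OF tK] NS RK dec _ _ _ that]) (auto simp: R_def intro!: pow)
    then show ?thesis using tK by (intro exI[of _ "{t}"]) auto
  qed
  then obtain R where R: "finite R" "R \<subseteq> K" "\<forall>k\<in>K. \<forall>l\<in>K. f k l \<in> S R" by blast
  have "T K \<subseteq> S R" unfolding T_def by (rule generate_subgroup_incl[OF _ SG[OF R(2)]]) (use R in auto)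
  then have "T K = S R" using ST[OF R(2)] by blast
  then show ?thesis unfolding fin_gen_def S_def
    using finB[OF R(1)] BG[OF R(2)] by (intro exI[of _ "B R"]) simp
qed

lemma T_fin_gen:
  assumes "series H {\<one>\<^bsub>H\<^esub>} K"
  shows "fin_gen H K \<and> fin_gen G (T K)"
  using assms
proof (induction rule: rtranclp_induct)
  case base
  have "fin_gen H {\<one>\<^bsub>H\<^esub>}" unfolding fin_gen_def by (intro exI[of _ "{}"]) (simp add: H.generate_empty)
  moreover have "fin_gen G (T {\<one>\<^bsub>H\<^esub>})" unfolding fin_gen_def T_def
    by (intro exI[of _ "{f \<one>\<^bsub>H\<^esub> \<one>\<^bsub>H\<^esub>}"]) (auto intro!: arg_cong[of _ _ "generate G"])
  ultimately show ?case ..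
next
  case (step N K)
  have "series H {\<one>\<^bsub>H\<^esub>} K" using step.hyps by (rule rtranclp.rtrancl_into_rtrancl)
  from series_finite_extension[OF H.is_group this H.triv_subgroup]
  obtain Y where "finite Y" "Y \<subseteq> K" "generate H ({\<one>\<^bsub>H\<^esub>} \<union> Y) = K" by blast
  moreover have "K \<subseteq> carrier H" using series_stepD(2)[OF step.hyps(2)] subgroup.subset by blast
  ultimately have "fin_gen H K" unfolding fin_gen_def by (intro exI[of _ "{\<one>\<^bsub>H\<^esub>} \<union> Y"]) auto
  then show ?case using T_step_fin_gen[OF _ _ step.hyps(2)] step.IH by blast
qed

text \<open>
  The relation \<open>R\<close> pairs \<open>h \<in> H\<close> with those \<open>t\<close> that act on the generators as \<open>h\<close> does. It relates every \<open>t\<close>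
  to some \<open>h\<close>, and the elements related to \<open>\<one>\<close> are central. It replaces the homomorphism
  \<open>a \<otimes> b \<mapsto> [a, b]\<close>, which a quotient of \<open>H \<otimes> H\<close> need not admit.
\<close>
theorem series_carrier:
  assumes s: "series H {\<one>\<^bsub>H\<^esub>} (carrier H)"
  shows "series G {\<one>} (carrier G)"
proof -
  interpret P: group "H \<times>\<times> G" by (simp add: DirProd_group)
  let ?X = "{f a b | a b. a \<in> carrier H \<and> b \<in> carrier H}"
  define R where "R = {(h, t). h \<in> carrier H \<and> t \<in> carrier G \<and>
    (\<forall>c\<in>carrier H. \<forall>d\<in>carrier H. inv t \<otimes> f c d \<otimes> t = f (conjugate H c h) (conjugate H d h))}"
  have RI: "(h, t) \<in> R" if "h \<in> carrier H" "t \<in> carrier G"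
    "\<And>c d. c \<in> carrier H \<Longrightarrow> d \<in> carrier H \<Longrightarrow> inv t \<otimes> f c d \<otimes> t = f (conjugate H c h) (conjugate H d h)" for h t
    using that unfolding R_def by blast
  have RD: "h \<in> carrier H" "t \<in> carrier G"
    "\<And>c d. c \<in> carrier H \<Longrightarrow> d \<in> carrier H \<Longrightarrow> inv t \<otimes> f c d \<otimes> t = f (conjugate H c h) (conjugate H d h)"
    if "(h, t) \<in> R" for h t using that unfolding R_def by blast+
  have R: "subgroup R (H \<times>\<times> G)"
  proof (rule P.subgroupI)
    show "R \<subseteq> carrier (H \<times>\<times> G)" using RD by auto
    have "(\<one>\<^bsub>H\<^esub>, \<one>) \<in> R" by (rule RI) auto
    then show "R \<noteq> {}" by blast
  next
    fix a assume "a \<in> R"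
    then obtain h t where a: "a = (h, t)" "(h, t) \<in> R" by (cases a) auto
    note r = RD[OF a(2)]
    have "(inv\<^bsub>H\<^esub> h, inv t) \<in> R"
    proof (rule RI)
      fix c d assume cd: "c \<in> carrier H" "d \<in> carrier H"
      let ?c = "conjugate H c (inv\<^bsub>H\<^esub> h)" and ?d = "conjugate H d (inv\<^bsub>H\<^esub> h)"
      have "inv t \<otimes> f ?c ?d \<otimes> t = f c d" using r(3)[of ?c ?d] cd r(1,2) by (simp add: H.conjugate_conjugate)
      then have "t \<otimes> (inv t \<otimes> f ?c ?d \<otimes> t) \<otimes> inv t = t \<otimes> f c d \<otimes> inv t" by simp
      then show "inv (inv t) \<otimes> f c d \<otimes> inv t = f ?c ?d" using cd r(1,2) by (simp add: m_assoc)
    qed (use r in auto)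
    then show "inv\<^bsub>H \<times>\<times> G\<^esub> a \<in> R" using a r by simp
  next
    fix a b assume "a \<in> R" "b \<in> R"
    then obtain h t k u where a: "a = (h, t)" "(h, t) \<in> R" and b: "b = (k, u)" "(k, u) \<in> R"
      by (cases a; cases b) auto
    note r = RD[OF a(2)] and q = RD[OF b(2)]
    have "(h \<otimes>\<^bsub>H\<^esub> k, t \<otimes> u) \<in> R"
    proof (rule RI)
      fix c d assume cd: "c \<in> carrier H" "d \<in> carrier H"
      have "inv (t \<otimes> u) \<otimes> f c d \<otimes> (t \<otimes> u) = inv u \<otimes> (inv t \<otimes> f c d \<otimes> t) \<otimes> u"
        using cd r(1,2) q(1,2) by (simp add: m_assoc inv_mult_group)
      also have "\<dots> = f (conjugate H (conjugate H c h) k) (conjugate H (conjugate H d h) k)"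
        using cd r q by simp
      finally show "inv (t \<otimes> u) \<otimes> f c d \<otimes> (t \<otimes> u) = f (conjugate H c (h \<otimes>\<^bsub>H\<^esub> k)) (conjugate H d (h \<otimes>\<^bsub>H\<^esub> k))"
        using cd r(1,2) q(1,2) by (simp add: H.conjugate_conjugate)
    qed (use r q in auto)
    then show "a \<otimes>\<^bsub>H \<times>\<times> G\<^esub> b \<in> R" using a b by simp
  qed
  have s1: "series G (R `` {\<one>\<^bsub>H\<^esub>}) (R `` carrier H)"
    by (rule series_Image[OF is_group H.is_group R s])
  have Z: "subgroup (R `` {\<one>\<^bsub>H\<^esub>}) G" "subgroup (R `` carrier H) G"
    using subgroup_Image[OF is_group H.is_group R] H.triv_subgroup H.subgroup_self by auto
  have "?X \<subseteq> R `` carrier H"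
  proof
    fix x assume "x \<in> ?X"
    then obtain a b where ab: "x = f a b" "a \<in> carrier H" "b \<in> carrier H" by blast
    have "(commutator H a b, f a b) \<in> R"
      by (rule RI) (use ab f_conjugate_commutator in \<open>auto simp: commutator_def\<close>)
    then show "x \<in> R `` carrier H" using RD ab by blast
  qed
  then have "carrier G \<subseteq> R `` carrier H" unfolding generated[symmetric]
    by (rule generate_subgroup_incl[OF _ Z(2)])
  then have top: "R `` carrier H = carrier G" using subgroup.subset[OF Z(2)] by blast
  have central: "z \<otimes> g = g \<otimes> z" if z: "z \<in> R `` {\<one>\<^bsub>H\<^esub>}" and g: "g \<in> carrier G" for z g
  proof (rule generate_commute[OF is_group])
    show "g \<in> generate G ?X" using g generated by simp
    have zR: "(\<one>\<^bsub>H\<^esub>, z) \<in> R" using z by blast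
    then show zc: "z \<in> carrier G" using RD by blast
    fix s assume "s \<in> ?X"
    then obtain a b where ab: "s = f a b" "a \<in> carrier H" "b \<in> carrier H" by blast
    have "inv z \<otimes> s \<otimes> z = s" using RD(3)[OF zR ab(2,3)] ab by simp
    then have "z \<otimes> (inv z \<otimes> s \<otimes> z) = z \<otimes> s" by simp
    then show "z \<otimes> s = s \<otimes> z" using zc ab by (simp add: m_assoc)
  qed auto
  have "fin_gen G (carrier G)" using T_fin_gen[OF s] generated by (simp add: T_def)
  then show ?thesis
    using fin_gen_central_extension_series[OF is_group Z(1) s1[unfolded top] _ order_refl] central by blast
qed

end

section \<open>Comparison with polycyclic-by-finite groups\<close>
lemma cyclic_step_iff_factor:
  fixes G (structure)
  assumes "group G" "subgroup K G"
  shows "cyclic_step G N K \<longleftrightarrow> N \<lhd> (G\<lparr>carrier := K\<rparr>) \<and> cyclic_group ((G\<lparr>carrier := K\<rparr>) Mod N)"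
proof -
  interpret group G by fact
  interpret K: subgroup K G by fact
  let ?K = "G\<lparr>carrier := K\<rparr>"
  interpret KG: group ?K by (rule subgroup_imp_group[OF assms(2)])
  have inv_eq: "inv\<^bsub>?K\<^esub> k = inv k" if "k \<in> K" for k using that m_inv_consistent[OF assms(2)] by blast
  have pow_eq: "t [^]\<^bsub>?K\<^esub> i = t [^] i" if "t \<in> K" for t and i :: int
    using int_pow_consistent[OF assms(2) that] by simp
  have powK: "t [^] i \<in> K" if "t \<in> K" for t and i :: int using subgroup_int_pow_closed[OF assms(2) that] .
  have cyc: "cyclic_group (?K Mod N) \<longleftrightarrow> (\<exists>t\<in>K. \<forall>k\<in>K. \<exists>i::int. k \<otimes> t [^] i \<in> N)" if nor: "N \<lhd> ?K"
  proof -
    interpret nN: normal N ?K by (rule nor)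
    interpret F: group "?K Mod N" by (rule nN.factorgroup_is_group)
    have NK: "N \<subseteq> K" using nN.subset by simp
    have NG: "subgroup N G" using incl_subgroup[OF assms(2) nN.subgroup_axioms] .
    have coset_eq: "N #> k = N #> l \<longleftrightarrow> k \<otimes> inv l \<in> N" if "k \<in> K" "l \<in> K" for k l
    proof
      assume "N #> k = N #> l"
      then have "k \<in> N #> l" using rcos_self[OF _ NG, of k] that by auto
      then obtain n where "n \<in> N" "k = n \<otimes> l" unfolding r_coset_def by blast
      then show "k \<otimes> inv l \<in> N" using that NK by (auto simp: m_assoc subset_iff)
    next
      assume "k \<otimes> inv l \<in> N"
      then have "k \<in> N #> l" unfolding r_coset_def using that by (auto simp: m_assoc intro!: bexI[of _ "k \<otimes> inv l"])
      then show "N #> k = N #> l" using repr_independence[OF _ _ NG, of k l] that by auto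
    qed
    have car: "carrier (?K Mod N) = (\<lambda>x. N #> x) ` K" by (simp add: carrier_FactGroup)
    have pw: "(N #> t) [^]\<^bsub>?K Mod N\<^esub> i = N #> t [^] i" if "t \<in> K" for t and i :: int
      using nN.FactGroup_int_pow[of t i] that pow_eq by simp
    show ?thesis
    proof
      assume "cyclic_group (?K Mod N)"
      then obtain t where t: "t \<in> K" "(\<lambda>x. N #> x) ` K = range (\<lambda>n::int. N #> t [^] n)"
        unfolding F.cyclic_group car using pw by auto
      have "\<exists>i::int. k \<otimes> t [^] i \<in> N" if k: "k \<in> K" for k
      proof -
        obtain i :: int where "N #> k = N #> t [^] i" using t(2) k by blast
        then have "k \<otimes> inv (t [^] i) \<in> N" using coset_eq k powK t(1) by blast
        then show ?thesis using t(1) by (intro exI[of _ "- i"]) (simp add: int_pow_neg)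
      qed
      then show "\<exists>t\<in>K. \<forall>k\<in>K. \<exists>i::int. k \<otimes> t [^] i \<in> N" using t(1) by blast
    next
      assume "\<exists>t\<in>K. \<forall>k\<in>K. \<exists>i::int. k \<otimes> t [^] i \<in> N"
      then obtain t where t: "t \<in> K" "\<forall>k\<in>K. \<exists>i::int. k \<otimes> t [^] i \<in> N" by blast
      have "N #> k \<in> range (\<lambda>n::int. N #> t [^] n)" if k: "k \<in> K" for k
      proof -
        obtain i :: int where "k \<otimes> t [^] i \<in> N" using t k by blast
        then have "k \<otimes> inv (t [^] (- i)) \<in> N" using t(1) by (simp add: int_pow_neg)
        then have "N #> k = N #> t [^] (- i)" using coset_eq k powK t(1) by blast
        then show ?thesis by blast
      qed
      then have "(\<lambda>x. N #> x) ` K = range (\<lambda>n::int. N #> t [^] n)" using powK[OF t(1)] by auto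
      then have "(\<lambda>x. N #> x) ` K = range (\<lambda>n::int. (N #> t) [^]\<^bsub>?K Mod N\<^esub> n)" using pw[OF t(1)] by simp
      then show "cyclic_group (?K Mod N)" unfolding F.cyclic_group car using t(1) by blast
    qed
  qed
  have "N \<lhd> ?K \<longleftrightarrow> subgroup N G \<and> N \<subseteq> K \<and> (\<forall>k\<in>K. \<forall>n\<in>N. k \<otimes> n \<otimes> inv k \<in> N)"
  proof
    assume "N \<lhd> ?K"
    then have *: "subgroup N ?K" "\<forall>k\<in>K. \<forall>n\<in>N. k \<otimes> n \<otimes> inv\<^bsub>?K\<^esub> k \<in> N" by (auto simp: KG.normal_inv_iff)
    then show "subgroup N G \<and> N \<subseteq> K \<and> (\<forall>k\<in>K. \<forall>n\<in>N. k \<otimes> n \<otimes> inv k \<in> N)"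
      using incl_subgroup[OF assms(2)] subgroup.subset[OF *(1)] inv_eq by auto
  next
    assume "subgroup N G \<and> N \<subseteq> K \<and> (\<forall>k\<in>K. \<forall>n\<in>N. k \<otimes> n \<otimes> inv k \<in> N)"
    then show "N \<lhd> ?K" using subgroup_incl[OF _ assms(2)] inv_eq by (auto simp: KG.normal_inv_iff)
  qed
  then show ?thesis unfolding cyclic_step_def using assms(2) cyc by blast
qed

lemma polycyclic_by_finite_imp_series:
  fixes H (structure)
  assumes "polycyclic_by_finite H"
  shows "series H {\<one>} (carrier H)"
proof -
  interpret group H using assms by (simp add: polycyclic_by_finite_def)
  obtain N where N: "N \<lhd> H" "polycyclic (H\<lparr>carrier := N\<rparr>)" "finite (rcosets N)"
    using assms unfolding polycyclic_by_finite_def by blast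
  interpret N: normal N H by (rule N)
  obtain n S where S: "S 0 = {\<one>}" "S n = N"
    "\<And>i. i < n \<Longrightarrow> S i \<lhd> (H\<lparr>carrier := S (Suc i)\<rparr>)"
    "\<And>i. i < n \<Longrightarrow> cyclic_group ((H\<lparr>carrier := S (Suc i)\<rparr>) Mod S i)"
    using N(2) unfolding polycyclic_def by auto
  have sub: "subgroup (S (n - j)) H" for j
  proof (induction j)
    case 0
    then show ?case using S(2) N.subgroup_axioms by simp
  next
    case (Suc j)
    show ?case
    proof (cases "j < n")
      case True
      then have "Suc (n - Suc j) = n - j" by simp
      then show ?thesis
        using incl_subgroup[OF Suc] S(3)[of "n - Suc j"] True normal_imp_subgroup by fastforce
    next
      case False
      then show ?thesis using Suc by simp
    qed
  qed
  have sub': "subgroup (S i) H" if "i \<le> n" for i using sub[of "n - i"] that by simp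
  have "i \<le> n \<Longrightarrow> series H {\<one>} (S i)" for i
  proof (induction i)
    case 0
    then show ?case using S(1) by simp
  next
    case (Suc i)
    have "cyclic_step H (S i) (S (Suc i))"
      using cyclic_step_iff_factor[OF is_group sub'[of "Suc i"]] S(3,4)[of i] Suc.prems by auto
    then show ?case using Suc by (meson Suc_leD rtranclp.rtrancl_into_rtrancl series_step_def)
  qed
  then have s: "series H {\<one>} N" using S(2) by blast
  define F where "F = (\<lambda>C. inv (SOME x. x \<in> C)) ` (rcosets N)"
  have some: "\<exists>n\<in>N. (SOME x. x \<in> N #> k) = n \<otimes> k" if "k \<in> carrier H" for k
  proof -
    have "(SOME x. x \<in> N #> k) \<in> N #> k" using rcos_self[OF that N.subgroup_axioms] by (rule someI)
    then show ?thesis unfolding r_coset_def by blast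
  qed
  have "finite_step H N (carrier H)"
    unfolding finite_step_def
  proof (intro conjI ballI exI[of _ F])
    show "subgroup N H" "subgroup (carrier H) H" "N \<subseteq> carrier H"
      using N.subgroup_axioms subgroup_self N.subset by auto
    show "k \<otimes> m \<otimes> inv k \<in> N" if "k \<in> carrier H" "m \<in> N" for k m using N.inv_op_closed2 that by simp
    show "finite F" using N(3) by (simp add: F_def)
    show "F \<subseteq> carrier H"
    proof
      fix x assume "x \<in> F"
      then obtain k where "k \<in> carrier H" "x = inv (SOME x. x \<in> N #> k)" unfolding F_def RCOSETS_def by blast
      then show "x \<in> carrier H" using some[of k] by fastforce
    qed
    fix k assume k: "k \<in> carrier H"
    obtain m where m: "m \<in> N" "(SOME x. x \<in> N #> k) = m \<otimes> k" using some[OF k] by blast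
    have "inv (m \<otimes> k) \<in> F" unfolding F_def m(2)[symmetric] using k by (auto simp: RCOSETS_def)
    moreover have "k \<otimes> inv (m \<otimes> k) = inv m" using k m(1) by (simp add: inv_mult_group)
    ultimately show "\<exists>f\<in>F. k \<otimes> f \<in> N" using m(1) by (metis N.m_inv_closed)
  qed
  then show ?thesis using s by (meson rtranclp.rtrancl_into_rtrancl series_step_def)
qed

text \<open>
  Finite index without normality: the polycyclic subgroups of finite index found along a series
  need not be normal.
\<close>
definition covers :: "('a, 'b) monoid_scheme \<Rightarrow> 'a set \<Rightarrow> 'a set \<Rightarrow> bool" where
  "covers G P K \<longleftrightarrow> (\<exists>F. finite F \<and> F \<subseteq> K \<and> (\<forall>k\<in>K. \<exists>f\<in>F. k \<otimes>\<^bsub>G\<^esub> f \<in> P))"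

text \<open>
  Among \<open>|F| + 1\<close> consecutive powers of \<open>k\<close> two lie in the same coset of \<open>P\<close>, so some \<open>k\<^sup>j\<close> with
  \<open>0 < j \<le> |F|\<close> is in \<open>P\<close>, and \<open>m = |F|!\<close> works for all \<open>k\<close>.
\<close>
lemma covers_exponent:
  fixes G (structure)
  assumes "group G" "subgroup P G" "subgroup K G" "covers G P K"
  shows "\<exists>m>0. \<forall>k\<in>K. k [^] (m::nat) \<in> P"
proof -
  interpret group G by fact
  interpret P: subgroup P G by fact
  interpret K: subgroup K G by fact
  obtain F where F: "finite F" "F \<subseteq> K" "\<forall>k\<in>K. \<exists>f\<in>F. k \<otimes> f \<in> P" using assms(4) unfolding covers_def by blast
  have P_pow: "x [^] (n::nat) \<in> P" if "x \<in> P" for x n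
    by (induction n) (use that in auto)
  have K_pow: "x [^] (n::nat) \<in> K" if "x \<in> K" for x n
    by (induction n) (use that in auto)
  have "k [^] (fact (card F) :: nat) \<in> P" if k: "k \<in> K" for k
  proof -
    have kc: "k \<in> carrier G" using k by simp
    have "\<forall>n. \<exists>f. f \<in> F \<and> k [^] (n::nat) \<otimes> f \<in> P" using F(3) K_pow[OF k] by blast
    then obtain \<phi> where \<phi>: "\<And>n. \<phi> n \<in> F \<and> k [^] (n::nat) \<otimes> \<phi> n \<in> P" by metis
    have "\<not> inj_on \<phi> {..card F}"
    proof
      assume "inj_on \<phi> {..card F}"
      then have "card {..card F} \<le> card F" using \<phi> F(1) by (intro card_inj_on_le) auto
      then show False by simp
    qed
    then obtain i j where ij: "i \<le> card F" "j \<le> card F" "\<phi> i = \<phi> j" "i < j"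
      unfolding inj_on_def by (metis atMost_iff linorder_neqE_nat)
    have fc: "\<phi> j \<in> carrier G" using \<phi>[of j] F(2) by auto
    have "(k [^] j \<otimes> \<phi> j) \<otimes> inv (k [^] i \<otimes> \<phi> i) \<in> P" using \<phi> by blast
    then have "k [^] j \<otimes> inv (k [^] i) \<in> P" using kc fc ij(3) by (simp add: m_assoc inv_mult_group)
    moreover have "k [^] j = k [^] (j - i) \<otimes> k [^] i" using nat_pow_mult[OF kc, of "j - i" i] ij(4) by simp
    ultimately have *: "k [^] (j - i) \<in> P" using kc by (simp add: m_assoc)
    have "(j - i) dvd fact (card F)" using ij by (intro dvd_fact) auto
    then obtain q where "fact (card F) = (j - i) * q" by blast
    then show ?thesis using P_pow[OF *, of q] kc by (simp add: nat_pow_pow)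
  qed
  then show ?thesis by (intro exI[of _ "fact (card F)"]) simp
qed

text \<open>
  A group with a series whose exponent is finite is finite, here applied to \<open>K\<close> modulo \<open>Q\<close>: along the
  series each cyclic factor contributes at most \<open>m\<close> cosets.
\<close>
lemma series_torsion_covers:
  fixes G (structure)
  assumes "group G" "series G {\<one>} K" "subgroup Q G" "m > 0"
    and "\<And>k. k \<in> K \<Longrightarrow> k [^] (m::nat) \<in> Q"
    and "\<And>k q. k \<in> K \<Longrightarrow> q \<in> Q \<Longrightarrow> k \<otimes> q \<otimes> inv k \<in> Q"
  shows "covers G Q K"
  using assms(2,5,6)
proof (induction rule: rtranclp_induct)
  case base
  interpret Q: subgroup Q G by fact
  interpret group G by fact
  show ?case unfolding covers_def using Q.one_closed by (intro exI[of _ "{\<one>}"]) auto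
next
  case (step N K)
  interpret group G by fact
  interpret Q: subgroup Q G by fact
  note D = series_stepD[OF step.hyps(2)]
  interpret N: subgroup N G by (rule D)
  interpret K: subgroup K G by (rule D)
  have "covers G Q N" using step.IH step.prems D(3) by blast
  then obtain F where F: "finite F" "F \<subseteq> N" "\<forall>k\<in>N. \<exists>f\<in>F. k \<otimes> f \<in> Q" unfolding covers_def by blast
  obtain E where E: "finite E" "E \<subseteq> K" "\<And>k. k \<in> K \<Longrightarrow> \<exists>e\<in>E. \<exists>f\<in>F. k \<otimes> (e \<otimes> f) \<in> Q"
  proof -
    from step.hyps(2) show ?thesis unfolding series_step_def
    proof
      assume st: "finite_step G N K"
      obtain E where E: "finite E" "E \<subseteq> K" "\<forall>k\<in>K. \<exists>f\<in>E. k \<otimes> f \<in> N" using finite_stepD(4)[OF st] by blast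
      show ?thesis
      proof (rule that[OF E(1,2)])
        fix k assume k: "k \<in> K"
        obtain e where e: "e \<in> E" "k \<otimes> e \<in> N" using E(3) k by blast
        obtain f where f: "f \<in> F" "k \<otimes> e \<otimes> f \<in> Q" using F(3) e by blast
        have "e \<in> carrier G" "f \<in> carrier G" using e E(2) f F(2) by auto
        then have "k \<otimes> (e \<otimes> f) \<in> Q" using f k by (simp add: m_assoc)
        then show "\<exists>e\<in>E. \<exists>f\<in>F. k \<otimes> (e \<otimes> f) \<in> Q" using e f by blast
      qed
    next
      assume st: "cyclic_step G N K"
      obtain t where t: "t \<in> K" "\<forall>k\<in>K. \<exists>i::int. k \<otimes> t [^] i \<in> N" using cyclic_stepD(5)[OF st] by blast
      have tc: "t \<in> carrier G" using t by simp
      show ?thesis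
      proof (rule that[of "(\<lambda>i::int. t [^] i) ` {0..<int m}"])
        show "(\<lambda>i::int. t [^] i) ` {0..<int m} \<subseteq> K" using subgroup_int_pow_closed[OF D(2) t(1)] by auto
        fix k assume k: "k \<in> K"
        obtain i :: int where i: "k \<otimes> t [^] i \<in> N" using t k by blast
        obtain f where f: "f \<in> F" "k \<otimes> t [^] i \<otimes> f \<in> Q" using F(3) i by blast
        have fc: "f \<in> carrier G" and fK: "f \<in> K" using f F(2) D(3) by auto
        define r where "r = i mod int m"
        define q where "q = i div int m"
        have "t [^] (int m * q) \<in> Q"
          using subgroup_int_pow_closed[OF assms(3) step.prems(1)[OF t(1)], of q] tc
          by (simp add: int_pow_pow int_pow_int[symmetric])
        then have "inv f \<otimes> t [^] (int m * q) \<otimes> inv (inv f) \<in> Q" using step.prems(2) fK by blast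
        then have u: "inv f \<otimes> t [^] (int m * q) \<otimes> f \<in> Q" using fc by simp
        have "i = r + int m * q" by (simp add: r_def q_def)
        then have "t [^] i = t [^] r \<otimes> t [^] (int m * q)" using tc int_pow_mult by metis
        then have "k \<otimes> t [^] i \<otimes> f = (k \<otimes> (t [^] r \<otimes> f)) \<otimes> (inv f \<otimes> t [^] (int m * q) \<otimes> f)"
          using tc fc k by (simp add: m_assoc)
        then have "(k \<otimes> t [^] i \<otimes> f) \<otimes> inv (inv f \<otimes> t [^] (int m * q) \<otimes> f) = k \<otimes> (t [^] r \<otimes> f)"
          using tc fc k by (simp add: m_assoc inv_mult_group)
        moreover have "(k \<otimes> t [^] i \<otimes> f) \<otimes> inv (inv f \<otimes> t [^] (int m * q) \<otimes> f) \<in> Q" using f(2) u by blast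
        ultimately have "k \<otimes> (t [^] r \<otimes> f) \<in> Q" by simp
        moreover have "r \<in> {0..<int m}" using assms(4) by (simp add: r_def)
        ultimately show "\<exists>e\<in>(\<lambda>i::int. t [^] i) ` {0..<int m}. \<exists>f\<in>F. k \<otimes> (e \<otimes> f) \<in> Q" using f(1) by blast
      qed simp
    qed
  qed
  show ?case unfolding covers_def
  proof (intro exI[of _ "(\<lambda>(e, f). e \<otimes> f) ` (E \<times> F)"] conjI ballI)
    show "finite ((\<lambda>(e, f). e \<otimes> f) ` (E \<times> F))" using E F by simp
    show "(\<lambda>(e, f). e \<otimes> f) ` (E \<times> F) \<subseteq> K" using E F D(3) by (auto intro!: K.m_closed)
    fix k assume "k \<in> K"
    then show "\<exists>f\<in>(\<lambda>(e, f). e \<otimes> f) ` (E \<times> F). k \<otimes> f \<in> Q" using E(3) by force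
  qed
qed

text \<open>
  The subgroup generated by the \<open>m\<close>-th powers, with \<open>m\<close> from \<open>covers_exponent\<close>, is characteristic and
  contained in \<open>P\<close>; by \<open>series_torsion_covers\<close> it still has finite index.
\<close>
lemma covers_characteristic:
  fixes G (structure)
  assumes "group G" "series G {\<one>} K" "subgroup K G" "subgroup P G" "covers G P K"
  shows "\<exists>Q. subgroup Q G \<and> Q \<subseteq> P \<and> Q \<subseteq> K \<and> covers G Q K \<and>
    (\<forall>x\<in>carrier G. (\<forall>k\<in>K. x \<otimes> k \<otimes> inv x \<in> K) \<longrightarrow> (\<forall>q\<in>Q. x \<otimes> q \<otimes> inv x \<in> Q))"
proof -
  interpret group G by fact
  interpret K: subgroup K G by fact
  interpret P: subgroup P G by fact
  obtain m :: nat where m: "m > 0" "\<And>k. k \<in> K \<Longrightarrow> k [^] m \<in> P"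
    using covers_exponent[OF assms(1,4,3,5)] by blast
  let ?X = "(\<lambda>k. k [^] m) ` K"
  define Q where "Q = generate G ?X"
  have XG: "?X \<subseteq> carrier G" by auto
  have K_pow: "x [^] (n::nat) \<in> K" if "x \<in> K" for x n
    by (induction n) (use that in auto)
  have Q: "subgroup Q G" unfolding Q_def using XG by (intro generate_is_subgroup)
  have QP: "Q \<subseteq> P" unfolding Q_def by (rule generate_subgroup_incl[OF _ assms(4)]) (use m in auto)
  have QK: "Q \<subseteq> K" unfolding Q_def by (rule generate_subgroup_incl[OF _ assms(3)]) (use K_pow in auto)
  have kQ: "k [^] m \<in> Q" if "k \<in> K" for k unfolding Q_def using that by (intro generate.incl) auto
  have norm: "x \<otimes> q \<otimes> inv x \<in> Q" if x: "x \<in> carrier G" "\<And>k. k \<in> K \<Longrightarrow> x \<otimes> k \<otimes> inv x \<in> K" and q: "q \<in> Q" for x q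
    unfolding Q_def
  proof (rule generate_conj_closed[OF assms(1) XG x(1)])
    show "q \<in> generate G ?X" using q by (simp add: Q_def)
    fix s assume "s \<in> ?X"
    then obtain k where k: "k \<in> K" "s = k [^] m" by blast
    have "(x \<otimes> k \<otimes> inv x) [^] n = x \<otimes> k [^] n \<otimes> inv x" for n :: nat
      using x k(1) by (induction n) (simp_all add: m_assoc)
    then show "x \<otimes> s \<otimes> inv x \<in> generate G ?X" using kQ[OF x(2)[OF k(1)]] k by (simp add: Q_def)
  qed
  have "covers G Q K"
  proof (rule series_torsion_covers[OF assms(1,2) Q m(1)])
    show "k \<otimes> q \<otimes> inv k \<in> Q" if "k \<in> K" "q \<in> Q" for k q
      by (rule norm) (use that in auto)
  qed (rule kQ)
  then show ?thesis using Q QP QK norm by (intro exI[of _ Q]) simp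
qed

lemma cyclic_series_Int:
  assumes "group G" "subgroup M G" "(cyclic_step G)\<^sup>*\<^sup>* A B"
  shows "(cyclic_step G)\<^sup>*\<^sup>* (A \<inter> M) (B \<inter> M)"
  using assms(3)
proof (induction rule: rtranclp_induct)
  case (step N K)
  from step.IH cyclic_step_Int[OF assms(1,2) step.hyps(2)] show ?case by (rule rtranclp.rtrancl_into_rtrancl)
qed simp

text \<open>
  All finite factors can be moved to the top. For a cyclic step from \<open>N\<close> to \<open>K\<close>, replace the polycyclic
  subgroup of finite index in \<open>N\<close> by a characteristic one, \<open>Q\<close>; then \<open>P' = Q \<langle>t\<rangle>\<close> is polycyclic and of finite
  index in \<open>K\<close>.
\<close>
lemma series_virtually_polycyclic:
  fixes G (structure)
  assumes "group G" "series G {\<one>} K"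
  shows "\<exists>P. subgroup P G \<and> P \<subseteq> K \<and> (cyclic_step G)\<^sup>*\<^sup>* {\<one>} P \<and> covers G P K"
  using assms(2)
proof (induction rule: rtranclp_induct)
  case base
  interpret group G by fact
  show ?case unfolding covers_def using triv_subgroup by (intro exI[of _ "{\<one>}"] conjI) auto
next
  case (step N K)
  interpret group G by fact
  note D = series_stepD[OF step.hyps(2)]
  interpret N: subgroup N G by (rule D)
  interpret K: subgroup K G by (rule D)
  obtain P where P: "subgroup P G" "P \<subseteq> N" "(cyclic_step G)\<^sup>*\<^sup>* {\<one>} P" "covers G P N"
    using step.IH by blast
  from step.hyps(2) show ?case unfolding series_step_def
  proof
    assume st: "finite_step G N K"
    obtain E where E: "finite E" "E \<subseteq> K" "\<forall>k\<in>K. \<exists>f\<in>E. k \<otimes> f \<in> N" using finite_stepD(4)[OF st] by blast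
    obtain F where F: "finite F" "F \<subseteq> N" "\<forall>k\<in>N. \<exists>f\<in>F. k \<otimes> f \<in> P" using P(4) unfolding covers_def by blast
    have "covers G P K" unfolding covers_def
    proof (intro exI[of _ "(\<lambda>(e, f). e \<otimes> f) ` (E \<times> F)"] conjI ballI)
      show "finite ((\<lambda>(e, f). e \<otimes> f) ` (E \<times> F))" using E F by simp
      show "(\<lambda>(e, f). e \<otimes> f) ` (E \<times> F) \<subseteq> K" using E F D(3) by (auto intro!: K.m_closed)
      fix k assume k: "k \<in> K"
      obtain e where e: "e \<in> E" "k \<otimes> e \<in> N" using E(3) k by blast
      obtain f where f: "f \<in> F" "k \<otimes> e \<otimes> f \<in> P" using F(3) e by blast
      have "e \<in> carrier G" "f \<in> carrier G" using e E(2) f F(2) by auto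
      then have "k \<otimes> (e \<otimes> f) \<in> P" using f k by (simp add: m_assoc)
      then show "\<exists>f\<in>(\<lambda>(e, f). e \<otimes> f) ` (E \<times> F). k \<otimes> f \<in> P" using e f by force
    qed
    then show ?thesis using P D(3) by blast
  next
    assume st: "cyclic_step G N K"
    obtain t where t: "t \<in> K" "\<forall>k\<in>K. \<exists>i::int. k \<otimes> t [^] i \<in> N" using cyclic_stepD(5)[OF st] by blast
    have tc: "t \<in> carrier G" using t by simp
    have tK: "t [^] i \<in> K" for i :: int using subgroup_int_pow_closed[OF D(2) t(1)] .
    obtain Q where Q: "subgroup Q G" "Q \<subseteq> P" "Q \<subseteq> N" "covers G Q N"
      "\<forall>x\<in>carrier G. (\<forall>k\<in>N. x \<otimes> k \<otimes> inv x \<in> N) \<longrightarrow> (\<forall>q\<in>Q. x \<otimes> q \<otimes> inv x \<in> Q)"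
      using covers_characteristic[OF assms(1) step.hyps(1) D(1) P(1,4)] by blast
    interpret Q: subgroup Q G by (rule Q)
    have norm: "k \<otimes> q \<otimes> inv k \<in> Q" if "k \<in> K" "q \<in> Q" for k q
      using Q(5) K.mem_carrier[OF that(1)] D(4)[OF that(1)] that(2) by blast
    have conj: "inv k \<otimes> q \<otimes> k \<in> Q" if "k \<in> K" "q \<in> Q" for k q
      using norm[of "inv k" q] that by simp
    have "(cyclic_step G)\<^sup>*\<^sup>* ({\<one>} \<inter> Q) (P \<inter> Q)" by (rule cyclic_series_Int[OF assms(1) Q(1) P(3)])
    then have cQ: "(cyclic_step G)\<^sup>*\<^sup>* {\<one>} Q" using Q(2) Q.one_closed by (simp add: Int_absorb1)
    define P' where "P' = {k \<in> K. \<exists>i::int. k \<otimes> t [^] i \<in> Q}"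
    have P': "subgroup P' G"
    proof (rule subgroupI)
      show "P' \<subseteq> carrier G" by (auto simp: P'_def)
      show "P' \<noteq> {}" using Q.one_closed by (auto simp: P'_def intro!: exI[of _ \<one>] exI[of _ "0::int"])
    next
      fix k assume "k \<in> P'"
      then obtain i :: int where k: "k \<in> K" "k \<otimes> t [^] i \<in> Q" by (auto simp: P'_def)
      have "t [^] i \<otimes> (k \<otimes> t [^] i) \<otimes> inv (t [^] i) \<in> Q" using norm[OF tK k(2)] .
      then have "inv (t [^] i \<otimes> k) \<in> Q" using k tc by (simp add: m_assoc)
      then have "inv k \<otimes> t [^] (- i) \<in> Q" using k tc by (simp add: inv_mult_group int_pow_neg)
      then show "inv k \<in> P'" using k by (auto simp: P'_def)
    next
      fix k l assume "k \<in> P'" "l \<in> P'"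
      then obtain i j :: int where k: "k \<in> K" "k \<otimes> t [^] i \<in> Q" and l: "l \<in> K" "l \<otimes> t [^] j \<in> Q"
        by (auto simp: P'_def)
      have "(k \<otimes> (l \<otimes> t [^] j) \<otimes> inv k) \<otimes> (k \<otimes> t [^] i) \<in> Q" using norm[OF k(1) l(2)] k(2) by blast
      then have "k \<otimes> l \<otimes> t [^] (j + i) \<in> Q" using k l tc by (simp add: m_assoc int_pow_mult)
      then show "k \<otimes> l \<in> P'" using k l by (auto simp: P'_def)
    qed
    have QP': "Q \<subseteq> P'" using Q(3) D(3) by (auto simp: P'_def intro!: exI[of _ "0::int"])
    have tP': "t \<in> P'" using t(1) tc Q.one_closed by (auto simp: P'_def int_pow_neg intro!: exI[of _ "-1::int"])
    have "cyclic_step G Q P'" unfolding cyclic_step_def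
    proof (intro conjI ballI Q(1) P' QP' bexI[of _ t] tP')
      show "k \<otimes> q \<otimes> inv k \<in> Q" if "k \<in> P'" "q \<in> Q" for k q using norm that by (auto simp: P'_def)
      show "\<exists>i::int. k \<otimes> t [^] i \<in> Q" if "k \<in> P'" for k using that by (auto simp: P'_def)
    qed
    then have "(cyclic_step G)\<^sup>*\<^sup>* {\<one>} P'" using cQ by (rule rtranclp.rtrancl_into_rtrancl[rotated])
    moreover have "covers G P' K"
    proof -
      obtain F where F: "finite F" "F \<subseteq> N" "\<forall>k\<in>N. \<exists>f\<in>F. k \<otimes> f \<in> Q" using Q(4) unfolding covers_def by blast
      have "\<exists>f\<in>F. k \<otimes> f \<in> P'" if k: "k \<in> K" for k
      proof -
        obtain i :: int where i: "k \<otimes> t [^] i \<in> N" using t k by blast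
        \<comment> \<open>the power of \<open>t\<close> has to stand on the left of \<open>k\<close>: a multiplier \<open>f\<close> taken for \<open>k \<otimes> t [^] i\<close>
          would end up conjugated by \<open>t [^] i\<close>, and there are infinitely many \<open>i\<close>\<close>
        have "t [^] i \<otimes> (k \<otimes> t [^] i) \<otimes> inv (t [^] i) \<in> N" using D(4)[OF tK i] .
        then have "t [^] i \<otimes> k \<in> N" using k tc by (simp add: m_assoc)
        then obtain f where f: "f \<in> F" "t [^] i \<otimes> k \<otimes> f \<in> Q" using F(3) by blast
        have fK: "f \<in> K" and fc: "f \<in> carrier G" using f F(2) D(3) by auto
        have "inv (t [^] i) \<otimes> (t [^] i \<otimes> k \<otimes> f) \<otimes> t [^] i \<in> Q" using conj[OF tK f(2)] .
        then have "k \<otimes> f \<otimes> t [^] i \<in> Q" using k tc fc by (simp add: m_assoc)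
        then have "k \<otimes> f \<in> P'" using k fK by (auto simp: P'_def)
        then show ?thesis using f(1) by blast
      qed
      then show ?thesis unfolding covers_def using F(1,2) D(3) by (intro exI[of _ F]) auto
    qed
    moreover have "P' \<subseteq> K" by (auto simp: P'_def)
    ultimately show ?thesis using P' by blast
  qed
qed

theorem series_imp_polycyclic_by_finite:
  fixes G (structure)
  assumes "group G" "series G {\<one>} (carrier G)"
  shows "polycyclic_by_finite G"
proof -
  interpret group G by fact
  obtain P where P: "subgroup P G" "(cyclic_step G)\<^sup>*\<^sup>* {\<one>} P" "covers G P (carrier G)"
    using series_virtually_polycyclic[OF assms] by blast
  obtain Q where Q: "subgroup Q G" "Q \<subseteq> P" "covers G Q (carrier G)"
    "\<forall>x\<in>carrier G. (\<forall>k\<in>carrier G. x \<otimes> k \<otimes> inv x \<in> carrier G) \<longrightarrow> (\<forall>q\<in>Q. x \<otimes> q \<otimes> inv x \<in> Q)"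
    using covers_characteristic[OF assms subgroup_self P(1,3)] by blast
  interpret Q: subgroup Q G by (rule Q)
  have nor: "Q \<lhd> G" using Q(1,4) by (simp add: normal_inv_iff)
  have "(cyclic_step G)\<^sup>*\<^sup>* ({\<one>} \<inter> Q) (P \<inter> Q)" by (rule cyclic_series_Int[OF assms(1) Q(1) P(2)])
  then have "(cyclic_step G)\<^sup>*\<^sup>* {\<one>} Q" using Q(2) Q.one_closed by (simp add: Int_absorb1)
  then obtain n where "(cyclic_step G ^^ n) {\<one>} Q" using rtranclp_imp_relpowp by fast
  then obtain S where S: "S 0 = {\<one>}" "S n = Q" "\<forall>i<n. cyclic_step G (S i) (S (Suc i))"
    unfolding relpowp_fun_conv by blast
  have "S i \<lhd> (G\<lparr>carrier := S (Suc i)\<rparr>) \<and> cyclic_group ((G\<lparr>carrier := S (Suc i)\<rparr>) Mod S i)" if "i < n" for i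
    using S(3) that cyclic_stepD(2)[of G "S i" "S (Suc i)"] cyclic_step_iff_factor[OF assms(1), of "S (Suc i)" "S i"] by blast
  then have "polycyclic (G\<lparr>carrier := Q\<rparr>)" unfolding polycyclic_def
    using subgroup_imp_group[OF Q(1)] S(1,2) by (intro conjI exI[of _ n] exI[of _ S]) auto
  moreover have "finite (rcosets Q)"
  proof -
    obtain F where F: "finite F" "F \<subseteq> carrier G" "\<forall>k\<in>carrier G. \<exists>f\<in>F. k \<otimes> f \<in> Q"
      using Q(3) unfolding covers_def by blast
    have "rcosets Q \<subseteq> (\<lambda>f. Q #> inv f) ` F"
    proof
      fix C assume "C \<in> rcosets Q"
      then obtain k where k: "k \<in> carrier G" "C = Q #> k" by (auto simp: RCOSETS_def)
      obtain f where f: "f \<in> F" "k \<otimes> f \<in> Q" using F(3) k(1) by blast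
      have fc: "f \<in> carrier G" using f F(2) by auto
      have "k = (k \<otimes> f) \<otimes> inv f" using k(1) fc by (simp add: m_assoc)
      then have "k \<in> Q #> inv f" using f(2) unfolding r_coset_def by blast
      then have "Q #> inv f = Q #> k" using repr_independence[OF _ _ Q(1)] fc by blast
      then show "C \<in> (\<lambda>f. Q #> inv f) ` F" using f(1) k(2) by blast
    qed
    then show ?thesis using F(1) finite_surj by blast
  qed
  ultimately show ?thesis unfolding polycyclic_by_finite_def using nor is_group by blast
qed

section \<open>Generators and relations\<close>
lemma generate_free_gen: "generate (free_group X) (free_gen ` X) = carrier (free_group X)"
proof
  interpret F: group "free_group X" by (rule group_free_group)
  have sub: "free_gen ` X \<subseteq> carrier (free_group X)" by (auto intro: free_gen_closed)
  show "generate (free_group X) (free_gen ` X) \<subseteq> carrier (free_group X)"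
    using F.generate_incl[OF sub] .
  have letter: "[(x, s)] \<in> generate (free_group X) (free_gen ` X)" if x: "x \<in> X" for x s
  proof (cases s)
    case True
    then show ?thesis using x by (auto simp: free_gen_def intro: generate.incl)
  next
    case False
    have "inv\<^bsub>free_group X\<^esub> (free_gen x) = [(x, False)]"
      by (rule F.inv_equality) (use x in \<open>auto simp: free_gen_def free_group_def\<close>)
    then show ?thesis using generate.inv[of "free_gen x" "free_gen ` X" "free_group X"] x False by auto
  qed
  show "carrier (free_group X) \<subseteq> generate (free_group X) (free_gen ` X)"
  proof
    fix w assume "w \<in> carrier (free_group X)"
    then have "reduced w" "set w \<subseteq> X \<times> UNIV" by (auto simp: free_group_def)
    then show "w \<in> generate (free_group X) (free_gen ` X)"
    proof (induction w)
      case Nil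
      then show ?case using generate.one[of "free_group X"] by (simp add: free_group_def)
    next
      case (Cons a w)
      have w: "w \<in> generate (free_group X) (free_gen ` X)" using Cons.IH Cons.prems reduced_tl[of a w] by auto
      obtain x s where a: "a = (x, s)" "x \<in> X" using Cons.prems by (cases a) auto
      have "[a] \<otimes>\<^bsub>free_group X\<^esub> w = a # w"
        using Cons.prems(1) by (cases w) (auto simp: free_group_def)
      then show ?case using generate.eng[OF letter[OF a(2), of s] w] a(1) by simp
    qed
  qed
qed

lemma subset_normal_closure: "S \<subseteq> normal_closure G S"
  unfolding normal_closure_def by blast

lemma generate_FactGroup:
  assumes "N \<lhd> G" "S \<subseteq> carrier G" "generate G S = carrier G"
  shows "generate (G Mod N) ((\<lambda>x. N #>\<^bsub>G\<^esub> x) ` S) = carrier (G Mod N)"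
proof -
  interpret normal N G by fact
  interpret \<pi>: group_hom G "G Mod N" "\<lambda>x. N #>\<^bsub>G\<^esub> x"
    using r_coset_hom_Mod factorgroup_is_group is_group by (simp add: group_hom_def group_hom_axioms_def)
  show ?thesis using \<pi>.generate_img[OF assms(2)] assms(3) by (simp add: carrier_FactGroup)
qed

lemma r_coset_normal_closure_eq:
  assumes "group G" "S \<subseteq> carrier G" "l \<in> carrier G" "r \<in> carrier G" "l \<otimes>\<^bsub>G\<^esub> inv\<^bsub>G\<^esub> r \<in> S"
  shows "normal_closure G S #>\<^bsub>G\<^esub> l = normal_closure G S #>\<^bsub>G\<^esub> r"
proof -
  interpret group G by fact
  interpret N: normal "normal_closure G S" G by (rule normal_closure_normal[OF assms(2)])
  have "l \<otimes>\<^bsub>G\<^esub> inv\<^bsub>G\<^esub> r \<in> normal_closure G S" by (rule subsetD[OF subset_normal_closure assms(5)])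
  then have "(l \<otimes>\<^bsub>G\<^esub> inv\<^bsub>G\<^esub> r) \<otimes>\<^bsub>G\<^esub> r \<in> normal_closure G S #>\<^bsub>G\<^esub> r" unfolding r_coset_def by blast
  then have "l \<in> normal_closure G S #>\<^bsub>G\<^esub> r" using assms(3,4) by (simp add: m_assoc)
  then show ?thesis using repr_independence[OF _ assms(4) N.subgroup_axioms] by simp
qed

context
  fixes X :: "'a set" and E
  assumes E: "E \<subseteq> carrier (free_group X) \<times> carrier (free_group X)"
begin

interpretation F: group "free_group X" by (rule group_free_group)

lemma relators_closed:
  "{l \<otimes>\<^bsub>free_group X\<^esub> inv\<^bsub>free_group X\<^esub> r | l r. (l, r) \<in> E} \<subseteq> carrier (free_group X)"
  using E by blast

lemma relator_closure_normal: "relator_closure X E \<lhd> free_group X"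
  unfolding relator_closure_def by (rule F.normal_closure_normal[OF relators_closed])

lemma presented_hom: "(\<lambda>w. relator_closure X E #>\<^bsub>free_group X\<^esub> w) \<in> hom (free_group X) (presented_group X E)"
  unfolding presented_group_def by (rule normal.r_coset_hom_Mod[OF relator_closure_normal])

lemma presented_relation:
  assumes "(l, r) \<in> E"
  shows "relator_closure X E #>\<^bsub>free_group X\<^esub> l = relator_closure X E #>\<^bsub>free_group X\<^esub> r"
  unfolding relator_closure_def
  by (rule r_coset_normal_closure_eq[OF F.is_group relators_closed]) (use assms E in auto)

lemma presented_mult_gen:
  assumes "x \<in> X" "y \<in> X"
  shows "relator_closure X E #>\<^bsub>free_group X\<^esub> (free_gen x \<otimes>\<^bsub>free_group X\<^esub> free_gen y)
    = presented_gen X E x \<otimes>\<^bsub>presented_group X E\<^esub> presented_gen X E y"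
  unfolding presented_gen_def
  by (rule hom_mult[OF presented_hom free_gen_closed[OF assms(1)] free_gen_closed[OF assms(2)]])

lemma generate_presented_gen:
  "generate (presented_group X E) (presented_gen X E ` X) = carrier (presented_group X E)"
proof -
  have "free_gen ` X \<subseteq> carrier (free_group X)" by (auto intro: free_gen_closed)
  from generate_FactGroup[OF relator_closure_normal this generate_free_gen]
  show ?thesis unfolding presented_group_def presented_gen_def by (simp add: image_image)
qed

end

lemma free_product_rels_closed:
  assumes "group G" "group K"
  shows "free_product_rels G K \<subseteq>
    carrier (free_group (carrier G <+> carrier K)) \<times> carrier (free_group (carrier G <+> carrier K))"
proof -
  interpret G: group G by fact
  interpret K: group K by fact
  interpret F: group "free_group (carrier G <+> carrier K)" by (rule group_free_group)
  show ?thesis by (auto simp: free_product_rels_def Let_def intro!: F.m_closed free_gen_closed)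
qed

lemma free_product_inl_hom:
  assumes "group G" "group K"
  shows "free_product_inl G K \<in> hom G (free_product G K)"
proof (rule homI)
  interpret G: group G by fact
  note C = free_product_rels_closed[OF assms]
  fix x assume x: "x \<in> carrier G"
  then show "free_product_inl G K x \<in> carrier (free_product G K)"
    unfolding free_product_inl_def free_product_def by (intro presented_gen_closed) auto
  fix y assume y: "y \<in> carrier G"
  have "(free_gen (Inl x) \<otimes>\<^bsub>free_group (carrier G <+> carrier K)\<^esub> free_gen (Inl y),
      free_gen (Inl (x \<otimes>\<^bsub>G\<^esub> y))) \<in> free_product_rels G K"
    using x y unfolding free_product_rels_def Let_def by blast
  from presented_relation[OF C this] presented_mult_gen[OF C, of "Inl x" "Inl y"]
  show "free_product_inl G K (x \<otimes>\<^bsub>G\<^esub> y) =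
      free_product_inl G K x \<otimes>\<^bsub>free_product G K\<^esub> free_product_inl G K y"
    using x y unfolding free_product_inl_def free_product_def by (auto simp: presented_gen_def)
qed

lemma free_product_inr_hom:
  assumes "group G" "group K"
  shows "free_product_inr G K \<in> hom K (free_product G K)"
proof (rule homI)
  interpret K: group K by fact
  note C = free_product_rels_closed[OF assms]
  fix x assume x: "x \<in> carrier K"
  then show "free_product_inr G K x \<in> carrier (free_product G K)"
    unfolding free_product_inr_def free_product_def by (intro presented_gen_closed) auto
  fix y assume y: "y \<in> carrier K"
  have "(free_gen (Inr x) \<otimes>\<^bsub>free_group (carrier G <+> carrier K)\<^esub> free_gen (Inr y),
      free_gen (Inr (x \<otimes>\<^bsub>K\<^esub> y))) \<in> free_product_rels G K"
    using x y unfolding free_product_rels_def Let_def by blast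
  from presented_relation[OF C this] presented_mult_gen[OF C, of "Inr x" "Inr y"]
  show "free_product_inr G K (x \<otimes>\<^bsub>K\<^esub> y) =
      free_product_inr G K x \<otimes>\<^bsub>free_product G K\<^esub> free_product_inr G K y"
    using x y unfolding free_product_inr_def free_product_def by (auto simp: presented_gen_def)
qed

lemma generate_free_product:
  assumes "group G" "group K"
  shows "generate (free_product G K)
    (free_product_inl G K ` carrier G \<union> free_product_inr G K ` carrier K) = carrier (free_product G K)"
proof -
  have "free_product_inl G K ` carrier G \<union> free_product_inr G K ` carrier K =
      presented_gen (carrier G <+> carrier K) (free_product_rels G K) ` (carrier G <+> carrier K)"
    unfolding free_product_inl_def free_product_inr_def Plus_def by (simp add: image_Un image_image)
  then show ?thesis
    using generate_presented_gen[OF free_product_rels_closed[OF assms]] by (simp add: free_product_def)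
qed

lemma weak_commutativity_group_pair:
  assumes "group H"
  shows "\<exists>\<alpha> \<beta>. weakly_commuting_pair (weak_commutativity_group H) H \<alpha> \<beta>"
proof -
  let ?P = "free_product H H" and ?X = "weak_commutativity_group H"
  let ?l = "free_product_inl H H" and ?r = "free_product_inr H H"
  let ?S = "{commutator ?P (?l h) (?r h) | h. h \<in> carrier H}"
  interpret H: group H by fact
  interpret P: group ?P by (rule group_free_product[OF assms assms])
  interpret X: group ?X by (rule group_weak_commutativity_group[OF assms])
  have l: "?l \<in> hom H ?P" and r: "?r \<in> hom H ?P"
    using free_product_inl_hom[OF assms assms] free_product_inr_hom[OF assms assms] .
  note lc = hom_in_carrier[OF l] and rc = hom_in_carrier[OF r]
  have S: "?S \<subseteq> carrier ?P" using lc rc by (auto simp: commutator_def)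
  have N: "normal_closure ?P ?S \<lhd> ?P" by (rule P.normal_closure_normal[OF S])
  define \<pi> where "\<pi> = (\<lambda>x. normal_closure ?P ?S #>\<^bsub>?P\<^esub> x)"
  have \<pi>: "\<pi> \<in> hom ?P ?X"
    unfolding \<pi>_def weak_commutativity_group_def by (rule normal.r_coset_hom_Mod[OF N])
  have "weakly_commuting_pair ?X H (\<pi> \<circ> ?l) (\<pi> \<circ> ?r)"
  proof (intro weakly_commuting_pair.intro group_hom.intro group_hom_axioms.intro
      weakly_commuting_pair_axioms.intro X.is_group H.is_group)
    show "\<pi> \<circ> ?l \<in> hom H ?X" "\<pi> \<circ> ?r \<in> hom H ?X" using hom_compose l r \<pi> by blast+
  next
    fix h assume h: "h \<in> carrier H"
    have "(?l h \<otimes>\<^bsub>?P\<^esub> ?r h) = (?r h \<otimes>\<^bsub>?P\<^esub> ?l h) \<otimes>\<^bsub>?P\<^esub> commutator ?P (?l h) (?r h)"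
      using lc[OF h] rc[OF h] by (simp add: commutator_def P.m_assoc)
    moreover have c: "commutator ?P (?l h) (?r h) \<in> ?S" using h by blast
    have "\<pi> (commutator ?P (?l h) (?r h)) = \<pi> \<one>\<^bsub>?P\<^esub>"
      unfolding \<pi>_def
    proof (rule r_coset_normal_closure_eq[OF P.is_group S])
      have "commutator ?P (?l h) (?r h) \<in> carrier ?P" using S c by blast
      then show "commutator ?P (?l h) (?r h) \<in> carrier ?P"
        "commutator ?P (?l h) (?r h) \<otimes>\<^bsub>?P\<^esub> inv\<^bsub>?P\<^esub> \<one>\<^bsub>?P\<^esub> \<in> ?S" using c by simp_all
    qed simp
    then have "\<pi> (commutator ?P (?l h) (?r h)) = \<one>\<^bsub>?X\<^esub>" using hom_one[OF \<pi> P.is_group X.is_group] by simp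
    ultimately have "\<pi> (?l h \<otimes>\<^bsub>?P\<^esub> ?r h) = \<pi> (?r h \<otimes>\<^bsub>?P\<^esub> ?l h)"
      using hom_mult[OF \<pi>, of "?r h \<otimes>\<^bsub>?P\<^esub> ?l h" "commutator ?P (?l h) (?r h)"] S c lc[OF h] rc[OF h]
        hom_in_carrier[OF \<pi>, of "?r h \<otimes>\<^bsub>?P\<^esub> ?l h"] by auto
    then show "(\<pi> \<circ> ?l) h \<otimes>\<^bsub>?X\<^esub> (\<pi> \<circ> ?r) h = (\<pi> \<circ> ?r) h \<otimes>\<^bsub>?X\<^esub> (\<pi> \<circ> ?l) h"
      using hom_mult[OF \<pi>] lc[OF h] rc[OF h] by simp
  next
    have sub: "?l ` carrier H \<union> ?r ` carrier H \<subseteq> carrier ?P" using lc rc by blast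
    show "generate ?X ((\<pi> \<circ> ?l) ` carrier H \<union> (\<pi> \<circ> ?r) ` carrier H) = carrier ?X"
      using generate_FactGroup[OF N sub generate_free_product[OF assms assms]]
      unfolding weak_commutativity_group_def \<pi>_def by (simp add: image_Un image_image comp_def)
  qed
  then show ?thesis by blast
qed

lemma tensor_square_crossed_pairing:
  assumes "group H"
  shows "\<exists>f. crossed_pairing (tensor_square H) H f"
proof -
  interpret H: group H by fact
  let ?X = "carrier H \<times> carrier H" and ?T = "tensor_square H" and ?E = "tensor_square_rels H"
  interpret T: group ?T by (rule group_tensor_square[OF assms])
  interpret F: group "free_group ?X" by (rule group_free_group)
  have C: "?E \<subseteq> carrier (free_group ?X) \<times> carrier (free_group ?X)"
    by (auto simp: tensor_square_rels_def Let_def intro!: F.m_closed free_gen_closed)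
  define f where "f a b = presented_gen ?X ?E (a, b)" for a b
  have "crossed_pairing ?T H f"
  proof (intro crossed_pairing.intro crossed_pairing_axioms.intro T.is_group H.is_group)
    fix a b assume "a \<in> carrier H" "b \<in> carrier H"
    then show "f a b \<in> carrier ?T" unfolding f_def tensor_square_def by (intro presented_gen_closed) auto
  next
    fix a b c assume abc: "a \<in> carrier H" "b \<in> carrier H" "c \<in> carrier H"
    have "(free_gen (a \<otimes>\<^bsub>H\<^esub> b, c),
        free_gen (conjugate H a b, conjugate H c b) \<otimes>\<^bsub>free_group ?X\<^esub> free_gen (b, c)) \<in> ?E"
      using abc unfolding tensor_square_rels_def Let_def by blast
    from presented_relation[OF C this]
      presented_mult_gen[OF C, of "(conjugate H a b, conjugate H c b)" "(b, c)"]
    show "f (a \<otimes>\<^bsub>H\<^esub> b) c = f (conjugate H a b) (conjugate H c b) \<otimes>\<^bsub>?T\<^esub> f b c"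
      using abc unfolding f_def tensor_square_def by (simp add: presented_gen_def)
    have "(free_gen (a, b \<otimes>\<^bsub>H\<^esub> c),
        free_gen (a, c) \<otimes>\<^bsub>free_group ?X\<^esub> free_gen (conjugate H a c, conjugate H b c)) \<in> ?E"
      using abc unfolding tensor_square_rels_def Let_def by blast
    from presented_relation[OF C this]
      presented_mult_gen[OF C, of "(a, c)" "(conjugate H a c, conjugate H b c)"]
    show "f a (b \<otimes>\<^bsub>H\<^esub> c) = f a c \<otimes>\<^bsub>?T\<^esub> f (conjugate H a c) (conjugate H b c)"
      using abc unfolding f_def tensor_square_def by (simp add: presented_gen_def)
  next
    have "{f a b | a b. a \<in> carrier H \<and> b \<in> carrier H} = presented_gen ?X ?E ` ?X"
      unfolding f_def by auto
    then show "generate ?T {f a b | a b. a \<in> carrier H \<and> b \<in> carrier H} = carrier ?T"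
      using generate_presented_gen[OF C] by (simp add: tensor_square_def)
  qed
  then show ?thesis by blast
qed

section \<open>Polycyclic-by-finite groups are closed under both constructions\<close>
theorem theorem1:
  fixes H :: "('a, 'b) monoid_scheme"
  assumes "polycyclic_by_finite H"
  shows "polycyclic_by_finite (weak_commutativity_group H) \<and>
         polycyclic_by_finite (tensor_square H)"
proof -
  have H: "group H" using assms by (simp add: polycyclic_by_finite_def)
  have s: "series H {\<one>\<^bsub>H\<^esub>} (carrier H)" by (rule polycyclic_by_finite_imp_series[OF assms])
  obtain \<alpha> \<beta> where "weakly_commuting_pair (weak_commutativity_group H) H \<alpha> \<beta>"
    using weak_commutativity_group_pair[OF H] by blast
  from weakly_commuting_pair.series_carrier[OF this s]
  have "polycyclic_by_finite (weak_commutativity_group H)"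
    by (rule series_imp_polycyclic_by_finite[OF group_weak_commutativity_group[OF H]])
  moreover obtain f where "crossed_pairing (tensor_square H) H f"
    using tensor_square_crossed_pairing[OF H] by blast
  from crossed_pairing.series_carrier[OF this s]
  have "polycyclic_by_finite (tensor_square H)"
    by (rule series_imp_polycyclic_by_finite[OF group_tensor_square[OF H]])
  ultimately show ?thesis by blast
qed

end
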